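(* Let $0<\tau,T,R,M<\infty$. Suppose that the Cauchy problem for the Boltzmann equation with initial datum $f_0$ has a mild solution $f(t)\in\mathcal{M}_{\tau,+}(R,M)$, $0\le t\le T$. Then, for each $0<\sigma<\tau$, there are some numbers $0<X_*<1$, $0<T_*<\min(1,T)$ and $0<K_i<\infty$, $i=1,2$, depending on $R,M,T,\tau,\sigma$ and $\Lambda=(b_0,\lambda)$, such that, for any $0<\Delta t\le T_*$ and $0<\Delta\mathbf{x}\le X_*$, the discrete approximation $f_{\Delta t,\Delta\mathbf{x}}$ (constructed from $f_0$, the time-step $\Delta t$ and a cell partition $\Pi$ of $\mathbb{R}^3$ with diameter $\Delta\mathbf{x}$) satisfies $$f_{\Delta t,\Delta\mathbf{x}}(t)\in\mathbb{L}^1_+\cap\mathbf{B}_\sigma,\qquad 0\le t<T,$$ and $$\sup_{t\in[0,T]}\|f_{\Delta t,\Delta\mathbf{x}}(t)-f(t)\|_{\mathbb{L}^1}\le K_1\Delta t+K_2\Delta\mathbf{x}.$$ Moreover, for all $0\le t<T$ and $i=0,1,2,3,4$, $$\int_{\mathbb{R}^3\times\mathbb{R}^3}\varphi_i(\mathbf{v})f_{\Delta t,\Delta\mathbf{x}}(t,\mathbf{x},\mathbf{v})\,d\mathbf{x}\,d\mathbf{v}=\int_{\mathbb{R}^3\times\mathbb{R}^3}\varphi_i(\mathbf{v})f_0(\mathbf{x},\mathbf{v})\,d\mathbf{x}\,d\mathbf{v},$$ where $\varphi_0(\mathbf{v})=1$, $\varphi_i(\mathbf{v})=v_i$ for $i=1,2,3$,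 and $\varphi_4(\mathbf{v})=\mathbf{v}^2$.
   Context: Collision operator. $b(|\mathbf{v}-\mathbf{v}_*|,\boldsymbol{\omega})\ge0$ is a given function depending only on $|\mathbf{v}-\mathbf{v}_*|$ and the scalar product $(\mathbf{v}-\mathbf{v}_* )\cdot\boldsymbol{\omega}$ ($\mathbf{v},\mathbf{v}_*\in\mathbb{R}^3$, $\boldsymbol{\omega}\in\mathbb{S}^2$). Throughout, it is assumed that there are constants $b_0>0$ and $0\le\lambda<2$ with $\int_{\mathbb{S}^2}b(|\mathbf{v}-\mathbf{v}_*|,\boldsymbol{\omega})\,d\boldsymbol{\omega}\le b_0|\mathbf{v}-\mathbf{v}_*|^{-\lambda}$; $\Lambda:=(b_0,\lambda)$. With $\mathbf{v}'=\mathbf{v}-((\mathbf{v}-\mathbf{v}_* )\cdot\boldsymbol{\omega})\boldsymbol{\omega}$, $\mathbf{v}'_*=\mathbf{v}_*+((\mathbf{v}-\mathbf{v}_* )\cdot\boldsymbol{\omega})\boldsymbol{\omega}$, $$J_B(g,h)(\mathbf{x},\mathbf{v})=\int_{\mathbb{R}^3\times\mathbb{S}^2}b(|\mathbf{v}-\mathbf{v}_*|,\boldsymbol{\omega})\,[g(\mathbf{x},\mathbf{v}')h(\mathbf{x},\mathbf{v}'_* )-g(\mathbf{x},\mathbf{v})h(\mathbf{x},\mathbf{v}_* )]\,d\mathbf{v}_*d\boldsymbol{\omega},\qquad J(g):=J_B(g,g).$$ Spaces. $\mathbb{L}^1:=\mathbb{L}^1(\mathbb{R}^3\times\mathbb{R}^3;d\mathbf{x}d\mathbf{v})$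 and $\mathbb{L}^\infty:=\mathbb{L}^\infty(\mathbb{R}^3\times\mathbb{R}^3;d\mathbf{x}d\mathbf{v})$ (real); $\mathbb{L}^1_+$ is the positive cone of $\mathbb{L}^1$. For $0\le\alpha<\infty$, $0<\tau<\infty$, $m_{\alpha,\tau}(\mathbf{x},\mathbf{v}):=\exp(-\alpha\mathbf{x}^2-\tau\mathbf{v}^2)$. $\mathbf{B}_\tau$ is the space of $g\in\mathbb{L}^\infty$ with $\|g\|_{\mathbf{B}_\tau}:=\|m_{0,\tau}^{-1}g\|_{\mathbb{L}^\infty}<\infty$; $\mathbf{M}_\tau$ is the space of $g\in\mathbf{B}_\tau$ with $\|g\|_{\mathbf{M}_\tau}:=\|m_{\tau,\tau}^{-1}g\|_{\mathbb{L}^\infty}<\infty$. $(T_{\mathbf{y}}g)(\mathbf{x},\mathbf{v}):=g(\mathbf{x}+\mathbf{y},\mathbf{v})$ for $\mathbf{y}\in\mathbb{R}^3$. $\mathcal{M}_\tau(R,M)$ is the set of $g\in\mathbf{M}_\tau$ with $\|g\|_{\mathbf{M}_\tau}\le R$ and $\|T_{\mathbf{y}}g-g\|_{\mathbf{M}_\tau}\le M|\mathbf{y}|$ for all $|\mathbf{y}|\le1$; $\mathcal{M}_{\tau,+}(R,M):=\{g\in\mathcal{M}_\tau(R,M):g\ge0\}$. Mild solution. $(U^tg)(\mathbf{x},\mathbf{v}):=g(\mathbf{x}-t\mathbf{v},\mathbf{v})$, $t\in\mathbb{R}$. The Cauchy problem is $\partial_tf+\mathbf{v}\cdot\nabla_{\mathbf{x}}f=J(f)$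 in $(0,T)\times\mathbb{R}^3\times\mathbb{R}^3$, $f(0,\mathbf{x},\mathbf{v})=f_0(\mathbf{x},\mathbf{v})$ on $\mathbb{R}^3\times\mathbb{R}^3$. A mild solution on $[0,T]$ in $\mathbb{L}^1$ is an element $f\in C(0,T;\mathbb{L}^1)$ satisfying $f(t)=U^tf_0+\int_0^tU^{t-s}J(f(s))\,ds$, with the integral in the sense of Riemann in $\mathbb{L}^1$ and $J$ defined on its natural domain in $\mathbb{L}^1$. Discrete model. $\Pi=(\pi_l)_{l\in\mathbb{N}}$ is a partition of $\mathbb{R}^3$ into a countable family of distinct cells $\pi_l$ with finite diameter $D(\pi_l)$ and volume $|\pi_l|$, such that the partition diameter $\Delta\mathbf{x}:=\sup_{l\in\mathbb{N}}D(\pi_l)$ is finite. Set $(\pi g)(\mathbf{x},\mathbf{v}):=\sum_{l\in\mathbb{N}}\chi_{\pi_l}(\mathbf{x})\frac1{|\pi_l|}\int_{\pi_l}g(\mathbf{y},\mathbf{v})\,d\mathbf{y}$, where $\chi_{\pi_l}$ is the indicator function of $\pi_l$, and $J^\pi(g):=J_B(g,\pi g)$. For a time-step $0<\Delta t<T$, with $[[\cdot]]$ the integer part, $$\tilde f^0=f_0,\qquad\tilde f^j=U^{\Delta t}\tilde f^{j-1}+\Delta t\,J^\pi(U^{\Delta t}\tilde f^{j-1}),\quad j=1,\dots,[[T/\Delta t]],$$ and $f_{\Delta t,\Delta\mathbf{x}}(t,\mathbf{x},\mathbf{v}):=\sum_{j=1}^{[[T/\Delta t]]}\chi_j(t)\tilde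 f^j(\mathbf{x},\mathbf{v})$ for $0\le t<T$, where $\chi_j$ is the indicator function of the real interval $[(j-1)\Delta t,j\Delta t)$; $f_{\Delta t,\Delta\mathbf{x}}(t):=f_{\Delta t,\Delta\mathbf{x}}(t,\cdot,\cdot)$.
   Formalization: The sum defining the discrete approximation runs to [[T/Δt]]+1 instead of [[T/Δt]], so that its intervals cover [0,T]; with the original range it vanishes on [[[T/Δt]]Δt, T) when Δt does not divide T, where the error bound and conservation fail. *)

theory Defs
  imports "HOL-Probability.Essential_Supremum"
begin

type_synonym space3 = "real ^ 3"
type_synonym phase = "space3 \<times> space3"


section \<open>Function spaces\<close>

text \<open>
  Elements of the Lebesgue spaces are handled through Borel measurable representatives; every
  equality or inequality between such elements is understood almost everywhere. Norms take values
  in \<^typ>\<open>ennreal\<close>, so that they are also meaningful outside the space in question.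
\<close>

definition L1_norm :: "(phase \<Rightarrow> real) \<Rightarrow> ennreal" where
  "L1_norm g = (\<integral>\<^sup>+ z. ennreal \<bar>g z\<bar> \<partial>lborel)"

definition L1 :: "(phase \<Rightarrow> real) set" where
  "L1 = {g. integrable lborel g}"

definition L1_pos :: "(phase \<Rightarrow> real) set" where
  "L1_pos = {g \<in> L1. AE z in lborel. 0 \<le> g z}"

definition Linf_norm :: "(phase \<Rightarrow> real) \<Rightarrow> ennreal" where
  "Linf_norm g = esssup lborel (\<lambda>z. ennreal \<bar>g z\<bar>)"

definition Linf :: "(phase \<Rightarrow> real) set" where
  "Linf = {g \<in> borel_measurable lborel. Linf_norm g < \<infinity>}"

definition weight :: "real \<Rightarrow> real \<Rightarrow> phase \<Rightarrow> real" where
  "weight \<alpha> \<tau> = (\<lambda>(x, v). exp (- \<alpha> * (x \<bullet> x) - \<tau> * (v \<bullet> v)))"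

definition B_norm :: "real \<Rightarrow> (phase \<Rightarrow> real) \<Rightarrow> ennreal" where
  "B_norm \<tau> g = Linf_norm (\<lambda>z. inverse (weight 0 \<tau> z) * g z)"

definition B_space :: "real \<Rightarrow> (phase \<Rightarrow> real) set" where
  "B_space \<tau> = {g \<in> Linf. B_norm \<tau> g < \<infinity>}"

definition M_norm :: "real \<Rightarrow> (phase \<Rightarrow> real) \<Rightarrow> ennreal" where
  "M_norm \<tau> g = Linf_norm (\<lambda>z. inverse (weight \<tau> \<tau> z) * g z)"

definition M_space :: "real \<Rightarrow> (phase \<Rightarrow> real) set" where
  "M_space \<tau> = {g \<in> B_space \<tau>. M_norm \<tau> g < \<infinity>}"

definition translate :: "space3 \<Rightarrow> (phase \<Rightarrow> real) \<Rightarrow> phase \<Rightarrow> real" where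
  "translate y g = (\<lambda>(x, v). g (x + y, v))"

definition M_set :: "real \<Rightarrow> real \<Rightarrow> real \<Rightarrow> (phase \<Rightarrow> real) set" where
  "M_set \<tau> R M = {g \<in> M_space \<tau>. M_norm \<tau> g \<le> ennreal R \<and>
     (\<forall>y. norm y \<le> 1 \<longrightarrow> M_norm \<tau> (\<lambda>z. translate y g z - g z) \<le> ennreal (M * norm y))}"

definition M_set_pos :: "real \<Rightarrow> real \<Rightarrow> real \<Rightarrow> (phase \<Rightarrow> real) set" where
  "M_set_pos \<tau> R M = {g \<in> M_set \<tau> R M. AE z in lborel. 0 \<le> g z}"


section \<open>Collision operator\<close>

text \<open>
  The surface measure of the unit sphere is obtained from Lebesgue measure in polar coordinates:
  the surface area of \<open>A\<close> is three times the volume of the cone \<open>{r \<omega> | 0 < r \<le> 1, \<omega> \<in> A}\<close>.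
  Note that \<^term>\<open>sgn x\<close> is \<open>x / norm x\<close>.
\<close>

definition sphere_measure :: "space3 measure" where
  "sphere_measure = scale_measure 3
     (distr (restrict_space lborel (cball 0 1 - {0})) (restrict_space borel (sphere 0 1)) sgn)"

lemma measurable_sgn_sphere:
  "sgn \<in> restrict_space lborel (cball 0 1 - {0}) \<rightarrow>\<^sub>M restrict_space borel (sphere (0::space3) 1)"
proof (rule measurable_restrict_space2)
  show "sgn \<in> space (restrict_space lborel (cball 0 1 - {0})) \<rightarrow> sphere (0::space3) 1"
    by (auto simp: space_restrict_space norm_sgn)
  have "(sgn :: space3 \<Rightarrow> space3) \<in> borel_measurable lborel"
    unfolding sgn_div_norm[abs_def] by measurable
  then show "(sgn :: space3 \<Rightarrow> space3) \<in> borel_measurable (restrict_space lborel (cball 0 1 - {0}))"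
    by (rule measurable_restrict_space1)
qed

lemma emeasure_sphere_measure: "emeasure sphere_measure (sphere 0 1) = ennreal (4 * pi)"
proof -
  let ?C = "cball 0 1 - {0} :: space3 set"
  have "emeasure (distr (restrict_space lborel ?C) (restrict_space borel (sphere 0 1)) sgn) (sphere 0 1)
      = emeasure (restrict_space lborel ?C) (sgn -` sphere 0 1 \<inter> space (restrict_space lborel ?C))"
    by (rule emeasure_distr[OF measurable_sgn_sphere]) (auto simp: sets_restrict_space)
  also have "sgn -` sphere 0 1 \<inter> space (restrict_space lborel ?C) = ?C"
    by (auto simp: space_restrict_space norm_sgn)
  also have "emeasure (restrict_space lborel ?C) ?C = emeasure lborel ?C"
    by (rule emeasure_restrict_space) auto
  also have "\<dots> = emeasure lborel (cball 0 1 :: space3 set)"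
    by (rule emeasure_Diff_null_set) auto
  also have "\<dots> = ennreal (4 / 3 * pi)"
    using emeasure_cball[of 1 "0::space3"] unit_ball_vol_3 by simp
  finally show ?thesis
    unfolding sphere_measure_def emeasure_scale_measure
    by (simp add: ennreal_mult[symmetric] flip: ennreal_numeral)
qed

text \<open>
  A kernel depending only on \<open>\<bar>v - v\<^sub>*\<bar>\<close> and \<open>(v - v\<^sub>*) \<bullet> \<omega>\<close> is given as a function of these two
  numbers, which range over the pairs \<open>(r, s)\<close> with \<open>\<bar>s\<bar> \<le> r\<close>. The case \<open>V = 0\<close>, in which
  \<^term>\<open>norm V powr (- lam)\<close> is \<open>0\<close> instead of \<open>\<infinity>\<close>, is left out of the bound.
\<close>

definition collision_kernel :: "(real \<Rightarrow> real \<Rightarrow> real) \<Rightarrow> real \<Rightarrow> real \<Rightarrow> bool" where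
  "collision_kernel b b0 lam \<longleftrightarrow>
     (\<lambda>(r, s). b r s) \<in> borel_measurable (restrict_space borel {(r, s). \<bar>s\<bar> \<le> r}) \<and>
     (\<forall>r s. \<bar>s\<bar> \<le> r \<longrightarrow> 0 \<le> b r s) \<and>
     (\<forall>V::space3. V \<noteq> 0 \<longrightarrow>
        (\<integral>\<^sup>+ \<omega>. ennreal (b (norm V) (V \<bullet> \<omega>)) \<partial>sphere_measure) \<le> ennreal (b0 * norm V powr (- lam)))"

definition post1 :: "space3 \<Rightarrow> space3 \<Rightarrow> space3 \<Rightarrow> space3" where
  "post1 v vs \<omega> = v - ((v - vs) \<bullet> \<omega>) *\<^sub>R \<omega>"

definition post2 :: "space3 \<Rightarrow> space3 \<Rightarrow> space3 \<Rightarrow> space3" where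
  "post2 v vs \<omega> = vs + ((v - vs) \<bullet> \<omega>) *\<^sub>R \<omega>"

definition collision_integrand ::
  "(real \<Rightarrow> real \<Rightarrow> real) \<Rightarrow> (phase \<Rightarrow> real) \<Rightarrow> (phase \<Rightarrow> real) \<Rightarrow> phase \<Rightarrow> space3 \<times> space3 \<Rightarrow> real" where
  "collision_integrand b g h = (\<lambda>(x, v) (vs, \<omega>). b (norm (v - vs)) ((v - vs) \<bullet> \<omega>) *
     (g (x, post1 v vs \<omega>) * h (x, post2 v vs \<omega>) - g (x, v) * h (x, vs)))"

definition J_B ::
  "(real \<Rightarrow> real \<Rightarrow> real) \<Rightarrow> (phase \<Rightarrow> real) \<Rightarrow> (phase \<Rightarrow> real) \<Rightarrow> phase \<Rightarrow> real" where
  "J_B b g h z = (LINT p|(lborel \<Otimes>\<^sub>M sphere_measure). collision_integrand b g h z p)"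

definition J :: "(real \<Rightarrow> real \<Rightarrow> real) \<Rightarrow> (phase \<Rightarrow> real) \<Rightarrow> phase \<Rightarrow> real" where
  "J b g = J_B b g g"

definition J_domain :: "(real \<Rightarrow> real \<Rightarrow> real) \<Rightarrow> (phase \<Rightarrow> real) set" where
  "J_domain b = {g \<in> L1.
     (AE z in lborel. integrable (lborel \<Otimes>\<^sub>M sphere_measure) (collision_integrand b g g z)) \<and>
     J b g \<in> L1}"


section \<open>Mild solutions\<close>

definition free_flow :: "real \<Rightarrow> (phase \<Rightarrow> real) \<Rightarrow> phase \<Rightarrow> real" where
  "free_flow t g = (\<lambda>(x, v). g (x - t *\<^sub>R v, v))"

text \<open>
  Riemann integral of an \<open>L\<^sup>1\<close>-valued function: the constant gauge of radius \<open>\<delta>\<close> bounds the mesh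
  of the tagged division (a non-constant gauge would give the Henstock-Kurzweil integral).
\<close>

definition has_riemann_integral_L1 ::
  "(real \<Rightarrow> phase \<Rightarrow> real) \<Rightarrow> (phase \<Rightarrow> real) \<Rightarrow> real \<Rightarrow> real \<Rightarrow> bool" where
  "has_riemann_integral_L1 u I a c \<longleftrightarrow>
     (\<forall>s\<in>{a..c}. u s \<in> L1) \<and> I \<in> L1 \<and>
     (\<forall>\<epsilon>>0. \<exists>\<delta>>0. \<forall>p. p tagged_division_of {a..c} \<and> (\<lambda>s. ball s \<delta>) fine p \<longrightarrow>
        L1_norm (\<lambda>z. (\<Sum>(s, k)\<in>p. measure lborel k * u s z) - I z) < ennreal \<epsilon>)"

definition mild_solution ::
  "(real \<Rightarrow> real \<Rightarrow> real) \<Rightarrow> real \<Rightarrow> (phase \<Rightarrow> real) \<Rightarrow> (real \<Rightarrow> phase \<Rightarrow> real) \<Rightarrow> bool" where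
  "mild_solution b T f0 f \<longleftrightarrow>
     f0 \<in> L1 \<and>
     (\<forall>t\<in>{0..T}. f t \<in> L1) \<and>
     (\<forall>t\<in>{0..T}. ((\<lambda>s. L1_norm (\<lambda>z. f s z - f t z)) \<longlongrightarrow> 0) (at t within {0..T})) \<and>
     (\<forall>t\<in>{0..T}. f t \<in> J_domain b) \<and>
     (\<forall>t\<in>{0..T}. \<exists>I. has_riemann_integral_L1 (\<lambda>s. free_flow (t - s) (J b (f s))) I 0 t \<and>
        (AE z in lborel. f t z = free_flow t f0 z + I z))"


section \<open>Discrete model\<close>

definition cell_partition :: "(nat \<Rightarrow> space3 set) \<Rightarrow> bool" where
  "cell_partition P \<longleftrightarrow>
     (\<forall>l. P l \<in> sets borel \<and> bounded (P l) \<and> 0 < measure lborel (P l)) \<and>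
     disjoint_family P \<and> (\<Union>l. P l) = UNIV \<and>
     bdd_above (range (\<lambda>l. diameter (P l)))"

definition partition_diameter :: "(nat \<Rightarrow> space3 set) \<Rightarrow> real" where
  "partition_diameter P = (SUP l. diameter (P l))"

definition cell_average :: "(nat \<Rightarrow> space3 set) \<Rightarrow> (phase \<Rightarrow> real) \<Rightarrow> phase \<Rightarrow> real" where
  "cell_average P g = (\<lambda>(x, v).
     \<Sum>l. indicator (P l) x * (1 / measure lborel (P l)) * (LINT y:P l|lborel. g (y, v)))"

definition J_cell ::
  "(real \<Rightarrow> real \<Rightarrow> real) \<Rightarrow> (nat \<Rightarrow> space3 set) \<Rightarrow> (phase \<Rightarrow> real) \<Rightarrow> phase \<Rightarrow> real" where
  "J_cell b P g = J_B b g (cell_average P g)"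

primrec scheme ::
  "(real \<Rightarrow> real \<Rightarrow> real) \<Rightarrow> (nat \<Rightarrow> space3 set) \<Rightarrow> real \<Rightarrow> (phase \<Rightarrow> real) \<Rightarrow> nat \<Rightarrow> phase \<Rightarrow> real" where
  "scheme b P dt f0 0 = f0"
| "scheme b P dt f0 (Suc j) =
     (\<lambda>z. free_flow dt (scheme b P dt f0 j) z + dt * J_cell b P (free_flow dt (scheme b P dt f0 j)) z)"

text \<open>
  The sum runs up to \<open>\<lfloor>T / dt\<rfloor> + 1\<close>, the least number of steps for which the time intervals cover
  \<open>[0, T]\<close>. Stopping at \<open>\<lfloor>T / dt\<rfloor>\<close> gives the same function for \<open>t < \<lfloor>T / dt\<rfloor> dt\<close>, but one that is
  identically zero for the remaining times up to \<open>T\<close>, where it neither approximates a nonzero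
  solution nor conserves its mass; see the two lemmas below.
\<close>

definition discrete_approx ::
  "(real \<Rightarrow> real \<Rightarrow> real) \<Rightarrow> (nat \<Rightarrow> space3 set) \<Rightarrow> real \<Rightarrow> real \<Rightarrow> (phase \<Rightarrow> real) \<Rightarrow> real \<Rightarrow> phase \<Rightarrow> real" where
  "discrete_approx b P T dt f0 t z =
     (\<Sum>j = 1..nat \<lfloor>T / dt\<rfloor> + 1. indicator {(real j - 1) * dt..<real j * dt} t * scheme b P dt f0 j z)"

lemma discrete_approx_floor:
  assumes "t < real (nat \<lfloor>T / dt\<rfloor>) * dt"
  shows "discrete_approx b P T dt f0 t z =
     (\<Sum>j = 1..nat \<lfloor>T / dt\<rfloor>. indicator {(real j - 1) * dt..<real j * dt} t * scheme b P dt f0 j z)"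
  using assms by (simp add: discrete_approx_def)

lemma floor_sum_vanishes:
  assumes "0 < dt" and "real (nat \<lfloor>T / dt\<rfloor>) * dt \<le> t"
  shows "(\<Sum>j = 1..nat \<lfloor>T / dt\<rfloor>.
     indicator {(real j - 1) * dt..<real j * dt} t * scheme b P dt f0 j z) = 0"
proof (rule sum.neutral, rule ballI)
  fix j assume "j \<in> {1..nat \<lfloor>T / dt\<rfloor>}"
  then have "real j * dt \<le> real (nat \<lfloor>T / dt\<rfloor>) * dt"
    using assms(1) by (intro mult_right_mono) auto
  then have "real j * dt \<le> t"
    using assms(2) by linarith
  then show "indicator {(real j - 1) * dt..<real j * dt} t * scheme b P dt f0 j z = 0"
    by simp
qed

definition invariant :: "nat \<Rightarrow> space3 \<Rightarrow> real" where
  "invariant i v = (if i = 0 then 1 else if i = 1 then v $ 1 else if i = 2 then v $ 2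
     else if i = 3 then v $ 3 else v \<bullet> v)"

end

theory Submission
  imports Defs
begin

text \<open>
  All estimates are made in the supremum norm with the weight
  \<open>W\<^bsub>s,t\<^esub>(x, v) = exp (- s \<bar>v\<bar>\<^sup>2 - \<bar>x - t v\<bar>)\<close>, called \<open>flow_weight s t\<close>; a function bounded by a multiple of it is
  called dominated. This one norm replaces both norms of the theorem: the weight is integrable with an integral
  independent of \<open>t\<close>, so it controls the \<open>L\<^sup>1\<close> norm, and it is at most \<open>exp (- s \<bar>v\<bar>\<^sup>2)\<close>, so it controls the norm
  of \<open>B_space s\<close>. It suits each of the three operations of the scheme.

  \<^item> The free flow over a time \<open>q\<close> maps \<open>W\<^bsub>s,t\<^esub>\<close> to \<open>W\<^bsub>s,t+q\<^esub>\<close>.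

  \<^item> In a collision, conservation of momentum and energy preserves
    \<open>\<bar>v\<bar>\<^sup>2 + \<bar>v\<^sub>*\<bar>\<^sup>2\<close> and \<open>\<bar>x - t v\<bar>\<^sup>2 + \<bar>x - t v\<^sub>*\<bar>\<^sup>2\<close>. So the product of the weights after the collision is
    at most \<open>W\<^bsub>s,t\<^esub>(x, v) exp (- s \<bar>v\<^sub>*\<bar>\<^sup>2)\<close> (\<open>flow_weight_reachable\<close>), and as \<open>\<bar>v - v\<^sub>*\<bar>\<^bsup>- lam\<^esup>\<close> is locally integrable,
    the collision operator is a bounded bilinear map (\<open>J_B_dominated\<close>, \<open>J_B_diff_dominated\<close>).

  \<^item> The average over a cell of diameter at most \<open>1\<close> changes the weight by at most a factor \<open>exp 1\<close>
    (\<open>cell_average_dominated\<close>).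

  The error is then estimated as for an ordinary differential equation. The solution has a representative that
  is Lipschitz continuous in the position everywhere (\<open>M_set_pos_representative\<close>). Hence averaging it over
  the cells costs \<open>O(\<Delta>x)\<close>, and one time step started at the exact solution costs \<open>O(\<Delta>t\<^sup>2)\<close>
  (\<open>solution_local_error\<close>): over a time \<open>\<Delta>t\<close>, transport and collisions commute up to \<open>O(\<Delta>t)\<close>, because the velocities that
  meet in a collision at one point come from points at a distance \<open>O(\<Delta>t)\<close>. That distance grows with the velocities, which
  takes up some of the Gaussian decay, and so does the bound of the solution by the weight (\<open>weight_le_flow_weight\<close>);
  the hypothesis \<open>\<sigma> < \<tau>\<close> provides this surplus. The collision operator is quadratic, so stability holds only on bounded sets; the iterates stay bounded up to time \<open>T\<close>
  since the induction in \<open>scheme_error\<close> shows at the same time that they remain within distance \<open>1\<close> of the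
  solution, provided that \<open>\<Delta>t\<close> and \<open>\<Delta>x\<close> are small.

  The scheme preserves positivity because the loss term is the density times a bounded frequency, which a small
  time step multiplies by less than \<open>1\<close> (\<open>step_nonneg\<close>). It conserves mass, momentum and
  energy because the collision map preserves the measure (\<open>distr_collide\<close>) and averaging over the cells is
  self-adjoint, so that the product of a density with its average is symmetric in the two velocities after
  integration over the position (\<open>cell_average_symmetric\<close>, \<open>J_cell_conservation\<close>).
\<close>

section \<open>Collisions preserve the measure on pairs of velocities\<close>

lemma sets_sphere_measure: "sets sphere_measure = sets (restrict_space borel (sphere 0 1))"
  by (simp add: sphere_measure_def)

lemma space_sphere_measure: "space sphere_measure = sphere 0 1"
  using sets_eq_imp_space_eq[OF sets_sphere_measure] by (simp add: space_restrict_space)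

lemma finite_measure_sphere: "finite_measure sphere_measure"
  by (rule finite_measureI) (simp add: space_sphere_measure emeasure_sphere_measure)

interpretation sphere: finite_measure sphere_measure
  by (rule finite_measure_sphere)

abbreviation partner_measure :: "(space3 \<times> space3) measure" where
  "partner_measure \<equiv> lborel \<Otimes>\<^sub>M sphere_measure"

interpretation vel_sphere: pair_sigma_finite "lborel :: space3 measure" sphere_measure ..

interpretation vel_vel_sphere: pair_sigma_finite "lborel :: space3 measure" "partner_measure"
  by (intro pair_sigma_finite.intro lborel.sigma_finite_measure_axioms sigma_finite_pair_measure sphere.sigma_finite_measure_axioms)

lemma measurable_sphere_borel: "(\<lambda>w. w) \<in> borel_measurable sphere_measure"
  unfolding measurable_cong_sets[OF sets_sphere_measure refl]
  by (rule measurable_restrict_space1) simp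

lemma measurable_sphere_uminus: "uminus \<in> sphere_measure \<rightarrow>\<^sub>M sphere_measure"
  unfolding measurable_cong_sets[OF sets_sphere_measure sets_sphere_measure]
  by (rule measurable_restrict_space3) auto

lemma lborel_distr_uminus_euclidean: "distr lborel borel uminus = (lborel :: 'a::euclidean_space measure)"
  by (subst lborel_affine[of "-1" 0]) (auto simp: density_1 one_ennreal_def[symmetric])

text \<open>
  Needed because a collision reverses the sign of \<open>(v - v\<^sub>*) \<bullet> \<omega>\<close>, on which the kernel may depend, while
  \<open>\<omega>\<close> and \<open>- \<omega>\<close> lead to the same velocities.
\<close>

lemma distr_sphere_measure_uminus: "distr sphere_measure sphere_measure uminus = sphere_measure"
proof (rule measure_eqI)
  let ?C = "cball 0 1 - {0} :: space3 set"
  let ?L = "restrict_space lborel ?C"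
  have sgn: "sgn \<in> ?L \<rightarrow>\<^sub>M restrict_space borel (sphere 0 1)" by (rule measurable_sgn_sphere)
  have sets_L: "S \<in> sets ?L \<longleftrightarrow> S \<subseteq> ?C \<and> S \<in> sets lborel" for S
    by (auto simp: sets_restrict_space_iff)
  fix A assume "A \<in> sets (distr sphere_measure sphere_measure uminus)"
  then have A: "A \<in> sets (restrict_space borel (sphere 0 1))" "A \<in> sets sphere_measure"
    by (auto simp: sets_sphere_measure)
  have sph: "emeasure sphere_measure B = 3 * emeasure lborel (sgn -` B \<inter> ?C)"
    if B: "B \<in> sets (restrict_space borel (sphere 0 1))" for B
  proof -
    have "sgn -` B \<inter> space ?L \<in> sets ?L"
      by (rule measurable_sets[OF sgn B])
    then have "sgn -` B \<inter> ?C \<in> sets ?L" by (simp add: space_restrict_space)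
    then show ?thesis
      unfolding sphere_measure_def emeasure_scale_measure
      by (subst emeasure_distr[OF sgn B])
        (simp add: space_restrict_space emeasure_restrict_space sets_L)
  qed
  let ?A' = "uminus -` A \<inter> sphere 0 1"
  have A': "?A' \<in> sets (restrict_space borel (sphere 0 1))"
    using measurable_sets[OF measurable_sphere_uminus A(2)]
    by (simp add: space_sphere_measure sets_sphere_measure)
  have mA: "sgn -` A \<inter> ?C \<in> sets lborel"
    using measurable_sets[OF sgn A(1)] by (simp add: space_restrict_space sets_L)
  have "emeasure (distr sphere_measure sphere_measure uminus) A = emeasure sphere_measure ?A'"
    by (subst emeasure_distr[OF measurable_sphere_uminus A(2)]) (simp add: space_sphere_measure)
  also have "\<dots> = 3 * emeasure lborel (sgn -` ?A' \<inter> ?C)"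
    by (rule sph[OF A'])
  also have "sgn -` ?A' \<inter> ?C = uminus -` (sgn -` A \<inter> ?C)"
    by (auto simp: sgn_minus norm_sgn)
  also have "emeasure lborel (uminus -` (sgn -` A \<inter> ?C)) = emeasure (distr lborel borel uminus) (sgn -` A \<inter> ?C)"
    using mA by (subst emeasure_distr) auto
  also have "\<dots> = emeasure lborel (sgn -` A \<inter> ?C)"
    by (simp add: lborel_distr_uminus_euclidean)
  also have "3 * \<dots> = emeasure sphere_measure A"
    by (rule sph[OF A(1), symmetric])
  finally show "emeasure (distr sphere_measure sphere_measure uminus) A = emeasure sphere_measure A" .
qed simp

lemma reflection_preserves_lborel:
  fixes w :: space3
  assumes w: "norm w = 1"
  shows "distr lborel borel (\<lambda>v. v - (2 * (v \<bullet> w)) *\<^sub>R w) = lborel"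
proof (rule lborel_eqI[symmetric])
  let ?r = "\<lambda>v. v - (2 * (v \<bullet> w)) *\<^sub>R w"
  have ww: "w \<bullet> w = 1" using w by (simp add: norm_eq_1)
  have lin: "linear ?r"
    by (rule linearI) (auto simp: algebra_simps inner_add_left)
  have orth: "orthogonal_transformation ?r"
    unfolding orthogonal_transformation_def
    using lin ww by (auto simp: inner_diff_left inner_diff_right inner_commute)
  have inv: "?r (?r v) = v" for v
    using ww by (simp add: algebra_simps inner_diff_left)
  have meas: "?r \<in> borel_measurable lborel"
    by (simp del: measurable_lborel1 add: borel_measurable_continuous_onI continuous_intros)
  fix l u :: space3
  assume le: "\<And>b. b \<in> Basis \<Longrightarrow> l \<bullet> b \<le> u \<bullet> b"
  have pre: "?r -` box l u = ?r ` box l u"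
  proof (intro set_eqI iffI)
    fix x assume "x \<in> ?r -` box l u"
    then show "x \<in> ?r ` box l u" using inv[of x] by (intro image_eqI[of _ _ "?r x"]) auto
  next
    fix x assume "x \<in> ?r ` box l u"
    then obtain v where "x = ?r v" "v \<in> box l u" by blast
    then show "x \<in> ?r -` box l u" unfolding vimage_def mem_Collect_eq by (metis inv)
  qed
  have m: "?r -` box l u \<in> sets lborel"
    using measurable_sets[OF meas, of "box l u"] by simp
  have lm: "box l u \<in> lmeasurable" by simp
  have "emeasure (distr lborel borel ?r) (box l u) = emeasure lborel (?r -` box l u)"
    using meas by (subst emeasure_distr) auto
  also have "\<dots> = emeasure lebesgue (?r ` box l u)" using m pre by (simp add: emeasure_completion)
  also have "\<dots> = ennreal (measure lebesgue (?r ` box l u))"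
    using measurable_orthogonal_image[OF orth lm] by (simp add: emeasure_eq_measure2 fmeasurableD)
  also have "\<dots> = ennreal (measure lebesgue (box l u))"
    by (simp only: measure_orthogonal_image[OF orth lm])
  also have "\<dots> = (\<Prod>b\<in>Basis. (u - l) \<bullet> b)"
    using emeasure_lborel_box[of l u] le emeasure_eq_measure2[OF lm]
    by (simp add: emeasure_completion)
  finally show "emeasure (distr lborel borel ?r) (box l u) = (\<Prod>b\<in>Basis. (u - l) \<bullet> b)" .
qed simp

lemma nn_integral_lborel_shift:
  fixes F :: "'a::euclidean_space \<Rightarrow> ennreal"
  assumes [measurable]: "F \<in> borel_measurable borel"
  shows "(\<integral>\<^sup>+ x. F (c + x) \<partial>lborel) = (\<integral>\<^sup>+ x. F x \<partial>lborel)"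
proof -
  have "(\<integral>\<^sup>+ x. F x \<partial>lborel) = (\<integral>\<^sup>+ x. F x \<partial>distr lborel borel ((+) c))"
    by (simp add: lborel_distr_plus)
  also have "\<dots> = (\<integral>\<^sup>+ x. F (c + x) \<partial>lborel)"
    by (subst nn_integral_distr) auto
  finally show ?thesis by simp
qed

lemma nn_integral_lborel_swap:
  fixes F :: "space3 \<Rightarrow> space3 \<Rightarrow> ennreal"
  assumes [measurable]: "(\<lambda>(x, y). F x y) \<in> borel_measurable (borel \<Otimes>\<^sub>M borel)"
  shows "(\<integral>\<^sup>+ x. \<integral>\<^sup>+ y. F x y \<partial>lborel \<partial>lborel) = (\<integral>\<^sup>+ y. \<integral>\<^sup>+ x. F x y \<partial>lborel \<partial>lborel)"
proof -
  have [measurable]: "(\<lambda>(x, y). F x y) \<in> borel_measurable (lborel \<Otimes>\<^sub>M lborel)"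
    using assms by (simp cong: measurable_cong_sets add: sets_pair_measure_cong[OF sets_lborel sets_lborel])
  show ?thesis
    by (rule lborel_pair.Fubini'[symmetric]) measurable
qed

text \<open>
  In terms of the relative velocity \<open>V = v - v\<^sub>*\<close> and \<open>v\<^sub>*\<close>, a collision is the shear
  \<open>v\<^sub>* \<mapsto> v\<^sub>* + (V \<bullet> \<omega>) \<omega>\<close> composed with the reflection of \<open>V\<close> in the plane orthogonal to \<open>\<omega>\<close>.
\<close>

lemma nn_integral_collision:
  fixes G :: "space3 \<Rightarrow> space3 \<Rightarrow> ennreal"
  assumes G: "(\<lambda>(x, y). G x y) \<in> borel_measurable (borel \<Otimes>\<^sub>M borel)" and w: "norm w = 1"
  shows "(\<integral>\<^sup>+ v. \<integral>\<^sup>+ vs. G (post1 v vs w) (post2 v vs w) \<partial>lborel \<partial>lborel)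
       = (\<integral>\<^sup>+ v. \<integral>\<^sup>+ vs. G v vs \<partial>lborel \<partial>lborel)"
proof -
  have M: "(\<lambda>p. G (g p) (h p)) \<in> borel_measurable N" if "g \<in> borel_measurable N" "h \<in> borel_measurable N" for g h N
    using measurable_compose[OF measurable_Pair[OF that] G] by simp
  have "(\<integral>\<^sup>+ v. \<integral>\<^sup>+ vs. G (post1 v vs w) (post2 v vs w) \<partial>lborel \<partial>lborel)
      = (\<integral>\<^sup>+ vs. \<integral>\<^sup>+ v. G (v - ((v - vs) \<bullet> w) *\<^sub>R w) (vs + ((v - vs) \<bullet> w) *\<^sub>R w) \<partial>lborel \<partial>lborel)"
    unfolding post1_def post2_def
    by (rule nn_integral_lborel_swap) (simp only: split_def, rule M; measurable)
  also have "\<dots> = (\<integral>\<^sup>+ vs. \<integral>\<^sup>+ V. G (vs + V - (V \<bullet> w) *\<^sub>R w) (vs + (V \<bullet> w) *\<^sub>R w) \<partial>lborel \<partial>lborel)"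
  proof (rule nn_integral_cong)
    fix vs :: space3
    have "(\<lambda>v. G (v - ((v - vs) \<bullet> w) *\<^sub>R w) (vs + ((v - vs) \<bullet> w) *\<^sub>R w)) \<in> borel_measurable borel"
      by (rule M) measurable
    from nn_integral_lborel_shift[OF this, of vs, symmetric]
    show "(\<integral>\<^sup>+ v. G (v - ((v - vs) \<bullet> w) *\<^sub>R w) (vs + ((v - vs) \<bullet> w) *\<^sub>R w) \<partial>lborel)
        = (\<integral>\<^sup>+ V. G (vs + V - (V \<bullet> w) *\<^sub>R w) (vs + (V \<bullet> w) *\<^sub>R w) \<partial>lborel)"
      by simp
  qed
  also have "\<dots> = (\<integral>\<^sup>+ V. \<integral>\<^sup>+ vs. G (vs + V - (V \<bullet> w) *\<^sub>R w) (vs + (V \<bullet> w) *\<^sub>R w) \<partial>lborel \<partial>lborel)"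
    by (rule nn_integral_lborel_swap) (simp only: split_def, rule M; measurable)
  also have "\<dots> = (\<integral>\<^sup>+ V. \<integral>\<^sup>+ vs. G (vs + (V - (2 * (V \<bullet> w)) *\<^sub>R w)) vs \<partial>lborel \<partial>lborel)"
  proof (rule nn_integral_cong)
    fix V :: space3
    have "(\<lambda>vs. G (vs + V - (V \<bullet> w) *\<^sub>R w) (vs + (V \<bullet> w) *\<^sub>R w)) \<in> borel_measurable borel"
      by (rule M) measurable
    from nn_integral_lborel_shift[OF this, of "- ((V \<bullet> w) *\<^sub>R w)", symmetric]
    show "(\<integral>\<^sup>+ vs. G (vs + V - (V \<bullet> w) *\<^sub>R w) (vs + (V \<bullet> w) *\<^sub>R w) \<partial>lborel)
        = (\<integral>\<^sup>+ vs. G (vs + (V - (2 * (V \<bullet> w)) *\<^sub>R w)) vs \<partial>lborel)"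
      by (simp add: algebra_simps scaleR_2 mult_2 flip: scaleR_left_distrib)
  qed
  also have "\<dots> = (\<integral>\<^sup>+ vs. \<integral>\<^sup>+ V. G (vs + (V - (2 * (V \<bullet> w)) *\<^sub>R w)) vs \<partial>lborel \<partial>lborel)"
    by (rule nn_integral_lborel_swap) (simp only: split_def, rule M; measurable)
  also have "\<dots> = (\<integral>\<^sup>+ vs. \<integral>\<^sup>+ V. G (vs + V) vs \<partial>lborel \<partial>lborel)"
  proof (rule nn_integral_cong)
    fix vs :: space3
    have m: "(\<lambda>V. G (vs + V) vs) \<in> borel_measurable borel"
      by (rule M) measurable
    have r: "(\<lambda>V. V - (2 * (V \<bullet> w)) *\<^sub>R w) \<in> lborel \<rightarrow>\<^sub>M borel"
      by (simp add: borel_measurable_continuous_onI continuous_intros)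
    have "(\<integral>\<^sup>+ V. G (vs + V) vs \<partial>lborel)
        = (\<integral>\<^sup>+ V. G (vs + V) vs \<partial>distr lborel borel (\<lambda>V. V - (2 * (V \<bullet> w)) *\<^sub>R w))"
      by (simp add: reflection_preserves_lborel[OF w])
    also have "\<dots> = (\<integral>\<^sup>+ V. G (vs + (V - (2 * (V \<bullet> w)) *\<^sub>R w)) vs \<partial>lborel)"
      by (rule nn_integral_distr[OF r]) (simp add: m)
    finally show "(\<integral>\<^sup>+ V. G (vs + (V - (2 * (V \<bullet> w)) *\<^sub>R w)) vs \<partial>lborel) = (\<integral>\<^sup>+ V. G (vs + V) vs \<partial>lborel)" ..
  qed
  also have "\<dots> = (\<integral>\<^sup>+ vs. \<integral>\<^sup>+ v. G v vs \<partial>lborel \<partial>lborel)"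
    by (intro nn_integral_cong nn_integral_lborel_shift M) measurable
  also have "\<dots> = (\<integral>\<^sup>+ v. \<integral>\<^sup>+ vs. G v vs \<partial>lborel \<partial>lborel)"
    by (rule nn_integral_lborel_swap[symmetric]) (simp only: split_def, rule M; measurable)
  finally show ?thesis .
qed

abbreviation collision_measure :: "(space3 \<times> space3 \<times> space3) measure" where
  "collision_measure \<equiv> lborel \<Otimes>\<^sub>M partner_measure"

lemma collision_measure_projections:
  shows "fst \<in> borel_measurable collision_measure"
    and "(\<lambda>m. fst (snd m)) \<in> borel_measurable collision_measure"
    and "(\<lambda>m. snd (snd m)) \<in> collision_measure \<rightarrow>\<^sub>M sphere_measure"
    and "(\<lambda>m. snd (snd m)) \<in> borel_measurable collision_measure"
proof -
  show *: "(\<lambda>m. snd (snd m)) \<in> collision_measure \<rightarrow>\<^sub>M sphere_measure" by measurable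
  show "(\<lambda>m. snd (snd m)) \<in> borel_measurable collision_measure"
    by (rule measurable_compose[OF * measurable_sphere_borel])
qed measurable

text \<open>
  The direction is taken out first, as the velocities are transformed with \<open>\<omega>\<close> held fixed.
\<close>

lemma nn_integral_collision_measure_reorder:
  assumes [measurable]: "F \<in> borel_measurable collision_measure"
  shows "(\<integral>\<^sup>+ m. F m \<partial>collision_measure)
       = (\<integral>\<^sup>+ w. \<integral>\<^sup>+ v. \<integral>\<^sup>+ vs. F (v, vs, w) \<partial>lborel \<partial>lborel \<partial>sphere_measure)"
proof -
  have "(\<integral>\<^sup>+ m. F m \<partial>collision_measure) = (\<integral>\<^sup>+ v. \<integral>\<^sup>+ p. F (v, p) \<partial>partner_measure \<partial>lborel)"
    by (rule vel_sphere.nn_integral_fst[symmetric]) measurable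
  also have "\<dots> = (\<integral>\<^sup>+ v. \<integral>\<^sup>+ w. \<integral>\<^sup>+ vs. F (v, vs, w) \<partial>lborel \<partial>sphere_measure \<partial>lborel)"
    by (intro nn_integral_cong vel_sphere.nn_integral_snd[symmetric]) measurable
  also have "\<dots> = (\<integral>\<^sup>+ w. \<integral>\<^sup>+ v. \<integral>\<^sup>+ vs. F (v, vs, w) \<partial>lborel \<partial>lborel \<partial>sphere_measure)"
    by (rule vel_sphere.Fubini'[symmetric]) measurable
  finally show ?thesis .
qed

lemma nn_integral_sphere_uminus:
  assumes "F \<in> borel_measurable sphere_measure"
  shows "(\<integral>\<^sup>+ w. F (- w) \<partial>sphere_measure) = (\<integral>\<^sup>+ w. F w \<partial>sphere_measure)"
  using nn_integral_distr[OF measurable_sphere_uminus, of F] assms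
  by (simp add: distr_sphere_measure_uminus)

text \<open>
  Both maps turn \<open>\<omega>\<close> around. This makes \<open>(v - v\<^sub>*) \<bullet> \<omega>\<close>, and hence the collision kernel, invariant under
  them without any assumption on the parity of the kernel.
\<close>

definition collide :: "space3 \<times> space3 \<times> space3 \<Rightarrow> space3 \<times> space3 \<times> space3" where
  "collide m = (post1 (fst m) (fst (snd m)) (snd (snd m)), post2 (fst m) (fst (snd m)) (snd (snd m)), - snd (snd m))"

definition exchange :: "space3 \<times> space3 \<times> space3 \<Rightarrow> space3 \<times> space3 \<times> space3" where
  "exchange m = (fst (snd m), fst m, - snd (snd m))"

lemma measurable_collide: "collide \<in> collision_measure \<rightarrow>\<^sub>M collision_measure"
  and measurable_exchange: "exchange \<in> collision_measure \<rightarrow>\<^sub>M collision_measure"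
proof -
  note [measurable] = collision_measure_projections measurable_sphere_uminus
  show "collide \<in> collision_measure \<rightarrow>\<^sub>M collision_measure"
    unfolding collide_def[abs_def] post1_def post2_def by measurable
  show "exchange \<in> collision_measure \<rightarrow>\<^sub>M collision_measure"
    unfolding exchange_def[abs_def] by measurable
qed

lemma distr_collide: "distr collision_measure collision_measure collide = collision_measure"
  and distr_exchange: "distr collision_measure collision_measure exchange = collision_measure"
proof -
  have collide: "(\<integral>\<^sup>+ m. F (collide m) \<partial>collision_measure) = (\<integral>\<^sup>+ m. F m \<partial>collision_measure)"
    and exchange: "(\<integral>\<^sup>+ m. F (exchange m) \<partial>collision_measure) = (\<integral>\<^sup>+ m. F m \<partial>collision_measure)"
    if [measurable]: "F \<in> borel_measurable collision_measure" for F
  proof -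
    have "(\<integral>\<^sup>+ m. F (collide m) \<partial>collision_measure)
        = (\<integral>\<^sup>+ w. \<integral>\<^sup>+ v. \<integral>\<^sup>+ vs. F (collide (v, vs, w)) \<partial>lborel \<partial>lborel \<partial>sphere_measure)"
      by (rule nn_integral_collision_measure_reorder) (rule measurable_compose[OF measurable_collide that])
    also have "\<dots> = (\<integral>\<^sup>+ w. \<integral>\<^sup>+ v. \<integral>\<^sup>+ vs. F (v, vs, - w) \<partial>lborel \<partial>lborel \<partial>sphere_measure)"
    proof (rule nn_integral_cong)
      fix w assume w: "w \<in> space sphere_measure"
      then have w': "- w \<in> space sphere_measure" by (simp add: space_sphere_measure)
      have "(\<lambda>q. (fst q, snd q, - w)) \<in> (borel \<Otimes>\<^sub>M borel) \<rightarrow>\<^sub>M collision_measure"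
        using w' by measurable
      from measurable_compose[OF this that]
      have "(\<lambda>(v, vs). F (v, vs, - w)) \<in> borel_measurable (borel \<Otimes>\<^sub>M borel)" by (simp add: split_def)
      from nn_integral_collision[OF this, of w] w
      show "(\<integral>\<^sup>+ v. \<integral>\<^sup>+ vs. F (collide (v, vs, w)) \<partial>lborel \<partial>lborel) = (\<integral>\<^sup>+ v. \<integral>\<^sup>+ vs. F (v, vs, - w) \<partial>lborel \<partial>lborel)"
        by (simp add: space_sphere_measure collide_def)
    qed
    also have "\<dots> = (\<integral>\<^sup>+ w. \<integral>\<^sup>+ v. \<integral>\<^sup>+ vs. F (v, vs, w) \<partial>lborel \<partial>lborel \<partial>sphere_measure)"
      by (rule nn_integral_sphere_uminus[where F = "\<lambda>w. \<integral>\<^sup>+ v. \<integral>\<^sup>+ vs. F (v, vs, w) \<partial>lborel \<partial>lborel"]) measurable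
    finally show "(\<integral>\<^sup>+ m. F (collide m) \<partial>collision_measure) = (\<integral>\<^sup>+ m. F m \<partial>collision_measure)"
      by (simp add: nn_integral_collision_measure_reorder)
    have "(\<integral>\<^sup>+ m. F (exchange m) \<partial>collision_measure)
        = (\<integral>\<^sup>+ w. \<integral>\<^sup>+ v. \<integral>\<^sup>+ vs. F (vs, v, - w) \<partial>lborel \<partial>lborel \<partial>sphere_measure)"
      by (subst nn_integral_collision_measure_reorder)
        (rule measurable_compose[OF measurable_exchange that], simp add: exchange_def)
    also have "\<dots> = (\<integral>\<^sup>+ w. \<integral>\<^sup>+ v. \<integral>\<^sup>+ vs. F (v, vs, - w) \<partial>lborel \<partial>lborel \<partial>sphere_measure)"
    proof (rule nn_integral_cong)
      fix w assume w: "w \<in> space sphere_measure"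
      then have w': "- w \<in> space sphere_measure" by (simp add: space_sphere_measure)
      have "(\<lambda>q. (snd q, fst q, - w)) \<in> (borel \<Otimes>\<^sub>M borel) \<rightarrow>\<^sub>M collision_measure"
        using w' by measurable
      from measurable_compose[OF this that]
      have "(\<lambda>(v, vs). F (vs, v, - w)) \<in> borel_measurable (borel \<Otimes>\<^sub>M borel)" by (simp add: split_def)
      from nn_integral_lborel_swap[OF this]
      show "(\<integral>\<^sup>+ v. \<integral>\<^sup>+ vs. F (vs, v, - w) \<partial>lborel \<partial>lborel) = (\<integral>\<^sup>+ v. \<integral>\<^sup>+ vs. F (v, vs, - w) \<partial>lborel \<partial>lborel)" .
    qed
    also have "\<dots> = (\<integral>\<^sup>+ w. \<integral>\<^sup>+ v. \<integral>\<^sup>+ vs. F (v, vs, w) \<partial>lborel \<partial>lborel \<partial>sphere_measure)"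
      by (rule nn_integral_sphere_uminus[where F = "\<lambda>w. \<integral>\<^sup>+ v. \<integral>\<^sup>+ vs. F (v, vs, w) \<partial>lborel \<partial>lborel"]) measurable
    finally show "(\<integral>\<^sup>+ m. F (exchange m) \<partial>collision_measure) = (\<integral>\<^sup>+ m. F m \<partial>collision_measure)"
      by (simp add: nn_integral_collision_measure_reorder)
  qed
  have distr: "distr collision_measure collision_measure t = collision_measure"
    if t: "t \<in> collision_measure \<rightarrow>\<^sub>M collision_measure"
      and inv: "\<And>F. F \<in> borel_measurable collision_measure \<Longrightarrow>
        (\<integral>\<^sup>+ m. F (t m) \<partial>collision_measure) = (\<integral>\<^sup>+ m. F m \<partial>collision_measure)" for t
  proof (rule measure_eqI)
    fix A assume "A \<in> sets (distr collision_measure collision_measure t)"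
    then have A: "A \<in> sets collision_measure" by simp
    have "emeasure (distr collision_measure collision_measure t) A
        = (\<integral>\<^sup>+ m. indicator A m \<partial>distr collision_measure collision_measure t)"
      using A by (subst nn_integral_indicator) auto
    also have "\<dots> = (\<integral>\<^sup>+ m. indicator A (t m) \<partial>collision_measure)"
      using A t by (subst nn_integral_distr) auto
    also have "\<dots> = emeasure collision_measure A"
      using A by (subst inv) auto
    finally show "emeasure (distr collision_measure collision_measure t) A = emeasure collision_measure A" .
  qed simp
  show "distr collision_measure collision_measure collide = collision_measure"
    by (rule distr[OF measurable_collide collide])
  show "distr collision_measure collision_measure exchange = collision_measure"
    by (rule distr[OF measurable_exchange exchange])
qed

section \<open>Gaussian integrals of the collision frequency\<close>

lemma emeasure_cball_space3: "0 \<le> r \<Longrightarrow> emeasure lborel (cball c r :: space3 set) = ennreal (4 / 3 * pi * r ^ 3)"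
  using emeasure_cball[of r c] unit_ball_vol_3 by simp

lemma term_le_suminf: "f k \<le> (\<Sum>n. f n :: ennreal)"
  using sum_le_suminf[OF summableI, of "{k}" f] by simp

text \<open>
  A decreasing radial function is at most a series of multiples of indicator functions of balls, with its
  values at a sequence of radii as coefficients; this evaluates such a series.
\<close>

lemma nn_integral_suminf_cball:
  fixes a r :: "nat \<Rightarrow> real"
  assumes "\<And>n. 0 \<le> a n" "\<And>n. 0 \<le> r n"
  shows "(\<integral>\<^sup>+ w. (\<Sum>n. ennreal (a n) * indicator (cball (0::space3) (r n)) w) \<partial>lborel)
    = (\<Sum>n. ennreal (a n * (4 / 3 * pi * r n ^ 3)))"
proof (subst nn_integral_suminf)
  fix n show "(\<lambda>w. ennreal (a n) * indicator (cball (0::space3) (r n)) w) \<in> borel_measurable lborel"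
    by (intro borel_measurable_times_ennreal borel_measurable_const borel_measurable_indicator) simp
next
  show "(\<Sum>n. \<integral>\<^sup>+ w. ennreal (a n) * indicator (cball (0::space3) (r n)) w \<partial>lborel)
      = (\<Sum>n. ennreal (a n * (4 / 3 * pi * r n ^ 3)))"
  proof (rule suminf_cong)
    fix n
    have "(\<integral>\<^sup>+ w. ennreal (a n) * indicator (cball (0::space3) (r n)) w \<partial>lborel)
        = ennreal (a n) * ennreal (4 / 3 * pi * r n ^ 3)"
      using assms by (subst nn_integral_cmult_indicator) (auto simp only: emeasure_cball_space3 sets_lborel borel_closed closed_cball)
    then show "(\<integral>\<^sup>+ w. ennreal (a n) * indicator (cball (0::space3) (r n)) w \<partial>lborel)
        = ennreal (a n * (4 / 3 * pi * r n ^ 3))"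
      using assms by (simp only: ennreal_mult')
  qed
qed

lemma nn_integral_exp_norm_finite:
  fixes s :: real assumes s: "0 < s"
  shows "(\<integral>\<^sup>+ u. ennreal (exp (- s * norm (u::space3))) \<partial>lborel) < \<infinity>"
proof -
  let ?c = "\<lambda>n. exp (- s * real n) * (4 / 3 * pi * (real n + 1) ^ 3)"
  (* With this K, the cube of n + 1 is at most K^3 exp (s n / 2), so half of the decay rate is left. *)
  define K where "K = max 1 (6 / s)"
  have K: "1 \<le> K" "6 \<le> K * s" using s by (auto simp: K_def max_def field_simps)
  have le: "?c n \<le> 4 / 3 * pi * K ^ 3 * exp (- s / 2) ^ n" for n
  proof -
    have "real n + 1 \<le> K * (1 + s / 6 * real n)"
      using K mult_right_mono[OF K(2), of "real n"] by (simp add: algebra_simps)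
    also have "\<dots> \<le> K * exp (s / 6 * real n)"
      using K by (intro mult_left_mono exp_ge_add_one_self) auto
    finally have "(real n + 1) ^ 3 \<le> (K * exp (s / 6 * real n)) ^ 3"
      by (intro power_mono) auto
    also have "\<dots> = K ^ 3 * exp (s / 2 * real n)"
      by (simp add: power_mult_distrib flip: exp_of_nat_mult)
    finally have "?c n \<le> exp (- s * real n) * (4 / 3 * pi * (K ^ 3 * exp (s / 2 * real n)))"
      by (intro mult_left_mono) auto
    also have "\<dots> = 4 / 3 * pi * K ^ 3 * (exp (- s * real n) * exp (s / 2 * real n))" by simp
    also have "exp (- s * real n) * exp (s / 2 * real n) = exp (- s / 2) ^ n"
      by (simp flip: exp_of_nat_mult exp_add add: field_simps)
    finally show ?thesis .
  qed
  have "summable ?c"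
    by (rule summable_comparison_test'[where g = "\<lambda>n. 4 / 3 * pi * K ^ 3 * exp (- s / 2) ^ n" and N = 0])
      (use s le in \<open>auto intro!: summable_mult summable_geometric\<close>)
  have "(\<integral>\<^sup>+ u. ennreal (exp (- s * norm (u::space3))) \<partial>lborel)
      \<le> (\<integral>\<^sup>+ u. (\<Sum>n. ennreal (exp (- s * real n)) * indicator (cball (0::space3) (real n + 1)) u) \<partial>lborel)"
  proof (rule nn_integral_mono)
    fix u :: space3
    let ?n = "nat \<lfloor>norm u\<rfloor>"
    have n: "real ?n \<le> norm u" "norm u \<le> real ?n + 1"
      by (simp_all add: of_nat_nat)
    have "ennreal (exp (- s * norm u)) \<le> ennreal (exp (- s * real ?n)) * indicator (cball 0 (real ?n + 1)) u"
      using n s by (auto intro!: ennreal_leI)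
    also have "\<dots> \<le> (\<Sum>n. ennreal (exp (- s * real n)) * indicator (cball (0::space3) (real n + 1)) u)"
      by (rule term_le_suminf)
    finally show "ennreal (exp (- s * norm u)) \<le> (\<Sum>n. ennreal (exp (- s * real n)) * indicator (cball (0::space3) (real n + 1)) u)" .
  qed
  also have "\<dots> = (\<Sum>n. ennreal (?c n))"
    by (rule nn_integral_suminf_cball) auto
  also have "\<dots> = ennreal (\<Sum>n. ?c n)"
    by (rule suminf_ennreal2) (use \<open>summable ?c\<close> in auto)
  finally show ?thesis by (simp add: le_less_trans)
qed

text \<open>
  All trade-offs between exponential growth and a part of the Gaussian decay go through this inequality.
\<close>

lemma linear_le_quadratic:
  fixes a s r :: real assumes "0 < s"
  shows "a * r \<le> s * r\<^sup>2 + a\<^sup>2 / (4 * s)"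
proof -
  have "s * r\<^sup>2 + a\<^sup>2 / (4 * s) - a * r = (2 * s * r - a)\<^sup>2 / (4 * s)"
    using assms by (simp add: power2_eq_square field_simps)
  also have "\<dots> \<ge> 0" using assms by simp
  finally show ?thesis by simp
qed

lemma nn_integral_gaussian_finite:
  fixes s :: real assumes s: "0 < s"
  shows "(\<integral>\<^sup>+ u. ennreal (exp (- s * ((u::space3) \<bullet> u))) \<partial>lborel) < \<infinity>"
proof -
  have "(\<integral>\<^sup>+ u. ennreal (exp (- s * ((u::space3) \<bullet> u))) \<partial>lborel)
      \<le> (\<integral>\<^sup>+ u. ennreal (exp (1 / (4 * s))) * ennreal (exp (- 1 * norm (u::space3))) \<partial>lborel)"
  proof (rule nn_integral_mono)
    fix u :: space3
    have "- s * (u \<bullet> u) \<le> 1 / (4 * s) + (- 1 * norm u)"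
      using linear_le_quadratic[OF s, of 1 "norm u"] by (simp add: power2_norm_eq_inner)
    then have "exp (- s * (u \<bullet> u)) \<le> exp (1 / (4 * s)) * exp (- 1 * norm u)"
      by (simp flip: exp_add)
    then show "ennreal (exp (- s * (u \<bullet> u))) \<le> ennreal (exp (1 / (4 * s))) * ennreal (exp (- 1 * norm u))"
      by (simp add: ennreal_leI flip: ennreal_mult)
  qed
  also have "\<dots> = ennreal (exp (1 / (4 * s))) * (\<integral>\<^sup>+ u. ennreal (exp (- 1 * norm (u::space3))) \<partial>lborel)"
    by (rule nn_integral_cmult) measurable
  also have "\<dots> < \<infinity>"
    using nn_integral_exp_norm_finite[of 1] by (simp add: ennreal_mult_less_top)
  finally show ?thesis .
qed

lemma nn_integral_riesz_unit_ball_finite: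
  fixes lam :: real assumes lam: "0 \<le> lam" "lam < 3"
  shows "(\<integral>\<^sup>+ w. ennreal (norm (w::space3) powr (- lam)) * indicator (cball 0 1) w \<partial>lborel) < \<infinity>"
proof -
  let ?h = "\<lambda>k::nat. (1 / 2 :: real) ^ k"
  let ?a = "\<lambda>k. ?h (Suc k) powr (- lam)"
  let ?c = "\<lambda>k. ?a k * (4 / 3 * pi * ?h k ^ 3)"
  have h: "?h k = 2 powr (- real k)" for k
    by (simp add: powr_minus powr_realpow power_one_over inverse_eq_divide)
  have c: "?c k = 4 / 3 * pi * 2 powr lam * (2 powr (lam - 3)) ^ k" for k
  proof -
    have "?a k = 2 powr (lam * real (Suc k))"
      unfolding h powr_powr by (simp add: algebra_simps)
    moreover have "?h k ^ 3 = 2 powr (- 3 * real k)"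
      unfolding h by (simp add: powr_power)
    moreover have "(2 powr (lam - 3)) ^ k = 2 powr ((lam - 3) * real k)"
      by (simp add: powr_power mult.commute)
    moreover have "2 powr (lam * real (Suc k)) * 2 powr (- 3 * real k) = 2 powr lam * 2 powr ((lam - 3) * real k)"
      unfolding powr_add[symmetric] by (simp add: algebra_simps)
    ultimately show ?thesis by simp
  qed
  have "2 powr (lam - 3) < 2 powr 0" using lam by (intro powr_less_mono) auto
  then have "summable ?c"
    unfolding c by (intro summable_mult summable_geometric) auto
  have "(\<integral>\<^sup>+ w. ennreal (norm (w::space3) powr (- lam)) * indicator (cball 0 1) w \<partial>lborel)
      \<le> (\<integral>\<^sup>+ w. (\<Sum>k. ennreal (?a k) * indicator (cball (0::space3) (?h k)) w) \<partial>lborel)"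
  proof (rule nn_integral_mono)
    fix w :: space3
    show "ennreal (norm w powr (- lam)) * indicator (cball 0 1) w
        \<le> (\<Sum>k. ennreal (?a k) * indicator (cball (0::space3) (?h k)) w)"
    proof (cases "0 < norm w \<and> norm w \<le> 1")
      case True
      (* The dyadic shell that contains w. *)
      then obtain n0 where "?h n0 < norm w" using real_arch_pow_inv[of "norm w" "1/2"] by auto
      then have L: "?h (LEAST n. ?h n < norm w) < norm w" by (rule LeastI)
      obtain k where k: "(LEAST n. ?h n < norm w) = Suc k"
        using L True by (cases "LEAST n. ?h n < norm w") auto
      have lo: "?h (Suc k) < norm w" using L k by simp
      have hi: "norm w \<le> ?h k" using not_less_Least[of k "\<lambda>n. ?h n < norm w"] k by simp
      have "norm w powr (- lam) \<le> ?a k"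
        using lo lam by (intro powr_mono2') auto
      then have "ennreal (norm w powr (- lam)) * indicator (cball 0 1) w
          \<le> ennreal (?a k) * indicator (cball (0::space3) (?h k)) w"
        using True hi by (auto intro!: ennreal_leI)
      also have "\<dots> \<le> (\<Sum>k. ennreal (?a k) * indicator (cball (0::space3) (?h k)) w)"
        by (rule term_le_suminf)
      finally show ?thesis .
    qed auto
  qed
  also have "\<dots> = (\<Sum>k. ennreal (?c k))"
    by (rule nn_integral_suminf_cball) auto
  also have "\<dots> = ennreal (\<Sum>k. ?c k)"
    by (rule suminf_ennreal2) (use \<open>summable ?c\<close> in auto)
  finally show ?thesis by (simp add: le_less_trans)
qed

text \<open>
  Times \<open>b0\<close>, this bounds the frequency of the collisions with a Gaussian density of rate \<open>s\<close>.
\<close>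

definition riesz_const :: "real \<Rightarrow> real \<Rightarrow> real" where
  "riesz_const s lam = enn2real (SUP v::space3.
     \<integral>\<^sup>+ u. ennreal (exp (- s * (u \<bullet> u)) * norm (v - u) powr (- lam)) \<partial>lborel)"

lemma riesz_const_nonneg: "0 \<le> riesz_const s lam"
  by (simp add: riesz_const_def)

text \<open>
  Where \<open>\<bar>v - u\<bar> > 1\<close> the singular factor is at most \<open>1\<close> and the Gaussian is integrable; where
  \<open>\<bar>v - u\<bar> \<le> 1\<close> the Gaussian is at most \<open>1\<close> and the singularity is integrable. Neither integral depends on \<open>v\<close>.
\<close>

lemma nn_integral_riesz_gaussian_le:
  fixes v :: space3
  assumes s: "0 < s" and lam: "0 \<le> lam" "lam < 3"
  shows "(\<integral>\<^sup>+ u. ennreal (exp (- s * (u \<bullet> u)) * norm (v - u) powr (- lam)) \<partial>lborel)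
    \<le> ennreal (riesz_const s lam)"
proof -
  let ?I = "\<lambda>v::space3. \<integral>\<^sup>+ u. ennreal (exp (- s * (u \<bullet> u)) * norm (v - u) powr (- lam)) \<partial>lborel"
  let ?G = "\<integral>\<^sup>+ u. ennreal (exp (- s * ((u::space3) \<bullet> u))) \<partial>lborel"
  let ?R = "\<integral>\<^sup>+ w. ennreal (norm (w::space3) powr (- lam)) * indicator (cball 0 1) w \<partial>lborel"
  have [measurable]: "(\<lambda>w. ennreal (norm w powr (- lam)) * indicator (cball 0 1) (w::space3)) \<in> borel_measurable borel"
    by (intro borel_measurable_times_ennreal borel_measurable_indicator) (simp_all, measurable)
  have [measurable]: "(\<lambda>u. ennreal (norm (- v + u) powr (- lam)) * indicator (cball 0 1) (- v + u :: space3)) \<in> borel_measurable borel" for v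
    by (rule measurable_compose[where f = "\<lambda>u. - v + u" and g = "\<lambda>w. ennreal (norm w powr (- lam)) * indicator (cball 0 1) w" and N = borel]) measurable
  have "?I v \<le> ?G + ?R" for v
  proof -
    have "?I v \<le> (\<integral>\<^sup>+ u. ennreal (exp (- s * (u \<bullet> u)))
        + ennreal (norm (- v + u) powr (- lam)) * indicator (cball 0 1) (- v + u) \<partial>lborel)"
    proof (rule nn_integral_mono)
      fix u :: space3
      have nrm: "norm (- v + u) = norm (v - u)" by (simp add: norm_minus_commute)
      show "ennreal (exp (- s * (u \<bullet> u)) * norm (v - u) powr (- lam)) \<le> ennreal (exp (- s * (u \<bullet> u)))
          + ennreal (norm (- v + u) powr (- lam)) * indicator (cball 0 1) (- v + u)"
      proof (cases "norm (v - u) \<le> 1")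
        case True
        then have "ennreal (exp (- s * (u \<bullet> u)) * norm (v - u) powr (- lam)) \<le> ennreal (norm (- v + u) powr (- lam)) * indicator (cball 0 1) (- v + u)"
          unfolding nrm using s by (auto simp: norm_minus_commute intro!: ennreal_leI mult_left_le_one_le)
        then show ?thesis by (simp add: add_increasing)
      next
        case False
        then have "norm (v - u) powr (- lam) \<le> 1"
          using lam powr_mono2'[of "- lam" 1 "norm (v - u)"] by simp
        then have "ennreal (exp (- s * (u \<bullet> u)) * norm (v - u) powr (- lam)) \<le> ennreal (exp (- s * (u \<bullet> u)))"
          by (intro ennreal_leI mult_right_le_one_le) auto
        then show ?thesis by (simp add: add_increasing2)
      qed
    qed
    also have "\<dots> = ?G + (\<integral>\<^sup>+ u. ennreal (norm (- v + u) powr (- lam)) * indicator (cball 0 1) (- v + u) \<partial>lborel)"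
      by (rule nn_integral_add) measurable
    also have "(\<integral>\<^sup>+ u. ennreal (norm (- v + u) powr (- lam)) * indicator (cball 0 1) (- v + u) \<partial>lborel) = ?R"
      by (rule nn_integral_lborel_shift) measurable
    finally show ?thesis .
  qed
  then have "(SUP v. ?I v) \<le> ?G + ?R" by (rule SUP_least)
  also have "\<dots> < \<infinity>"
    using nn_integral_gaussian_finite[OF s] nn_integral_riesz_unit_ball_finite[OF lam] by simp
  finally have "ennreal (riesz_const s lam) = (SUP v. ?I v)"
    by (simp add: riesz_const_def)
  moreover have "?I v \<le> (SUP v. ?I v)" by (rule SUP_upper) simp
  ultimately show ?thesis by (simp only:)
qed

section \<open>Collision invariants and the weight of the free flow\<close>

lemma measurable_post [measurable]:
  assumes "f \<in> borel_measurable N" "g \<in> borel_measurable N" "h \<in> borel_measurable N"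
  shows "(\<lambda>x. post1 (f x) (g x) (h x)) \<in> borel_measurable N"
    and "(\<lambda>x. post2 (f x) (g x) (h x)) \<in> borel_measurable N"
  using assms unfolding post1_def post2_def by measurable

lemma energy_conservation:
  assumes "norm w = 1"
  shows "post1 v vs w \<bullet> post1 v vs w + post2 v vs w \<bullet> post2 v vs w = v \<bullet> v + vs \<bullet> vs"
proof -
  have "w \<bullet> w = 1" using assms by (simp add: norm_eq_1)
  then show ?thesis
    by (simp add: post1_def post2_def inner_add_left inner_add_right inner_diff_left inner_diff_right
        inner_commute algebra_simps)
qed

lemma momentum_conservation: "post1 v vs w + post2 v vs w = v + vs"
  by (simp add: post1_def post2_def)

lemma inner_unit_le: "norm w = 1 \<Longrightarrow> \<bar>V \<bullet> w\<bar> \<le> norm (V :: space3)"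
  using Cauchy_Schwarz_ineq2[of V w] by simp

text \<open>
  The estimates of the collision integral only use the conservation laws; this relation holds both for the
  pair before the collision and for each pair after it, so gain and loss are estimated at once.
\<close>

definition reachable :: "space3 \<Rightarrow> space3 \<Rightarrow> space3 \<Rightarrow> space3 \<Rightarrow> bool" where
  "reachable v vs u us \<longleftrightarrow> u + us = v + vs \<and> u \<bullet> u + us \<bullet> us = v \<bullet> v + vs \<bullet> vs"

lemma reachable_refl: "reachable v vs v vs"
  by (simp add: reachable_def)

lemma reachable_post: "norm w = 1 \<Longrightarrow> reachable v vs (post1 v vs w) (post2 v vs w)"
  by (simp add: reachable_def energy_conservation momentum_conservation)

text \<open>
  \<open>u\<close> and \<open>u\<^sub>*\<close> lie on the sphere that has the segment from \<open>v\<close> to \<open>v\<^sub>*\<close> as a diameter.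
\<close>

lemma reachable_dist:
  assumes "reachable v vs u us"
  shows "norm (v - u) \<le> norm (v - vs)" "norm (v - us) \<le> norm (v - vs)"
proof -
  have us: "us = v + vs - u" using assms by (simp add: reachable_def algebra_simps)
  have e: "u \<bullet> u + us \<bullet> us = v \<bullet> v + vs \<bullet> vs" using assms by (simp add: reachable_def)
  have "(norm (v - u))\<^sup>2 + (norm (v - us))\<^sup>2 = (norm (v - vs))\<^sup>2"
    using e unfolding us power2_norm_eq_inner
    by (simp add: inner_add_left inner_add_right inner_diff_left inner_diff_right inner_commute algebra_simps)
  then have "(norm (v - u))\<^sup>2 \<le> (norm (v - vs))\<^sup>2" "(norm (v - us))\<^sup>2 \<le> (norm (v - vs))\<^sup>2"
    using zero_le_power2[of "norm (v - u)"] zero_le_power2[of "norm (v - us)"] by linarith+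
  then show "norm (v - u) \<le> norm (v - vs)" "norm (v - us) \<le> norm (v - vs)"
    by (auto intro: power2_le_imp_le)
qed

text \<open>
  The position enters through \<open>x - t v\<close>, which is constant along the free flow, so transport by time \<open>q\<close>
  only replaces \<open>t\<close> by \<open>t + q\<close>. The decay in it is exponential rather than Gaussian because cell
  averages must not enlarge the weight by more than a constant factor.
\<close>

definition flow_weight :: "real \<Rightarrow> real \<Rightarrow> phase \<Rightarrow> real" where
  "flow_weight s t z = exp (- s * (snd z \<bullet> snd z) - norm (fst z - t *\<^sub>R snd z))"

lemma flow_weight_pos: "0 < flow_weight s t z"
  by (simp add: flow_weight_def)

lemma flow_weight_nonneg: "0 \<le> flow_weight s t z"
  by (simp add: flow_weight_def)

lemma measurable_flow_weight [measurable]: "flow_weight s t \<in> borel_measurable borel"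
  unfolding flow_weight_def[abs_def] borel_prod[symmetric] by measurable

text \<open>
  As \<open>\<bar>x - t u\<bar>\<^sup>2 + \<bar>x - t u\<^sub>*\<bar>\<^sup>2\<close> only depends on the mass, momentum and energy of the pair
  \<open>(u, u\<^sub>*)\<close>, it does not change in a collision. Hence one of the two spatial factors
  of the product survives, with the velocity \<open>v\<close> in place of \<open>u\<close> and \<open>u\<^sub>*\<close>.
\<close>

lemma flow_weight_reachable:
  assumes "reachable v vs u us"
  shows "flow_weight s t (x, u) * flow_weight s t (x, us)
    \<le> exp (- s * (vs \<bullet> vs)) * flow_weight s t (x, v)"
proof -
  have us: "us = v + vs - u" using assms by (simp add: reachable_def algebra_simps)
  have e: "u \<bullet> u + us \<bullet> us = v \<bullet> v + vs \<bullet> vs" using assms by (simp add: reachable_def)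
  have sq: "(norm (x - t *\<^sub>R u))\<^sup>2 + (norm (x - t *\<^sub>R us))\<^sup>2
      = (norm (x - t *\<^sub>R v))\<^sup>2 + (norm (x - t *\<^sub>R vs))\<^sup>2"
  proof -
    have exp: "(norm (x - t *\<^sub>R p))\<^sup>2 + (norm (x - t *\<^sub>R q))\<^sup>2
        = 2 * (x \<bullet> x) - 2 * t * (x \<bullet> (p + q)) + t\<^sup>2 * (p \<bullet> p + q \<bullet> q)" for p q
      unfolding power2_norm_eq_inner
      by (simp add: inner_add_left inner_add_right inner_diff_left inner_diff_right inner_commute
          algebra_simps power2_eq_square)
    have "u + us = v + vs" using us by simp
    then show ?thesis by (simp only: exp e)
  qed
  have "(norm (x - t *\<^sub>R v))\<^sup>2 \<le> (norm (x - t *\<^sub>R u) + norm (x - t *\<^sub>R us))\<^sup>2"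
  proof -
    have "(norm (x - t *\<^sub>R v))\<^sup>2 \<le> (norm (x - t *\<^sub>R u))\<^sup>2 + (norm (x - t *\<^sub>R us))\<^sup>2"
      unfolding sq by simp
    also have "\<dots> \<le> (norm (x - t *\<^sub>R u) + norm (x - t *\<^sub>R us))\<^sup>2"
      by (simp add: power2_sum)
    finally show ?thesis .
  qed
  then have n: "norm (x - t *\<^sub>R v) \<le> norm (x - t *\<^sub>R u) + norm (x - t *\<^sub>R us)"
    by (rule power2_le_imp_le) simp
  have "- s * (u \<bullet> u) - norm (x - t *\<^sub>R u) + (- s * (us \<bullet> us) - norm (x - t *\<^sub>R us))
      = - s * (u \<bullet> u + us \<bullet> us) - (norm (x - t *\<^sub>R u) + norm (x - t *\<^sub>R us))"
    by (simp add: algebra_simps)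
  also have "\<dots> \<le> - s * (v \<bullet> v + vs \<bullet> vs) - norm (x - t *\<^sub>R v)" using n by (simp only: e)
  also have "\<dots> = - s * (vs \<bullet> vs) + (- s * (v \<bullet> v) - norm (x - t *\<^sub>R v))"
    by (simp add: algebra_simps)
  finally show ?thesis by (simp add: flow_weight_def flip: exp_add)
qed

section \<open>The collision integral at a point\<close>

definition collision_mass :: "real \<Rightarrow> real \<Rightarrow> real \<Rightarrow> real" where
  "collision_mass b0 lam s = b0 * riesz_const s lam"

lemma collision_mass_nonneg: "0 \<le> b0 \<Longrightarrow> 0 \<le> collision_mass b0 lam s"
  by (simp add: collision_mass_def riesz_const_nonneg)

locale collision =
  fixes b :: "real \<Rightarrow> real \<Rightarrow> real" and b0 lam :: real
  assumes kernel: "collision_kernel b b0 lam" and b0: "0 < b0" and lam: "0 \<le> lam" "lam < 2"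
begin

definition rate :: "space3 \<Rightarrow> space3 \<Rightarrow> space3 \<Rightarrow> real" where
  "rate v vs w = b (norm (v - vs)) ((v - vs) \<bullet> w)"

lemma rate_nonneg: "norm w = 1 \<Longrightarrow> 0 \<le> rate v vs w"
  using kernel inner_unit_le[of w "v - vs"] by (simp add: rate_def collision_kernel_def)

lemma rate_measurable:
  assumes [measurable]: "f \<in> borel_measurable N" "g \<in> borel_measurable N"
    and w: "h \<in> N \<rightarrow>\<^sub>M sphere_measure"
  shows "(\<lambda>x. rate (f x) (g x) (h x)) \<in> borel_measurable N"
proof -
  have [measurable]: "h \<in> borel_measurable N"
    by (rule measurable_compose[OF w measurable_sphere_borel])
  have nh: "norm (h x) = 1" if "x \<in> space N" for x
    using measurable_space[OF w that] by (simp add: space_sphere_measure)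
  have "(\<lambda>x. (norm (f x - g x), (f x - g x) \<bullet> h x)) \<in> N \<rightarrow>\<^sub>M restrict_space borel {(r, s). \<bar>s\<bar> \<le> r}"
    by (rule measurable_restrict_space2) (auto simp: nh inner_unit_le)
  moreover have "(\<lambda>(r, s). b r s) \<in> borel_measurable (restrict_space borel {(r, s). \<bar>s\<bar> \<le> r})"
    using kernel by (simp add: collision_kernel_def)
  ultimately have "(\<lambda>x. (\<lambda>(r, s). b r s) (norm (f x - g x), (f x - g x) \<bullet> h x)) \<in> borel_measurable N"
    by (rule measurable_compose)
  then show ?thesis by (simp add: rate_def)
qed

abbreviation mass :: "real \<Rightarrow> real" where
  "mass \<equiv> collision_mass b0 lam"

lemma mass_nonneg: "0 \<le> mass s"
  using b0 by (intro collision_mass_nonneg) simp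

lemma nn_integral_rate_le:
  assumes s: "0 < s"
  shows "(\<integral>\<^sup>+ p. ennreal (rate v (fst p) (snd p) * exp (- s * (fst p \<bullet> fst p))) \<partial>partner_measure)
    \<le> ennreal (mass s)"
proof -
  have [measurable]: "(\<lambda>p. rate v (fst p) (snd p)) \<in> borel_measurable partner_measure"
    by (rule rate_measurable) measurable
  have "(\<integral>\<^sup>+ p. ennreal (rate v (fst p) (snd p) * exp (- s * (fst p \<bullet> fst p))) \<partial>partner_measure)
      = (\<integral>\<^sup>+ vs. \<integral>\<^sup>+ w. ennreal (rate v vs w * exp (- s * (vs \<bullet> vs))) \<partial>sphere_measure \<partial>lborel)"
    by (subst sphere.nn_integral_fst[symmetric]) (simp_all, measurable)
  also have "\<dots> \<le> (\<integral>\<^sup>+ vs. ennreal b0 * ennreal (exp (- s * (vs \<bullet> vs)) * norm (v - vs) powr (- lam)) \<partial>lborel)"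
  proof (rule nn_integral_mono_AE)
    have "AE vs in lborel. vs \<noteq> v" by (rule AE_lborel_singleton)
    then show "AE vs in lborel. (\<integral>\<^sup>+ w. ennreal (rate v vs w * exp (- s * (vs \<bullet> vs))) \<partial>sphere_measure)
        \<le> ennreal b0 * ennreal (exp (- s * (vs \<bullet> vs)) * norm (v - vs) powr (- lam))"
    proof eventually_elim
      fix vs :: space3 assume "vs \<noteq> v"
      have m: "(\<lambda>w. ennreal (rate v vs w)) \<in> borel_measurable sphere_measure"
        by (intro measurable_compose[OF _ measurable_ennreal] rate_measurable) measurable
      have "(\<integral>\<^sup>+ w. ennreal (rate v vs w * exp (- s * (vs \<bullet> vs))) \<partial>sphere_measure)
          = (\<integral>\<^sup>+ w. ennreal (exp (- s * (vs \<bullet> vs))) * ennreal (rate v vs w) \<partial>sphere_measure)"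
        by (intro nn_integral_cong) (simp add: space_sphere_measure rate_nonneg mult.commute flip: ennreal_mult)
      also have "\<dots> = ennreal (exp (- s * (vs \<bullet> vs))) * (\<integral>\<^sup>+ w. ennreal (rate v vs w) \<partial>sphere_measure)"
        by (rule nn_integral_cmult[OF m])
      also have "\<dots> \<le> ennreal (exp (- s * (vs \<bullet> vs))) * ennreal (b0 * norm (v - vs) powr (- lam))"
        using kernel \<open>vs \<noteq> v\<close> by (intro mult_left_mono) (auto simp: rate_def collision_kernel_def)
      also have "\<dots> = ennreal b0 * ennreal (exp (- s * (vs \<bullet> vs)) * norm (v - vs) powr (- lam))"
        using b0 by (simp add: mult.left_commute flip: ennreal_mult)
      finally show "(\<integral>\<^sup>+ w. ennreal (rate v vs w * exp (- s * (vs \<bullet> vs))) \<partial>sphere_measure)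
          \<le> ennreal b0 * ennreal (exp (- s * (vs \<bullet> vs)) * norm (v - vs) powr (- lam))" .
    qed
  qed
  also have "\<dots> = ennreal b0 * (\<integral>\<^sup>+ vs. ennreal (exp (- s * (vs \<bullet> vs)) * norm (v - vs) powr (- lam)) \<partial>lborel)"
    by (rule nn_integral_cmult) measurable
  also have "\<dots> \<le> ennreal b0 * ennreal (riesz_const s lam)"
    using lam by (intro mult_left_mono nn_integral_riesz_gaussian_le[OF s]) auto
  also have "\<dots> = ennreal (mass s)"
    using b0 by (simp add: collision_mass_def riesz_const_nonneg flip: ennreal_mult)
  finally show ?thesis .
qed

text \<open>
  A bound in the velocity of the partner alone suffices, since the integral over the directions is
  controlled by \<open>\<bar>v - v\<^sub>*\<bar>\<close>.
\<close>

lemma rate_integral: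
  assumes s: "0 < s"
    and F: "F \<in> borel_measurable partner_measure" and A: "0 \<le> A"
    and bd: "\<And>vs w. norm w = 1 \<Longrightarrow> \<bar>F (vs, w)\<bar> \<le> A * exp (- s * (vs \<bullet> vs))"
  shows "integrable partner_measure (\<lambda>p. rate v (fst p) (snd p) * F p)"
    and "\<bar>LINT p|partner_measure. rate v (fst p) (snd p) * F p\<bar> \<le> A * mass s"
proof -
  have [measurable]: "(\<lambda>p. rate v (fst p) (snd p)) \<in> borel_measurable partner_measure"
    by (rule rate_measurable) measurable
  have "(\<integral>\<^sup>+ p. ennreal (norm (rate v (fst p) (snd p) * F p)) \<partial>partner_measure)
      \<le> (\<integral>\<^sup>+ p. ennreal A * ennreal (rate v (fst p) (snd p) * exp (- s * (fst p \<bullet> fst p))) \<partial>partner_measure)"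
  proof (rule nn_integral_mono)
    fix p :: "space3 \<times> space3" assume "p \<in> space partner_measure"
    then have w: "norm (snd p) = 1" by (auto simp: space_pair_measure space_sphere_measure)
    have "norm (rate v (fst p) (snd p) * F p) \<le> rate v (fst p) (snd p) * (A * exp (- s * (fst p \<bullet> fst p)))"
      using bd[OF w, of "fst p"] rate_nonneg[OF w] by (simp add: abs_mult mult_left_mono)
    then show "ennreal (norm (rate v (fst p) (snd p) * F p))
        \<le> ennreal A * ennreal (rate v (fst p) (snd p) * exp (- s * (fst p \<bullet> fst p)))"
      using A rate_nonneg[OF w] by (simp add: mult.left_commute flip: ennreal_mult)
  qed
  also have "\<dots> = ennreal A * (\<integral>\<^sup>+ p. ennreal (rate v (fst p) (snd p) * exp (- s * (fst p \<bullet> fst p))) \<partial>partner_measure)"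
    by (rule nn_integral_cmult) measurable
  also have "\<dots> \<le> ennreal A * ennreal (mass s)"
    by (intro mult_left_mono nn_integral_rate_le[OF s]) auto
  finally have le: "(\<integral>\<^sup>+ p. ennreal (norm (rate v (fst p) (snd p) * F p)) \<partial>partner_measure)
      \<le> ennreal (A * mass s)"
    using A by (simp add: mass_nonneg ennreal_mult)
  show int: "integrable partner_measure (\<lambda>p. rate v (fst p) (snd p) * F p)"
    using F le by (intro integrableI_bounded) (auto simp: le_less_trans)
  have "ennreal \<bar>LINT p|partner_measure. rate v (fst p) (snd p) * F p\<bar> \<le> ennreal (A * mass s)"
    using integral_norm_bound_ennreal[OF int] le by simp
  then show "\<bar>LINT p|partner_measure. rate v (fst p) (snd p) * F p\<bar> \<le> A * mass s"
    using A by (simp add: mass_nonneg)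
qed

text \<open>
  The collision operator with the position frozen: \<open>F\<close> stands for the tensor product of the two densities.
  Both \<open>J_B\<close> at a point and the transported \<open>J_B\<close> have this form, for different \<open>F\<close>.
\<close>

definition Q :: "(space3 \<Rightarrow> space3 \<Rightarrow> real) \<Rightarrow> space3 \<Rightarrow> real" where
  "Q F v = (LINT p|partner_measure. rate v (fst p) (snd p) *
     (F (post1 v (fst p) (snd p)) (post2 v (fst p) (snd p)) - F v (fst p)))"

lemma J_B_eq_Q: "J_B b g h (x, v) = Q (\<lambda>u us. g (x, u) * h (x, us)) v"
  unfolding J_B_def Q_def collision_integrand_def rate_def by (simp add: split_def)

lemma Q_integrable_bound:
  assumes s: "0 < s" and A: "0 \<le> A"
    and F: "(\<lambda>(u, us). F u us) \<in> borel_measurable borel"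
    and bd: "\<And>vs u us. reachable v vs u us \<Longrightarrow> \<bar>F u us\<bar> \<le> A * exp (- s * (vs \<bullet> vs))"
  shows "integrable partner_measure (\<lambda>p. rate v (fst p) (snd p) *
      (F (post1 v (fst p) (snd p)) (post2 v (fst p) (snd p)) - F v (fst p)))" (is ?thesis1)
    and "\<bar>Q F v\<bar> \<le> 2 * A * mass s" (is ?thesis2)
proof -
  have [measurable]: "snd \<in> borel_measurable partner_measure"
    by (rule measurable_compose[OF measurable_snd measurable_sphere_borel])
  have M: "(\<lambda>p. F (g p) (h p)) \<in> borel_measurable N"
    if [measurable]: "g \<in> borel_measurable N" "h \<in> borel_measurable N" for g h and N :: "'c measure"
    by (rule measurable_compose[OF _ F, of "\<lambda>p. (g p, h p)", simplified]) measurable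
  let ?F = "\<lambda>p. F (post1 v (fst p) (snd p)) (post2 v (fst p) (snd p)) - F v (fst p)"
  have m: "?F \<in> borel_measurable partner_measure"
    by (intro borel_measurable_diff M) measurable
  have b: "\<bar>?F (vs, w)\<bar> \<le> 2 * A * exp (- s * (vs \<bullet> vs))" if "norm w = 1" for vs w
    using bd[OF reachable_post[OF that, of v vs]] bd[OF reachable_refl[of v vs]] by simp
  have "0 \<le> 2 * A" using A by simp
  from rate_integral[OF s m this b]
  show ?thesis1 ?thesis2 unfolding Q_def by auto
qed

lemma Q_diff:
  assumes s: "0 < s" and A: "0 \<le> A" and B: "0 \<le> B"
    and F: "(\<lambda>(u, us). F u us) \<in> borel_measurable borel" and G: "(\<lambda>(u, us). G u us) \<in> borel_measurable borel"
    and bF: "\<And>vs u us. reachable v vs u us \<Longrightarrow> \<bar>F u us\<bar> \<le> A * exp (- s * (vs \<bullet> vs))"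
    and bG: "\<And>vs u us. reachable v vs u us \<Longrightarrow> \<bar>G u us\<bar> \<le> A * exp (- s * (vs \<bullet> vs))"
    and bd: "\<And>vs u us. reachable v vs u us \<Longrightarrow> \<bar>F u us - G u us\<bar> \<le> B * exp (- s * (vs \<bullet> vs))"
  shows "\<bar>Q F v - Q G v\<bar> \<le> 2 * B * mass s"
proof -
  have m: "(\<lambda>(u, us). F u us - G u us) \<in> borel_measurable borel"
    using borel_measurable_diff[OF F G] by (simp add: split_def)
  have "Q F v - Q G v = Q (\<lambda>u us. F u us - G u us) v"
    unfolding Q_def
    by (subst Bochner_Integration.integral_diff[symmetric])
      (use Q_integrable_bound(1)[OF s A F bF] Q_integrable_bound(1)[OF s A G bG] in
        \<open>auto simp: algebra_simps intro!: Bochner_Integration.integral_cong\<close>)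
  then show ?thesis using Q_integrable_bound(2)[OF s B m bd] by simp
qed

end

section \<open>The collision operator on dominated functions\<close>

lemma
  fixes f :: "'c \<Rightarrow> phase" and g h :: "'c \<Rightarrow> space3"
  shows borel_measurable_phase_fst: "f \<in> borel_measurable N \<Longrightarrow> (\<lambda>x. fst (f x)) \<in> borel_measurable N"
    and borel_measurable_phase_snd: "f \<in> borel_measurable N \<Longrightarrow> (\<lambda>x. snd (f x)) \<in> borel_measurable N"
    and borel_measurable_phase_Pair: "g \<in> borel_measurable N \<Longrightarrow> h \<in> borel_measurable N \<Longrightarrow> (\<lambda>x. (g x, h x)) \<in> borel_measurable N"
proof -
  show "f \<in> borel_measurable N \<Longrightarrow> (\<lambda>x. fst (f x)) \<in> borel_measurable N"
    by (rule borel_measurable_continuous_on[OF continuous_on_fst]) (auto intro: continuous_intros)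
  show "f \<in> borel_measurable N \<Longrightarrow> (\<lambda>x. snd (f x)) \<in> borel_measurable N"
    by (rule borel_measurable_continuous_on[OF continuous_on_snd]) (auto intro: continuous_intros)
  show "g \<in> borel_measurable N \<Longrightarrow> h \<in> borel_measurable N \<Longrightarrow> (\<lambda>x. (g x, h x)) \<in> borel_measurable N"
    by (rule borel_measurable_Pair)
qed

lemma measurable_fst_phase: "fst \<in> borel_measurable (borel :: phase measure)"
  and measurable_snd_phase: "snd \<in> borel_measurable (borel :: phase measure)"
  using borel_measurable_phase_fst[of "\<lambda>z. z" borel] borel_measurable_phase_snd[of "\<lambda>z. z" borel] by simp_all

lemma borel_measurable_at_phase:
  fixes g :: "phase \<Rightarrow> real"
  assumes "g \<in> borel_measurable borel" "f \<in> borel_measurable N" "h \<in> borel_measurable N"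
  shows "(\<lambda>x. g (f x, h x)) \<in> borel_measurable N"
  by (rule measurable_compose[OF borel_measurable_phase_Pair assms(1)]) fact+

definition dominated :: "real \<Rightarrow> real \<Rightarrow> real \<Rightarrow> (phase \<Rightarrow> real) \<Rightarrow> bool" where
  "dominated A s t g \<longleftrightarrow> (\<forall>z. \<bar>g z\<bar> \<le> A * flow_weight s t z)"

lemma dominatedD: "dominated A s t g \<Longrightarrow> \<bar>g z\<bar> \<le> A * flow_weight s t z"
  unfolding dominated_def by blast

lemma dominated_nonneg: "dominated A s t g \<Longrightarrow> 0 \<le> A"
  unfolding dominated_def using flow_weight_pos[of s t 0]
  by (metis abs_ge_zero order_trans zero_le_mult_iff not_less)

lemma dominated_mono: "dominated A s t g \<Longrightarrow> A \<le> A' \<Longrightarrow> dominated A' s t g"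
  unfolding dominated_def by (meson flow_weight_nonneg mult_right_mono order_trans)

lemma flow_weight_mono: "s \<le> s' \<Longrightarrow> flow_weight s' t z \<le> flow_weight s t z"
  by (simp add: flow_weight_def mult_right_mono)

lemma dominated_mono_weight:
  assumes "dominated A s' t g" "s \<le> s'"
  shows "dominated A s t g"
  unfolding dominated_def
proof
  fix z
  have "\<bar>g z\<bar> \<le> A * flow_weight s' t z" by (rule dominatedD[OF assms(1)])
  also have "\<dots> \<le> A * flow_weight s t z"
    by (rule mult_left_mono[OF flow_weight_mono[OF assms(2)] dominated_nonneg[OF assms(1)]])
  finally show "\<bar>g z\<bar> \<le> A * flow_weight s t z" .
qed

lemma dominated_diff_mono:
  assumes "dominated A s t g" "dominated B s t (\<lambda>z. h z - g z)"
  shows "dominated (A + B) s t h"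
  unfolding dominated_def
proof
  fix z
  show "\<bar>h z\<bar> \<le> (A + B) * flow_weight s t z"
    using dominatedD[OF assms(1), of z] dominatedD[OF assms(2), of z] by (simp add: algebra_simps)
qed

lemma free_flow_apply: "free_flow q g (x, v) = g (x - q *\<^sub>R v, v)"
  by (simp add: free_flow_def)

lemma flow_weight_free_flow: "flow_weight s t (x - q *\<^sub>R v, v) = flow_weight s (t + q) (x, v)"
  by (simp add: flow_weight_def algebra_simps)

lemma dominated_free_flow: "dominated A s t g \<Longrightarrow> dominated A s (t + q) (free_flow q g)"
  unfolding dominated_def by (auto simp: free_flow_apply flow_weight_free_flow[symmetric])

lemma measurable_free_flow:
  assumes "g \<in> borel_measurable borel"
  shows "free_flow q g \<in> borel_measurable borel"
proof -
  note [measurable] = measurable_fst_phase measurable_snd_phase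
  have "(\<lambda>z. g (fst z - q *\<^sub>R snd z, snd z)) \<in> borel_measurable borel"
    by (rule borel_measurable_at_phase[OF assms]) simp_all
  then show ?thesis by (simp add: free_flow_def split_def)
qed

lemma product_reachable_bound:
  assumes g: "dominated A s t g" and h: "dominated B s t h" and r: "reachable v vs u us"
  shows "\<bar>g (x, u) * h (x, us)\<bar> \<le> A * B * flow_weight s t (x, v) * exp (- s * (vs \<bullet> vs))"
proof -
  have "\<bar>g (x, u) * h (x, us)\<bar> \<le> (A * flow_weight s t (x, u)) * (B * flow_weight s t (x, us))"
    unfolding abs_mult using dominatedD[OF g] dominatedD[OF h] by (intro mult_mono) (auto intro: order_trans[OF abs_ge_zero])
  also have "\<dots> = A * B * (flow_weight s t (x, u) * flow_weight s t (x, us))" by simp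
  also have "\<dots> \<le> A * B * (exp (- s * (vs \<bullet> vs)) * flow_weight s t (x, v))"
    using dominated_nonneg[OF g] dominated_nonneg[OF h] by (intro mult_left_mono flow_weight_reachable[OF r]) auto
  finally show ?thesis by (simp add: ac_simps)
qed

text \<open>
  A null set of velocities stays a null set under \<open>collide\<close> and \<open>exchange\<close>, which preserve the measure.
\<close>

lemma AE_collision_velocities:
  assumes P: "Measurable.pred borel P" and ae: "AE v in lborel. P v"
  shows "AE v in lborel. AE p in partner_measure.
    P v \<and> P (fst p) \<and> P (post1 v (fst p) (snd p)) \<and> P (post2 v (fst p) (snd p))"
proof -
  note [measurable] = P collision_measure_projections
  have sets: "{m \<in> space collision_measure. P (fst m)} \<in> sets collision_measure"
    "{m \<in> space collision_measure. P (fst (snd m))} \<in> sets collision_measure"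
    by measurable
  have 1: "AE m in collision_measure. P (fst m)"
    using sets(1) by (rule vel_vel_sphere.AE_pair_measure) (use ae in auto)
  then have "AE m in distr collision_measure collision_measure exchange. P (fst m)"
    by (simp only: distr_exchange)
  then have 2: "AE m in collision_measure. P (fst (snd m))"
    by (simp add: AE_distr_iff[OF measurable_exchange sets(1)] exchange_def)
  from 1 have "AE m in distr collision_measure collision_measure collide. P (fst m)"
    by (simp only: distr_collide)
  then have 3: "AE m in collision_measure. P (post1 (fst m) (fst (snd m)) (snd (snd m)))"
    by (simp add: AE_distr_iff[OF measurable_collide sets(1)] collide_def)
  from 2 have "AE m in distr collision_measure collision_measure collide. P (fst (snd m))"
    by (simp only: distr_collide)
  then have 4: "AE m in collision_measure. P (post2 (fst m) (fst (snd m)) (snd (snd m)))"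
    by (simp add: AE_distr_iff[OF measurable_collide sets(2)] collide_def)
  from 1 2 3 4 have "AE m in collision_measure. P (fst m) \<and> P (fst (snd m))
      \<and> P (post1 (fst m) (fst (snd m)) (snd (snd m))) \<and> P (post2 (fst m) (fst (snd m)) (snd (snd m)))"
    by eventually_elim simp
  from vel_vel_sphere.AE_pair[OF this] show ?thesis by simp
qed

lemma AE_phase_iff:
  assumes "Measurable.pred borel P"
  shows "(AE z in (lborel :: phase measure). P z) \<longleftrightarrow> (AE x in lborel. AE v in lborel. P (x :: space3, v :: space3))"
proof -
  have "{z \<in> space (lborel \<Otimes>\<^sub>M lborel). P z} \<in> sets (lborel \<Otimes>\<^sub>M lborel :: phase measure)"
    using assms unfolding lborel_prod by (simp add: pred_def)
  with lborel_pair.AE_pair[of P] lborel_pair.AE_pair_measure[of P] show ?thesis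
    unfolding lborel_prod by blast
qed

context collision begin

lemma J_B_measurable:
  assumes g: "g \<in> borel_measurable borel" and h: "h \<in> borel_measurable borel"
  shows "J_B b g h \<in> borel_measurable borel"
proof -
  let ?N = "(borel :: phase measure) \<Otimes>\<^sub>M partner_measure"
  have w: "(\<lambda>q. snd (snd q)) \<in> ?N \<rightarrow>\<^sub>M sphere_measure" by measurable
  have [measurable]: "(\<lambda>q. snd (snd q)) \<in> borel_measurable ?N"
    by (rule measurable_compose[OF w measurable_sphere_borel])
  have f: "fst \<in> borel_measurable ?N" by measurable
  note [measurable] = borel_measurable_phase_fst[OF f] borel_measurable_phase_snd[OF f]
  have "(\<lambda>q. rate (snd (fst q)) (fst (snd q)) (snd (snd q))
      * (g (fst (fst q), post1 (snd (fst q)) (fst (snd q)) (snd (snd q)))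
          * h (fst (fst q), post2 (snd (fst q)) (fst (snd q)) (snd (snd q)))
        - g (fst (fst q), snd (fst q)) * h (fst (fst q), fst (snd q)))) \<in> borel_measurable ?N"
    by (intro borel_measurable_times borel_measurable_diff rate_measurable[OF _ _ w]
        borel_measurable_at_phase[OF g] borel_measurable_at_phase[OF h]) measurable
  then have "(\<lambda>(z, p). collision_integrand b g h z p) \<in> borel_measurable ?N"
    by (simp add: collision_integrand_def rate_def split_def)
  from vel_sphere.borel_measurable_lebesgue_integral[OF this]
  show ?thesis unfolding J_B_def[abs_def] by simp
qed

lemma product_measurable:
  fixes g h :: "phase \<Rightarrow> real"
  assumes "g \<in> borel_measurable borel" "h \<in> borel_measurable borel"
  shows "(\<lambda>(u, us). g (x, u) * h (x, us)) \<in> borel_measurable borel"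
proof -
  have "(\<lambda>q::space3 \<times> space3. g (x, fst q) * h (x, snd q)) \<in> borel_measurable borel"
    by (intro borel_measurable_times borel_measurable_at_phase[OF assms(1)] borel_measurable_at_phase[OF assms(2)]
        borel_measurable_phase_fst borel_measurable_phase_snd) simp_all
  then show ?thesis by (simp add: split_def)
qed

text \<open>
  By \<open>flow_weight_reachable\<close>, both products of the integrand are at most the weight at \<open>v\<close> times a Gaussian in
  \<open>v\<^sub>*\<close>. So the operator maps dominated functions to functions with the same weight.
\<close>

lemma J_B_integrable_bound:
  assumes s: "0 < s"
    and m: "g \<in> borel_measurable borel" "h \<in> borel_measurable borel"
    and g: "dominated A s t g" and h: "dominated B s t h"
  shows J_B_integrable: "integrable partner_measure (collision_integrand b g h (x, v))"
    and "\<bar>J_B b g h (x, v)\<bar> \<le> 2 * A * B * mass s * flow_weight s t (x, v)"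
proof -
  have nn: "0 \<le> A * B * flow_weight s t (x, v)"
    using dominated_nonneg[OF g] dominated_nonneg[OF h] by (simp add: flow_weight_nonneg)
  have bd: "\<bar>g (x, u) * h (x, us)\<bar> \<le> A * B * flow_weight s t (x, v) * exp (- s * (vs \<bullet> vs))"
    if "reachable v vs u us" for vs u us
    by (rule product_reachable_bound[OF g h that])
  note * = Q_integrable_bound[OF s nn product_measurable[OF m, of x] bd]
  show "integrable partner_measure (collision_integrand b g h (x, v))"
    using *(1) by (simp add: collision_integrand_def rate_def split_def)
  show "\<bar>J_B b g h (x, v)\<bar> \<le> 2 * A * B * mass s * flow_weight s t (x, v)"
    using *(2) by (simp add: J_B_eq_Q ac_simps)
qed

lemma J_B_dominated:
  assumes "0 < s" "g \<in> borel_measurable borel" "h \<in> borel_measurable borel"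
    and "dominated A s t g" "dominated B s t h"
  shows "dominated (2 * A * B * mass s) s t (J_B b g h)"
  using J_B_integrable_bound(2)[OF assms] by (auto simp: dominated_def)

lemma J_B_diff_dominated:
  assumes s: "0 < s"
    and m: "g \<in> borel_measurable borel" "h \<in> borel_measurable borel" "g' \<in> borel_measurable borel" "h' \<in> borel_measurable borel"
    and g: "dominated A s t g" "dominated A s t g'" and h: "dominated B s t h" "dominated B s t h'"
    and dg: "dominated C s t (\<lambda>z. g z - g' z)" and dh: "dominated D s t (\<lambda>z. h z - h' z)"
  shows "dominated (2 * (C * B + A * D) * mass s) s t (\<lambda>z. J_B b g h z - J_B b g' h' z)"
  unfolding dominated_def
proof
  fix z :: phase
  obtain x v where z: "z = (x, v)" by (cases z)
  let ?W = "flow_weight s t (x, v)"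
  have nn: "0 \<le> A * B * ?W" "0 \<le> (C * B + A * D) * ?W"
    using g h dg dh by (auto intro!: mult_nonneg_nonneg add_nonneg_nonneg dest!: dominated_nonneg simp: flow_weight_nonneg)
  have "\<bar>Q (\<lambda>u us. g (x, u) * h (x, us)) v - Q (\<lambda>u us. g' (x, u) * h' (x, us)) v\<bar>
      \<le> 2 * ((C * B + A * D) * ?W) * mass s"
  proof (rule Q_diff[OF s nn product_measurable[OF m(1,2)] product_measurable[OF m(3,4)]])
    fix vs u us assume r: "reachable v vs u us"
    show "\<bar>g (x, u) * h (x, us)\<bar> \<le> A * B * ?W * exp (- s * (vs \<bullet> vs))"
      by (rule product_reachable_bound[OF g(1) h(1) r])
    show "\<bar>g' (x, u) * h' (x, us)\<bar> \<le> A * B * ?W * exp (- s * (vs \<bullet> vs))"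
      by (rule product_reachable_bound[OF g(2) h(2) r])
    have "\<bar>g (x, u) * h (x, us) - g' (x, u) * h' (x, us)\<bar>
        = \<bar>(g (x, u) - g' (x, u)) * h (x, us) + g' (x, u) * (h (x, us) - h' (x, us))\<bar>"
      by (simp add: algebra_simps)
    also have "\<dots> \<le> \<bar>(g (x, u) - g' (x, u)) * h (x, us)\<bar> + \<bar>g' (x, u) * (h (x, us) - h' (x, us))\<bar>"
      by (rule abs_triangle_ineq)
    also have "\<dots> \<le> C * B * ?W * exp (- s * (vs \<bullet> vs)) + A * D * ?W * exp (- s * (vs \<bullet> vs))"
      using product_reachable_bound[OF dg h(1) r, of x] product_reachable_bound[OF g(2) dh r, of x]
      by (rule add_mono)
    finally show "\<bar>g (x, u) * h (x, us) - g' (x, u) * h' (x, us)\<bar>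
        \<le> (C * B + A * D) * ?W * exp (- s * (vs \<bullet> vs))"
      by (simp add: algebra_simps)
  qed
  then show "\<bar>J_B b g h z - J_B b g' h' z\<bar> \<le> 2 * (C * B + A * D) * mass s * flow_weight s t z"
    by (simp add: z J_B_eq_Q algebra_simps)
qed

text \<open>
  Only the loss term is negative, and it is \<open>g\<close> itself times a bounded collision frequency.
\<close>

lemma J_B_lower_bound:
  assumes s: "0 < s"
    and m: "g \<in> borel_measurable borel" "h \<in> borel_measurable borel"
    and g: "dominated A s t g" and h: "dominated B s t h"
    and nn: "\<And>z. 0 \<le> g z" "\<And>z. 0 \<le> h z"
  shows "- (B * mass s * g z) \<le> J_B b g h z"
proof -
  obtain x v where z: "z = (x, v)" by (cases z)
  let ?F = "\<lambda>p::space3 \<times> space3. - g (x, v) * h (x, fst p)"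
  have mF: "?F \<in> borel_measurable partner_measure"
    by (intro borel_measurable_times borel_measurable_const borel_measurable_at_phase[OF m(2)]) measurable
  have B: "0 \<le> g (x, v) * B" using nn dominated_nonneg[OF h] by simp
  have bd: "\<bar>?F (vs, w)\<bar> \<le> g (x, v) * B * exp (- s * (vs \<bullet> vs))" for vs w
  proof -
    have "h (x, vs) \<le> B * flow_weight s t (x, vs)" using dominatedD[OF h, of "(x, vs)"] by simp
    also have "\<dots> \<le> B * exp (- s * (vs \<bullet> vs))"
      using dominated_nonneg[OF h] by (intro mult_left_mono) (auto simp: flow_weight_def)
    finally show ?thesis using nn by (simp add: abs_mult mult_left_mono mult.assoc)
  qed
  note loss = rate_integral[OF s mF B bd]
  have "- (B * mass s * g z) \<le> (LINT p|partner_measure. rate v (fst p) (snd p) * ?F p)"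
    using loss(2)[of v] by (simp add: z ac_simps)
  also have "\<dots> \<le> J_B b g h z"
    unfolding J_B_def z
  proof (rule integral_mono[OF loss(1) J_B_integrable[OF s m g h]])
    fix p :: "space3 \<times> space3" assume "p \<in> space partner_measure"
    then have w: "norm (snd p) = 1" by (auto simp: space_pair_measure space_sphere_measure)
    show "rate v (fst p) (snd p) * ?F p \<le> collision_integrand b g h (x, v) p"
      using rate_nonneg[OF w, of v "fst p"] nn
      by (auto simp: collision_integrand_def split_def rate_def right_diff_distrib)
  qed
  finally show ?thesis .
qed

text \<open>
  Makes the operator well defined on classes of functions. Estimates whose hypotheses are needed everywhere
  can thus be used when they hold a.e., after a change of the functions on a null set.
\<close>

lemma J_B_cong_AE:
  assumes m: "g \<in> borel_measurable borel" "h \<in> borel_measurable borel" "g' \<in> borel_measurable borel" "h' \<in> borel_measurable borel"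
    and g: "AE z in lborel. g z = g' z" and h: "AE z in lborel. h z = h' z"
  shows "AE z in lborel. J_B b g h z = J_B b g' h' z"
proof -
  let ?P = "\<lambda>z. g z = g' z \<and> h z = h' z"
  note [measurable] = m J_B_measurable[OF m(1,2)] J_B_measurable[OF m(3,4)]
  have pm: "Measurable.pred borel ?P" "Measurable.pred borel (\<lambda>z. J_B b g h z = J_B b g' h' z)" by measurable
  have "AE z in lborel. ?P z" using g h by eventually_elim simp
  then have "AE x in lborel. AE v in lborel. ?P (x, v)"
    unfolding AE_phase_iff[OF pm(1)] .
  then have "AE x in lborel. AE v in lborel. J_B b g h (x, v) = J_B b g' h' (x, v)"
  proof eventually_elim
    fix x :: space3 assume ae: "AE v in lborel. ?P (x, v)"
    have "Measurable.pred borel (\<lambda>v. ?P (x, v))"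
      by (intro pred_intros_logic borel_measurable_eq borel_measurable_at_phase m; simp)
    from AE_collision_velocities[OF this ae]
    show "AE v in lborel. J_B b g h (x, v) = J_B b g' h' (x, v)"
    proof eventually_elim
      fix v :: space3
      assume ae: "AE p in partner_measure. ?P (x, v) \<and> ?P (x, fst p)
        \<and> ?P (x, post1 v (fst p) (snd p)) \<and> ?P (x, post2 v (fst p) (snd p))"
      have [measurable]: "snd \<in> borel_measurable partner_measure"
        by (rule measurable_compose[OF measurable_snd measurable_sphere_borel])
      have M: "(\<lambda>p. rate v (fst p) (snd p) * (k (x, post1 v (fst p) (snd p)) * l (x, post2 v (fst p) (snd p))
          - k (x, v) * l (x, fst p))) \<in> borel_measurable partner_measure"
        if "k \<in> borel_measurable borel" "l \<in> borel_measurable borel" for k l :: "phase \<Rightarrow> real"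
        by (intro borel_measurable_times borel_measurable_diff rate_measurable
            borel_measurable_at_phase[OF that(1)] borel_measurable_at_phase[OF that(2)]) measurable
      show "J_B b g h (x, v) = J_B b g' h' (x, v)"
        unfolding J_B_eq_Q Q_def
        by (rule integral_cong_AE[OF M[OF m(1,2)] M[OF m(3,4)]]) (use ae in eventually_elim, simp)
    qed
  qed
  then show ?thesis
    unfolding AE_phase_iff[OF pm(2)] .
qed

end

section \<open>Averages over the cells\<close>

lemma AE_phase_swap_iff:
  assumes "Measurable.pred borel P"
  shows "(AE z in (lborel :: phase measure). P z) \<longleftrightarrow> (AE v in lborel. AE x in lborel. P (x :: space3, v :: space3))"
proof -
  have "{z \<in> space (lborel \<Otimes>\<^sub>M lborel). P (fst z, snd z)} \<in> sets (lborel \<Otimes>\<^sub>M lborel :: phase measure)"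
    using assms unfolding lborel_prod by (simp add: pred_def)
  then have "(AE x in lborel. AE v in lborel. P (x, v)) \<longleftrightarrow> (AE v in lborel. AE x in lborel. P (x, v))"
    by (rule lborel_pair.AE_commute)
  then show ?thesis using AE_phase_iff[OF assms] by simp
qed

lemma dominated_bounded:
  assumes "dominated A s t g" "0 \<le> s"
  shows "\<bar>g z\<bar> \<le> A"
proof -
  have "flow_weight s t z \<le> 1" using assms(2) by (simp add: flow_weight_def)
      (meson assms(2) inner_ge_zero mult_nonneg_nonneg neg_le_0_iff_le norm_ge_zero order_trans)
  then have "A * flow_weight s t z \<le> A * 1"
    using dominated_nonneg[OF assms(1)] by (intro mult_left_mono)
  then show ?thesis using dominatedD[OF assms(1), of z] by simp
qed

lemma flow_weight_shift: "flow_weight s t (y, v) \<le> exp (norm (y - x)) * flow_weight s t (x, v)"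
proof -
  have "norm (x - t *\<^sub>R v) \<le> norm (y - x) + norm (y - t *\<^sub>R v)"
    using norm_triangle_ineq4[of "y - t *\<^sub>R v" "y - x"] by (simp add: add.commute)
  then show ?thesis by (simp add: flow_weight_def flip: exp_add)
qed

text \<open>
  Cells of diameter at most \<open>1\<close>: the weights at two points of one cell then differ by a factor \<open>exp 1\<close>
  at most.
\<close>

locale cells =
  fixes P :: "nat \<Rightarrow> space3 set"
  assumes partition: "cell_partition P" and small: "partition_diameter P \<le> 1"
begin

lemma cell_sets [measurable]: "P l \<in> sets borel"
  and cell_bounded: "bounded (P l)"
  and cell_pos: "0 < measure lborel (P l)"
  using partition by (auto simp: cell_partition_def)

lemma cell_finite: "emeasure lborel (P l) < \<infinity>"
  using emeasure_bounded_finite[OF cell_bounded] by simp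

lemma cell_cover: obtains l where "x \<in> P l"
  using partition unfolding cell_partition_def by blast

lemma cell_dist:
  assumes "x \<in> P l" "y \<in> P l"
  shows "norm (y - x) \<le> partition_diameter P"
proof -
  have "norm (y - x) \<le> diameter (P l)"
    using diameter_bounded_bound[OF cell_bounded assms] by (simp add: dist_norm norm_minus_commute)
  also have "\<dots> \<le> partition_diameter P"
    unfolding partition_diameter_def using partition by (intro cSUP_upper) (auto simp: cell_partition_def)
  finally show ?thesis .
qed

lemma diameter_nonneg: "0 \<le> partition_diameter P"
proof -
  obtain l where "0 \<in> P l" by (rule cell_cover)
  from cell_dist[OF this this] show ?thesis by simp
qed

lemma cell_average_eq:
  assumes "x \<in> P l"
  shows "cell_average P g (x, v) = (LINT y:P l|lborel. g (y, v)) / measure lborel (P l)"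
proof -
  have "x \<notin> P k" if "k \<noteq> l" for k
    using partition assms that by (auto simp: cell_partition_def disjoint_family_on_def)
  then have "cell_average P g (x, v) = (\<Sum>k\<in>{l}. indicator (P k) x * (1 / measure lborel (P k)) * (LINT y:P k|lborel. g (y, v)))"
    unfolding cell_average_def by (simp, subst suminf_finite[of "{l}"]) auto
  then show ?thesis using assms by simp
qed

lemma cell_average_measurable:
  assumes g: "g \<in> borel_measurable borel"
  shows "cell_average P g \<in> borel_measurable borel"
proof -
  note fs = measurable_fst_phase measurable_snd_phase
  have I: "(\<lambda>z::phase. LINT y:P l|lborel. g (y, snd z)) \<in> borel_measurable borel" for l
    unfolding set_lebesgue_integral_def
  proof (rule lborel.borel_measurable_lebesgue_integral)
    have "(\<lambda>q::phase \<times> space3. indicator (P l) (snd q) *\<^sub>R g (snd q, snd (fst q))) \<in> borel_measurable (borel \<Otimes>\<^sub>M lborel)"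
      by (intro borel_measurable_scaleR borel_measurable_at_phase[OF g] measurable_compose[OF measurable_fst fs(2)]
          borel_measurable_indicator' ; measurable)
    then show "(\<lambda>(z::phase, y). indicator (P l) y *\<^sub>R g (y, snd z)) \<in> borel_measurable (borel \<Otimes>\<^sub>M lborel)"
      by (simp add: split_def)
  qed
  have ind: "(\<lambda>z::phase. indicator (P l) (fst z) :: real) \<in> borel_measurable borel" for l
    by (rule measurable_compose[OF fs(1)]) simp
  have "(\<lambda>z::phase. \<Sum>l. indicator (P l) (fst z) * (1 / measure lborel (P l)) * (LINT y:P l|lborel. g (y, snd z))) \<in> borel_measurable borel"
    by (intro borel_measurable_suminf borel_measurable_times borel_measurable_const I ind)
  then show ?thesis by (simp add: cell_average_def split_def)
qed

lemma cell_integrable: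
  fixes f :: "space3 \<Rightarrow> real"
  assumes [measurable]: "f \<in> borel_measurable borel" and bd: "\<And>y. \<bar>f y\<bar> \<le> B"
  shows "set_integrable lborel (P l) f"
proof (unfold set_integrable_def, rule integrableI_bounded_set[where A = "P l" and B = B])
  show "emeasure lborel (P l) < \<infinity>" by (rule cell_finite)
  show "AE x\<in>P l in lborel. norm (indicat_real (P l) x *\<^sub>R f x) \<le> B"
    using bd by (auto simp: indicator_def)
qed auto

text \<open>
  Applied with \<open>c = 0\<close> for bounds and with \<open>c = g (x, v)\<close> for the averaging error.
\<close>

lemma cell_average_near:
  assumes g: "g \<in> borel_measurable borel" and bd: "\<And>z. \<bar>g z\<bar> \<le> A"
    and x: "x \<in> P l" and c: "\<And>y. y \<in> P l \<Longrightarrow> \<bar>g (y, v) - c\<bar> \<le> B"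
  shows "\<bar>cell_average P g (x, v) - c\<bar> \<le> B"
proof -
  let ?m = "measure lborel (P l)"
  have gv [measurable]: "(\<lambda>y. g (y, v)) \<in> borel_measurable borel"
    by (rule borel_measurable_at_phase[OF g]) simp_all
  have i1: "set_integrable lborel (P l) (\<lambda>y. g (y, v))"
    by (rule cell_integrable[OF gv bd])
  have ic: "set_integrable lborel (P l) (\<lambda>y. k)" for k :: real
    by (rule cell_integrable[where B = "\<bar>k\<bar>"]) auto
  have k: "(LINT y:P l|lborel. k) = k * ?m" for k :: real
    by (simp add: set_lebesgue_integral_def)
  have "\<bar>LINT y:P l|lborel. g (y, v) - c\<bar> \<le> (LINT y:P l|lborel. B)"
  proof -
    have "\<bar>LINT y:P l|lborel. g (y, v) - c\<bar> \<le> (LINT y:P l|lborel. \<bar>g (y, v) - c\<bar>)"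
      using set_integral_norm_bound[OF set_integral_diff(1)[OF i1 ic[of c]]] by simp
    also have "\<dots> \<le> (LINT y:P l|lborel. B)"
      using set_integrable_norm[OF set_integral_diff(1)[OF i1 ic[of c]]] c
      by (intro set_integral_mono ic) auto
    finally show ?thesis .
  qed
  then have "\<bar>(LINT y:P l|lborel. g (y, v)) - c * ?m\<bar> \<le> B * ?m"
    by (simp add: set_integral_diff(2)[OF i1 ic] k)
  moreover have "cell_average P g (x, v) - c = ((LINT y:P l|lborel. g (y, v)) - c * ?m) / ?m"
    using cell_pos[of l] by (simp add: cell_average_eq[OF x] diff_divide_distrib)
  ultimately show ?thesis
    using cell_pos[of l] by (simp add: divide_le_eq)
qed

lemma cell_average_nonneg:
  assumes "\<And>z. 0 \<le> g z"
  shows "0 \<le> cell_average P g z"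
proof -
  obtain l where "fst z \<in> P l" by (rule cell_cover)
  from cell_average_eq[OF this, of g "snd z"] show ?thesis
    using assms cell_pos[of l] by (simp add: set_lebesgue_integral_def integral_nonneg)
qed

lemma cell_average_dominated:
  assumes g: "g \<in> borel_measurable borel" and d: "dominated A s t g" and s: "0 \<le> s"
  shows "dominated (exp 1 * A) s t (cell_average P g)"
  unfolding dominated_def
proof
  fix z :: phase
  obtain x v where z: "z = (x, v)" by (cases z)
  obtain l where x: "x \<in> P l" by (rule cell_cover)
  have "\<bar>cell_average P g (x, v) - 0\<bar> \<le> exp 1 * A * flow_weight s t (x, v)"
  proof (rule cell_average_near[OF g dominated_bounded[OF d s] x])
    fix y assume y: "y \<in> P l"
    have "exp (norm (y - x)) \<le> exp 1"
      using cell_dist[OF x y] small by simp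
    then have "flow_weight s t (y, v) \<le> exp 1 * flow_weight s t (x, v)"
      using flow_weight_shift[of s t y v x] mult_right_mono[OF _ flow_weight_nonneg[of s t "(x, v)"]] by (meson order_trans)
    then have "A * flow_weight s t (y, v) \<le> A * (exp 1 * flow_weight s t (x, v))"
      using dominated_nonneg[OF d] by (intro mult_left_mono)
    then show "\<bar>g (y, v) - 0\<bar> \<le> exp 1 * A * flow_weight s t (x, v)"
      using dominatedD[OF d, of "(y, v)"] by (simp add: mult.left_commute mult.commute)
  qed
  then show "\<bar>cell_average P g z\<bar> \<le> exp 1 * A * flow_weight s t z" by (simp add: z)
qed

lemma cell_average_diff:
  assumes g: "g \<in> borel_measurable borel" "\<And>z. \<bar>g z\<bar> \<le> A" and h: "h \<in> borel_measurable borel" "\<And>z. \<bar>h z\<bar> \<le> B"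
  shows "cell_average P (\<lambda>z. g z - h z) z = cell_average P g z - cell_average P h z"
proof -
  obtain l where x: "fst z \<in> P l" by (rule cell_cover)
  have "set_integrable lborel (P l) (\<lambda>y. g (y, snd z))" "set_integrable lborel (P l) (\<lambda>y. h (y, snd z))"
    by (rule cell_integrable[OF borel_measurable_at_phase[OF g(1)] g(2)]; simp)
      (rule cell_integrable[OF borel_measurable_at_phase[OF h(1)] h(2)]; simp)
  from set_integral_diff(2)[OF this] show ?thesis
    using cell_average_eq[OF x, of _ "snd z"] by (simp add: diff_divide_distrib)
qed

lemma cell_average_diff_dominated:
  assumes g: "g \<in> borel_measurable borel" "dominated A s t g" and h: "h \<in> borel_measurable borel" "dominated B s t h"
    and d: "dominated C s t (\<lambda>z. g z - h z)" and s: "0 \<le> s"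
  shows "dominated (exp 1 * C) s t (\<lambda>z. cell_average P g z - cell_average P h z)"
proof -
  have "(\<lambda>z. g z - h z) \<in> borel_measurable borel" using g h by measurable
  from cell_average_dominated[OF this d s] show ?thesis
    by (simp only: cell_average_diff[OF g(1) dominated_bounded[OF g(2) s] h(1) dominated_bounded[OF h(2) s], abs_def])
qed

lemma cell_average_cong_AE:
  assumes m: "g \<in> borel_measurable borel" "h \<in> borel_measurable borel" and eq: "AE z in lborel. g z = h z"
  shows "AE z in lborel. cell_average P g z = cell_average P h z"
proof -
  note [measurable] = m cell_average_measurable[OF m(1)] cell_average_measurable[OF m(2)]
  have pm: "Measurable.pred borel (\<lambda>z. g z = h z)" "Measurable.pred borel (\<lambda>z. cell_average P g z = cell_average P h z)"
    by measurable
  have "AE v in lborel. AE x in lborel. g (x, v) = h (x, v)"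
    using eq unfolding AE_phase_swap_iff[OF pm(1)] .
  then have "AE v in lborel. AE x in lborel. cell_average P g (x, v) = cell_average P h (x, v)"
  proof eventually_elim
    fix v :: space3 assume ae: "AE x in lborel. g (x, v) = h (x, v)"
    have "(LINT y:P l|lborel. g (y, v)) = (LINT y:P l|lborel. h (y, v))" for l
      unfolding set_lebesgue_integral_def
    proof (rule integral_cong_AE)
      have "(\<lambda>y. k (y, v)) \<in> borel_measurable borel" if "k \<in> borel_measurable borel" for k :: "phase \<Rightarrow> real"
        by (rule borel_measurable_at_phase[OF that]) simp_all
      from this[OF m(1)] this[OF m(2)]
      show "(\<lambda>y. indicator (P l) y *\<^sub>R g (y, v)) \<in> borel_measurable lborel"
        "(\<lambda>y. indicator (P l) y *\<^sub>R h (y, v)) \<in> borel_measurable lborel"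
        by (auto intro!: borel_measurable_scaleR)
      show "AE y in lborel. indicator (P l) y *\<^sub>R g (y, v) = indicator (P l) y *\<^sub>R h (y, v)"
        using ae by eventually_elim simp
    qed
    then have "cell_average P g (x, v) = cell_average P h (x, v)" for x
      by (simp add: cell_average_def)
    then show "AE x in lborel. cell_average P g (x, v) = cell_average P h (x, v)" by simp
  qed
  then show ?thesis unfolding AE_phase_swap_iff[OF pm(2)] .
qed

text \<open>
  Averaging over the cells is self-adjoint: either side is the sum, over the cells, of the product of the two
  integrals over the cell, divided by its volume. Hence a density and its average, although they play
  different roles in the discrete collision operator, produce a symmetric function of the two
  velocities once the position is integrated out.
\<close>

lemma cell_average_symmetric:
  assumes g: "g \<in> borel_measurable borel"
    and int: "\<And>v u. integrable lborel (\<lambda>x. g (x, v) * cell_average P g (x, u))"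
  shows "(LINT x|lborel. g (x, v) * cell_average P g (x, u)) = (LINT x|lborel. g (x, u) * cell_average P g (x, v))"
proof -
  have expand: "(LINT x|lborel. g (x, v) * cell_average P g (x, u))
      = (\<Sum>l. (LINT x:P l|lborel. g (x, v)) * (LINT x:P l|lborel. g (x, u)) / measure lborel (P l))" for v u
  proof -
    have U: "(\<Union>l. P l) = UNIV" and disj: "disjoint_family P" using partition by (auto simp: cell_partition_def)
    have "(LINT x|lborel. g (x, v) * cell_average P g (x, u))
        = (LINT x:(\<Union>l. P l)|lborel. g (x, v) * cell_average P g (x, u))"
      by (simp add: U set_lebesgue_integral_def)
    also have "\<dots> = (\<Sum>l. LINT x:P l|lborel. g (x, v) * cell_average P g (x, u))"
    proof (rule lebesgue_integral_countable_add)
      show "\<And>i j. i \<noteq> j \<Longrightarrow> P i \<inter> P j = {}" using disj by (auto simp: disjoint_family_on_def)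
      show "set_integrable lborel (\<Union> (range P)) (\<lambda>x. g (x, v) * cell_average P g (x, u))"
        using int by (simp add: U set_integrable_def)
    qed simp
    also have "\<dots> = (\<Sum>l. (LINT x:P l|lborel. g (x, v)) * (LINT x:P l|lborel. g (x, u)) / measure lborel (P l))"
    proof (rule suminf_cong)
      fix l
      have "(LINT x:P l|lborel. g (x, v) * cell_average P g (x, u))
          = (LINT x:P l|lborel. g (x, v) * ((LINT x:P l|lborel. g (x, u)) / measure lborel (P l)))"
        by (rule set_lebesgue_integral_cong) (auto simp: cell_average_eq)
      then show "(LINT x:P l|lborel. g (x, v) * cell_average P g (x, u))
          = (LINT x:P l|lborel. g (x, v)) * (LINT x:P l|lborel. g (x, u)) / measure lborel (P l)" by simp
    qed
    finally show ?thesis .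
  qed
  show ?thesis unfolding expand by (simp add: mult.commute)
qed

end

section \<open>Conservation of mass, momentum and energy\<close>

text \<open>
  The integral of the weight over the phase space; it is the same for all times, as the free flow
  preserves the measure.
\<close>

definition weight_mass :: "real \<Rightarrow> real" where
  "weight_mass s = enn2real (\<integral>\<^sup>+ v. ennreal (exp (- s * ((v::space3) \<bullet> v))) \<partial>lborel)
     * enn2real (\<integral>\<^sup>+ x. ennreal (exp (- 1 * norm (x::space3))) \<partial>lborel)"

lemma weight_mass_nonneg: "0 \<le> weight_mass s"
  by (simp add: weight_mass_def)

lemma nn_integral_exp_norm_shift:
  "(\<integral>\<^sup>+ x. ennreal (exp (- norm (x - c :: space3))) \<partial>lborel) = (\<integral>\<^sup>+ x. ennreal (exp (- 1 * norm (x::space3))) \<partial>lborel)"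
proof -
  have "(\<integral>\<^sup>+ x. ennreal (exp (- 1 * norm (- c + x))) \<partial>lborel) = (\<integral>\<^sup>+ x. ennreal (exp (- 1 * norm (x::space3))) \<partial>lborel)"
    by (rule nn_integral_lborel_shift[where F = "\<lambda>x. ennreal (exp (- 1 * norm x))"]) measurable
  then show ?thesis by simp
qed

lemma nn_integral_flow_weight:
  assumes s: "0 < s"
  shows "(\<integral>\<^sup>+ z. ennreal (flow_weight s t z) \<partial>lborel) = ennreal (weight_mass s)"
proof -
  let ?G = "\<integral>\<^sup>+ v. ennreal (exp (- s * ((v::space3) \<bullet> v))) \<partial>lborel"
  let ?E = "\<integral>\<^sup>+ x. ennreal (exp (- 1 * norm (x::space3))) \<partial>lborel"
  have [measurable]: "(\<lambda>z. ennreal (flow_weight s t z)) \<in> borel_measurable (lborel \<Otimes>\<^sub>M lborel)"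
    unfolding lborel_prod by measurable
  have "(\<integral>\<^sup>+ z. ennreal (flow_weight s t z) \<partial>lborel) = (\<integral>\<^sup>+ z. ennreal (flow_weight s t z) \<partial>(lborel \<Otimes>\<^sub>M lborel))"
    by (simp only: lborel_prod)
  also have "\<dots> = (\<integral>\<^sup>+ v. \<integral>\<^sup>+ x. ennreal (flow_weight s t (x, v)) \<partial>lborel \<partial>lborel)"
    by (rule lborel_pair.nn_integral_snd[symmetric]) measurable
  also have "\<dots> = (\<integral>\<^sup>+ v. ennreal (exp (- s * ((v::space3) \<bullet> v))) * ?E \<partial>lborel)"
  proof (rule nn_integral_cong)
    fix v :: space3
    have "(\<integral>\<^sup>+ x. ennreal (flow_weight s t (x, v)) \<partial>lborel)
        = (\<integral>\<^sup>+ x. ennreal (exp (- s * (v \<bullet> v))) * ennreal (exp (- norm (x - t *\<^sub>R v))) \<partial>lborel)"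
      by (intro nn_integral_cong) (simp add: flow_weight_def flip: ennreal_mult exp_add)
    also have "\<dots> = ennreal (exp (- s * (v \<bullet> v))) * ?E"
      by (subst nn_integral_cmult) (measurable, simp only: nn_integral_exp_norm_shift)
    finally show "(\<integral>\<^sup>+ x. ennreal (flow_weight s t (x, v)) \<partial>lborel) = ennreal (exp (- s * (v \<bullet> v))) * ?E" .
  qed
  also have "\<dots> = ?G * ?E" by (rule nn_integral_multc) measurable
  also have "\<dots> = ennreal (weight_mass s)"
    using nn_integral_gaussian_finite[OF s] nn_integral_exp_norm_finite[of 1]
    unfolding weight_mass_def by (subst ennreal_mult) (auto simp del: mult_minus1)
  finally show ?thesis .
qed

lemma dominated_integrable:
  assumes s: "0 < s" and g: "g \<in> borel_measurable borel" and d: "dominated A s t g"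
  shows "integrable lborel g" and "L1_norm g \<le> ennreal (A * weight_mass s)"
proof -
  have "L1_norm g \<le> (\<integral>\<^sup>+ z. ennreal A * ennreal (flow_weight s t z) \<partial>lborel)"
    unfolding L1_norm_def using dominatedD[OF d] dominated_nonneg[OF d]
    by (intro nn_integral_mono) (simp add: flow_weight_nonneg ennreal_leI flip: ennreal_mult)
  also have "\<dots> = ennreal A * (\<integral>\<^sup>+ z. ennreal (flow_weight s t z) \<partial>lborel)"
    by (rule nn_integral_cmult) simp
  also have "\<dots> = ennreal (A * weight_mass s)"
    using dominated_nonneg[OF d] by (simp add: nn_integral_flow_weight[OF s] ennreal_mult weight_mass_nonneg)
  finally show *: "L1_norm g \<le> ennreal (A * weight_mass s)" .
  show "integrable lborel g"
    using g * by (intro integrableI_bounded) (auto simp: L1_norm_def le_less_trans)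
qed

lemma invariant_measurable: "invariant i \<in> borel_measurable borel"
  unfolding invariant_def[abs_def] by (cases "i = 0"; cases "i = 1"; cases "i = 2"; cases "i = 3") (simp_all, measurable)

text \<open>
  Half of the Gaussian decay pays for the quadratic growth.
\<close>

lemma invariant_bound:
  assumes s: "0 < s"
  shows "\<bar>invariant i v\<bar> * flow_weight s t (x, v) \<le> (1 + 2 / s) * flow_weight (s / 2) t (x, v)"
proof -
  have c: "\<bar>v $ k\<bar> \<le> 1 + v \<bullet> v" for k
  proof -
    have "\<bar>v $ k\<bar> \<le> norm v" by (rule component_le_norm_cart)
    also have "\<dots> \<le> 1 + (norm v)\<^sup>2"
    proof -
      have "2 * norm v \<le> 1 + (norm v)\<^sup>2"
        using zero_le_power2[of "norm v - 1"] by (simp add: power2_diff)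
      then show ?thesis using norm_ge_zero[of v] by linarith
    qed
    finally show ?thesis by (simp add: power2_norm_eq_inner)
  qed
  have "\<bar>invariant i v\<bar> \<le> 1 + v \<bullet> v"
    using c by (auto simp: invariant_def)
  also have "\<dots> \<le> (1 + 2 / s) * (1 + s / 2 * (v \<bullet> v))"
  proof -
    have "(1 + 2 / s) * (1 + s / 2 * (v \<bullet> v)) = 1 + v \<bullet> v + (2 / s + s / 2 * (v \<bullet> v))"
      using s by (simp add: field_simps)
    moreover have "0 \<le> 2 / s + s / 2 * (v \<bullet> v)" using s by simp
    ultimately show ?thesis by linarith
  qed
  also have "\<dots> \<le> (1 + 2 / s) * exp (s / 2 * (v \<bullet> v))"
    using s by (intro mult_left_mono exp_ge_add_one_self) auto
  finally have "\<bar>invariant i v\<bar> * flow_weight s t (x, v)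
      \<le> (1 + 2 / s) * exp (s / 2 * (v \<bullet> v)) * flow_weight s t (x, v)"
    by (rule mult_right_mono) (rule flow_weight_nonneg)
  also have "\<dots> = (1 + 2 / s) * (exp (s / 2 * (v \<bullet> v)) * flow_weight s t (x, v))"
    by (rule mult.assoc)
  also have "exp (s / 2 * (v \<bullet> v)) * flow_weight s t (x, v) = flow_weight (s / 2) t (x, v)"
    by (simp add: flow_weight_def flip: exp_add)
  finally show ?thesis .
qed

lemma invariant_dominated:
  assumes s: "0 < s" and d: "dominated A s t g"
  shows "dominated (A * (1 + 2 / s)) (s / 2) t (\<lambda>z. invariant i (snd z) * g z)"
  unfolding dominated_def
proof
  fix z :: phase
  have "\<bar>invariant i (snd z) * g z\<bar> \<le> \<bar>invariant i (snd z)\<bar> * (A * flow_weight s t z)"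
    unfolding abs_mult by (intro mult_left_mono dominatedD[OF d]) simp
  also have "\<dots> \<le> A * ((1 + 2 / s) * flow_weight (s / 2) t z)"
    using invariant_bound[OF s, of i "snd z" t "fst z"] dominated_nonneg[OF d]
    by (simp add: mult.left_commute mult_left_mono)
  finally show "\<bar>invariant i (snd z) * g z\<bar> \<le> A * (1 + 2 / s) * flow_weight (s / 2) t z"
    by (simp add: mult.assoc)
qed

lemma invariant_product_measurable:
  fixes g :: "phase \<Rightarrow> real"
  assumes "g \<in> borel_measurable borel"
  shows "(\<lambda>z. invariant i (snd z) * g z) \<in> borel_measurable borel"
  by (intro borel_measurable_times assms measurable_compose[OF measurable_snd_phase invariant_measurable])

lemma invariant_conserved:
  assumes "reachable v vs u us"
  shows "invariant i u + invariant i us = invariant i v + invariant i vs"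
proof -
  have sum: "u + us = v + vs" and e: "u \<bullet> u + us \<bullet> us = v \<bullet> v + vs \<bullet> vs"
    using assms by (auto simp: reachable_def)
  have "u $ k + us $ k = v $ k + vs $ k" for k
    using arg_cong[OF sum, of "\<lambda>w. w $ k"] by simp
  then show ?thesis using e by (simp add: invariant_def)
qed

lemma integral_free_flow:
  fixes g :: "phase \<Rightarrow> real"
  assumes g: "g \<in> borel_measurable borel" "integrable lborel (\<lambda>z. invariant i (snd z) * g z)"
    and g': "integrable lborel (\<lambda>z. invariant i (snd z) * free_flow q g z)"
  shows "(LINT z|lborel. invariant i (snd z) * free_flow q g z) = (LINT z|lborel. invariant i (snd z) * g z)"
proof -
  have I: "(LINT z|lborel. f z) = (LINT v|lborel. LINT x|lborel. f (x, v))"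
    if "integrable lborel f" for f :: "phase \<Rightarrow> real"
  proof -
    have "integrable (lborel \<Otimes>\<^sub>M lborel) (\<lambda>(x, v). f (x, v))" using that by (simp add: lborel_prod)
    from lborel_pair.integral_snd[OF this] show ?thesis by (simp add: lborel_prod)
  qed
  have "(LINT x|lborel. invariant i v * free_flow q g (x, v)) = (LINT x|lborel. invariant i v * g (x, v))" for v
  proof -
    have [measurable]: "(\<lambda>x. g (x, v)) \<in> borel_measurable borel"
      by (rule borel_measurable_at_phase[OF g(1)]) simp_all
    have "(LINT x|lborel. invariant i v * g (x, v)) = (LINT x|distr lborel borel ((+) (- (q *\<^sub>R v))). invariant i v * g (x, v))"
      by (simp add: lborel_distr_plus)
    also have "\<dots> = (LINT x|lborel. invariant i v * g (- (q *\<^sub>R v) + x, v))"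
      by (subst integral_distr) auto
    also have "\<dots> = (LINT x|lborel. invariant i v * free_flow q g (x, v))"
      by (simp add: free_flow_apply)
    finally show ?thesis ..
  qed
  then show ?thesis unfolding I[OF g(2)] I[OF g'] snd_conv by (simp only:)
qed

locale collision_cells = collision b b0 lam + cells P
  for b b0 lam P
begin

text \<open>
  In the weak form, the change of variables \<open>collide\<close> moves the gain term onto the test function, so the
  integral becomes that of \<open>b (\<phi>(v') - \<phi>(v))\<close> against \<open>S(v, v\<^sub>*)\<close>, where \<open>S\<close> is the product of the density and its
  cell average, integrated over the position. As \<open>S\<close> is symmetric by \<open>cell_average_symmetric\<close>, adding the
  same integral with \<open>v\<close> and \<open>v\<^sub>*\<close> exchanged yields the sum
  \<open>\<phi>(v') + \<phi>(v'\<^sub>*) - \<phi>(v) - \<phi>(v\<^sub>*)\<close>, which vanishes for the collision invariants.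
\<close>

lemma J_cell_conservation:
  assumes s: "0 < s" and g: "g \<in> borel_measurable borel" and d: "dominated A s t g"
  shows "(LINT z|lborel. invariant i (snd z) * J_cell b P g z) = 0"
proof -
  define h where "h = cell_average P g"
  have h: "h \<in> borel_measurable borel" unfolding h_def by (rule cell_average_measurable[OF g])
  have dh: "dominated (exp 1 * A) s t h" unfolding h_def by (rule cell_average_dominated[OF g d]) (use s in simp)
  let ?B = "exp 1 * A"
  let ?C = "A * ?B * (1 + 2 / s)"
  have A: "0 \<le> A" by (rule dominated_nonneg[OF d])
  define p1 where "p1 m = post1 (fst m) (fst (snd m)) (snd (snd m))" for m :: "space3 \<times> space3 \<times> space3"
  define p2 where "p2 m = post2 (fst m) (fst (snd m)) (snd (snd m))" for m :: "space3 \<times> space3 \<times> space3"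
  define r where "r m = rate (fst m) (fst (snd m)) (snd (snd m))" for m :: "space3 \<times> space3 \<times> space3"
  let ?N = "(lborel :: space3 measure) \<Otimes>\<^sub>M collision_measure"
  define G where "G q = r (snd q) * (invariant i (fst (snd q)) * (g (fst q, p1 (snd q)) * h (fst q, p2 (snd q))))"
    for q :: "space3 \<times> space3 \<times> space3 \<times> space3"
  define L where "L q = r (snd q) * (invariant i (fst (snd q)) * (g (fst q, fst (snd q)) * h (fst q, fst (snd (snd q)))))"
    for q :: "space3 \<times> space3 \<times> space3 \<times> space3"
  interpret N: pair_sigma_finite "lborel :: space3 measure" collision_measure
    by (intro pair_sigma_finite.intro lborel.sigma_finite_measure_axioms vel_vel_sphere.P.sigma_finite_measure_axioms)
  note [measurable] = collision_measure_projections
  have p [measurable]: "p1 \<in> borel_measurable collision_measure" "p2 \<in> borel_measurable collision_measure"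
    unfolding p1_def[abs_def] p2_def[abs_def] by measurable
  have r [measurable]: "r \<in> borel_measurable collision_measure"
    unfolding r_def[abs_def] by (intro rate_measurable) measurable
  have [measurable]: "(\<lambda>m. invariant i (fst m)) \<in> borel_measurable collision_measure"
    by (rule measurable_compose[OF _ invariant_measurable]) measurable
  have GL: "G \<in> borel_measurable ?N" "L \<in> borel_measurable ?N"
    unfolding G_def[abs_def] L_def[abs_def]
    by (intro borel_measurable_times borel_measurable_at_phase[OF g] borel_measurable_at_phase[OF h]; measurable)+
  have r_nonneg: "0 \<le> r m" if "m \<in> space collision_measure" for m
    using that by (auto simp: r_def space_pair_measure space_sphere_measure intro!: rate_nonneg)
  (* The loss and the gain term are bounded by the same integrable function. *)
  let ?U = "\<lambda>q. ?C * flow_weight (s / 2) t (fst q, fst (snd q)) * (r (snd q) * exp (- s * (fst (snd (snd q)) \<bullet> fst (snd (snd q)))))"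
  have W: "(\<lambda>q::space3 \<times> space3 \<times> space3 \<times> space3. flow_weight (s / 2) t (fst q, fst (snd q))) \<in> borel_measurable ?N"
    by (rule measurable_compose[OF borel_measurable_phase_Pair measurable_flow_weight]) measurable
  have [measurable]: "(\<lambda>q. fst (snd (snd q))) \<in> borel_measurable ?N" by measurable
  have U: "?U \<in> borel_measurable ?N" using W by measurable
  have bound: "\<bar>K q\<bar> \<le> ?U q"
    if q: "q \<in> space ?N" and K: "K q = r (snd q) * (invariant i (fst (snd q)) * (g (fst q, u) * h (fst q, us)))"
      and re: "reachable (fst (snd q)) (fst (snd (snd q))) u us" for K :: "space3 \<times> space3 \<times> space3 \<times> space3 \<Rightarrow> real" and q u us
  proof -
    let ?x = "fst q" and ?v = "fst (snd q)" and ?vs = "fst (snd (snd q))"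
    have rn: "0 \<le> r (snd q)" using q by (auto simp: space_pair_measure intro!: r_nonneg)
    have "\<bar>K q\<bar> = r (snd q) * (\<bar>invariant i ?v\<bar> * \<bar>g (?x, u) * h (?x, us)\<bar>)"
      using rn by (simp add: K abs_mult)
    also have "\<dots> \<le> r (snd q) * (\<bar>invariant i ?v\<bar> * (A * ?B * flow_weight s t (?x, ?v) * exp (- s * (?vs \<bullet> ?vs))))"
      using rn by (intro mult_left_mono product_reachable_bound[OF d dh re]) auto
    also have "\<dots> = A * ?B * (r (snd q) * exp (- s * (?vs \<bullet> ?vs))) * (\<bar>invariant i ?v\<bar> * flow_weight s t (?x, ?v))"
      by (simp add: ac_simps)
    also have "\<dots> \<le> A * ?B * (r (snd q) * exp (- s * (?vs \<bullet> ?vs))) * ((1 + 2 / s) * flow_weight (s / 2) t (?x, ?v))"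
      using rn A by (intro mult_left_mono invariant_bound[OF s]) auto
    finally show ?thesis by (simp add: ac_simps)
  qed
  have U_fin: "(\<integral>\<^sup>+ q. ennreal (?U q) \<partial>?N) < \<infinity>"
  proof -
    have "(\<integral>\<^sup>+ q. ennreal (?U q) \<partial>?N) = (\<integral>\<^sup>+ x. \<integral>\<^sup>+ m. ennreal (?U (x, m)) \<partial>collision_measure \<partial>lborel)"
      by (rule vel_vel_sphere.nn_integral_fst[symmetric]) (rule measurable_compose[OF U measurable_ennreal])
    also have "\<dots> \<le> (\<integral>\<^sup>+ x. \<integral>\<^sup>+ v. ennreal (?C * mass s) * ennreal (flow_weight (s / 2) t (x, v)) \<partial>lborel \<partial>lborel)"
    proof (rule nn_integral_mono)
      fix x :: space3
      have Ux: "(\<lambda>m. ?U (x, m)) \<in> borel_measurable collision_measure"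
        by (rule measurable_compose[OF measurable_Pair1' U]) simp
      have "(\<integral>\<^sup>+ m. ennreal (?U (x, m)) \<partial>collision_measure)
          = (\<integral>\<^sup>+ v. \<integral>\<^sup>+ p. ennreal (?U (x, v, p)) \<partial>partner_measure \<partial>lborel)"
        by (rule vel_sphere.nn_integral_fst[symmetric]) (rule measurable_compose[OF Ux measurable_ennreal])
      also have "\<dots> \<le> (\<integral>\<^sup>+ v. ennreal (?C * mass s) * ennreal (flow_weight (s / 2) t (x, v)) \<partial>lborel)"
      proof (rule nn_integral_mono)
        fix v :: space3
        have c: "0 \<le> ?C * flow_weight (s / 2) t (x, v)" using A s by (simp add: flow_weight_nonneg)
        have [measurable]: "(\<lambda>p. rate v (fst p) (snd p)) \<in> borel_measurable partner_measure"
          by (rule rate_measurable) measurable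
        have "(\<integral>\<^sup>+ p. ennreal (?U (x, v, p)) \<partial>partner_measure)
            = (\<integral>\<^sup>+ p. ennreal (?C * flow_weight (s / 2) t (x, v)) * ennreal (rate v (fst p) (snd p) * exp (- s * (fst p \<bullet> fst p))) \<partial>partner_measure)"
          by (intro nn_integral_cong) (simp only: ennreal_mult'[OF c] r_def fst_conv snd_conv)
        also have "\<dots> = ennreal (?C * flow_weight (s / 2) t (x, v)) * (\<integral>\<^sup>+ p. ennreal (rate v (fst p) (snd p) * exp (- s * (fst p \<bullet> fst p))) \<partial>partner_measure)"
          by (rule nn_integral_cmult) measurable
        also have "\<dots> \<le> ennreal (?C * flow_weight (s / 2) t (x, v)) * ennreal (mass s)"
          by (intro mult_left_mono nn_integral_rate_le[OF s]) simp
        also have "\<dots> = ennreal (?C * mass s) * ennreal (flow_weight (s / 2) t (x, v))"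
          using A s by (simp add: flow_weight_nonneg mass_nonneg mult.assoc mult.commute mult.left_commute flip: ennreal_mult)
        finally show "(\<integral>\<^sup>+ p. ennreal (?U (x, v, p)) \<partial>partner_measure) \<le> ennreal (?C * mass s) * ennreal (flow_weight (s / 2) t (x, v))" .
      qed
      finally show "(\<integral>\<^sup>+ m. ennreal (?U (x, m)) \<partial>collision_measure) \<le> (\<integral>\<^sup>+ v. ennreal (?C * mass s) * ennreal (flow_weight (s / 2) t (x, v)) \<partial>lborel)" .
    qed
    also have "\<dots> = (\<integral>\<^sup>+ z. ennreal (?C * mass s) * ennreal (flow_weight (s / 2) t z) \<partial>(lborel \<Otimes>\<^sub>M lborel))"
      by (rule lborel.nn_integral_fst) (simp only: lborel_prod, measurable)
    also have "\<dots> = ennreal (?C * mass s) * (\<integral>\<^sup>+ z. ennreal (flow_weight (s / 2) t z) \<partial>lborel)"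
      unfolding lborel_prod by (rule nn_integral_cmult) measurable
    also have "\<dots> < \<infinity>"
      using nn_integral_flow_weight[of "s / 2" t] s by (simp add: ennreal_mult_less_top)
    finally show ?thesis .
  qed
  have int: "integrable ?N K" if K: "K \<in> borel_measurable ?N" and bd: "\<And>q. q \<in> space ?N \<Longrightarrow> \<bar>K q\<bar> \<le> ?U q" for K
  proof (rule integrableI_bounded[OF K])
    have "(\<integral>\<^sup>+ q. ennreal (norm (K q)) \<partial>?N) \<le> (\<integral>\<^sup>+ q. ennreal (?U q) \<partial>?N)"
      by (intro nn_integral_mono ennreal_leI) (simp only: real_norm_def bd)
    then show "(\<integral>\<^sup>+ q. ennreal (norm (K q)) \<partial>?N) < \<infinity>" using U_fin by (rule le_less_trans)
  qed
  have re: "reachable (fst m) (fst (snd m)) (p1 m) (p2 m)" if "m \<in> space collision_measure" for m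
    using that by (auto simp: p1_def p2_def space_pair_measure space_sphere_measure intro!: reachable_post)
  have intG: "integrable ?N G"
  proof (rule int[OF GL(1)])
    fix q assume q: "q \<in> space ?N"
    then have "snd q \<in> space collision_measure" by (auto simp: space_pair_measure)
    from re[OF this] show "\<bar>G q\<bar> \<le> ?U q"
      by (rule bound[OF q, where K = G, rotated]) (simp add: G_def)
  qed
  have intL: "integrable ?N L"
  proof (rule int[OF GL(2)])
    fix q assume q: "q \<in> space ?N"
    from reachable_refl show "\<bar>L q\<bar> \<le> ?U q"
      by (rule bound[OF q, where K = L, rotated]) (simp add: L_def)
  qed
  define S where "S v u = (LINT x|lborel. g (x, v) * h (x, u))" for v u
  have S_sym: "S v u = S u v" for v u
    unfolding S_def h_def
  proof (rule cell_average_symmetric[OF g], fold h_def)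
    fix v u :: space3
    have [measurable]: "(\<lambda>x. g (x, v) * h (x, u)) \<in> borel_measurable borel"
      by (intro borel_measurable_times borel_measurable_at_phase[OF g] borel_measurable_at_phase[OF h]) simp_all
    have "(\<integral>\<^sup>+ x. ennreal (norm (g (x, v) * h (x, u))) \<partial>lborel) \<le> (\<integral>\<^sup>+ x. ennreal (A * ?B) * ennreal (exp (- norm (x - t *\<^sub>R v))) \<partial>lborel)"
    proof (rule nn_integral_mono)
      fix x :: space3
      have "flow_weight s t (x, v) \<le> exp (- norm (x - t *\<^sub>R v))"
        using s by (simp add: flow_weight_def)
      then have "\<bar>g (x, v)\<bar> \<le> A * exp (- norm (x - t *\<^sub>R v))"
        using dominatedD[OF d, of "(x, v)"] A by (meson mult_left_mono order_trans)
      then have "norm (g (x, v) * h (x, u)) \<le> (A * exp (- norm (x - t *\<^sub>R v))) * ?B"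
        using dominated_bounded[OF dh, of "(x, u)"] s A unfolding real_norm_def abs_mult
        by (intro mult_mono) auto
      then show "ennreal (norm (g (x, v) * h (x, u))) \<le> ennreal (A * ?B) * ennreal (exp (- norm (x - t *\<^sub>R v)))"
        using A by (simp add: ac_simps ennreal_leI flip: ennreal_mult)
    qed
    also have "\<dots> = ennreal (A * ?B) * (\<integral>\<^sup>+ x. ennreal (exp (- 1 * norm (x::space3))) \<partial>lborel)"
      by (subst nn_integral_cmult) (measurable, simp only: nn_integral_exp_norm_shift)
    also have "\<dots> < \<infinity>" using nn_integral_exp_norm_finite[of 1] by (simp add: ennreal_mult_less_top)
    finally show "integrable lborel (\<lambda>x. g (x, v) * h (x, u))" by (intro integrableI_bounded) auto
  qed
  (* The gain and the loss, integrated over the position and with the gain moved onto the test function. *)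
  define a where "a m = r m * invariant i (p1 m) * S (fst m) (fst (snd m))" for m
  define c where "c m = r m * invariant i (fst m) * S (fst m) (fst (snd m))" for m
  (* collide is an involution that leaves the rate unchanged. *)
  have nw: "r (collide m) = r m" "p1 (collide m) = fst m" if "m \<in> space collision_measure" for m
  proof -
    obtain v vs w where m: "m = (v, vs, w)" by (cases m)
    have w: "norm w = 1" "w \<bullet> w = 1" using that by (auto simp: m space_pair_measure space_sphere_measure norm_eq_1)
    have V: "post1 v vs w - post2 v vs w = (v - vs) - (2 * ((v - vs) \<bullet> w)) *\<^sub>R w"
      by (simp add: post1_def post2_def algebra_simps flip: scaleR_2)
    have Vw: "(post1 v vs w - post2 v vs w) \<bullet> - w = (v - vs) \<bullet> w"
      unfolding V using w by (simp add: inner_diff_left)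
    have "(norm (post1 v vs w - post2 v vs w))\<^sup>2 = (norm (v - vs))\<^sup>2"
      unfolding V power2_norm_eq_inner using w
      by (simp add: inner_diff_left inner_diff_right inner_commute algebra_simps)
    then have "norm (post1 v vs w - post2 v vs w) = norm (v - vs)" by simp
    with Vw show "r (collide m) = r m" by (simp add: m r_def collide_def rate_def)
    show "p1 (collide m) = fst m"
      using Vw by (simp add: m p1_def collide_def) (simp add: post1_def[of "post1 v vs w"], simp add: post1_def)
  qed
  have G_int: "(LINT x|lborel. G (x, m)) = a (collide m)" if "m \<in> space collision_measure" for m
    using nw[OF that] by (simp add: G_def a_def S_def) (simp add: collide_def p1_def p2_def mult.assoc)
  have L_int: "(LINT x|lborel. L (x, m)) = c m" for m
    by (simp add: L_def c_def S_def mult.assoc)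
  have swap: "a (exchange m) = r m * invariant i (p2 m) * S (fst m) (fst (snd m))"
    "c (exchange m) = r m * invariant i (fst (snd m)) * S (fst m) (fst (snd m))" for m
  proof -
    obtain v vs w where m: "m = (v, vs, w)" by (cases m)
    have "r (exchange m) = r m" "p1 (exchange m) = p2 m"
      by (simp_all add: m r_def rate_def exchange_def norm_minus_commute p1_def p2_def post1_def post2_def algebra_simps)
    then show "a (exchange m) = r m * invariant i (p2 m) * S (fst m) (fst (snd m))"
      "c (exchange m) = r m * invariant i (fst (snd m)) * S (fst m) (fst (snd m))"
      using S_sym by (simp_all add: a_def c_def) (simp_all add: m exchange_def)
  qed
  have inv_dist: "integrable collision_measure f \<longleftrightarrow> integrable collision_measure (\<lambda>m. f (T m))"
    "(LINT m|collision_measure. f (T m)) = (LINT m|collision_measure. f m)"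
    if f: "f \<in> borel_measurable collision_measure" and T: "T \<in> collision_measure \<rightarrow>\<^sub>M collision_measure"
      and D: "distr collision_measure collision_measure T = collision_measure"
    for f :: "space3 \<times> space3 \<times> space3 \<Rightarrow> real" and T
    using integrable_distr_eq[OF T f] integral_distr[OF T f] by (simp_all add: D)
  have S_meas: "(\<lambda>m. S (fst m) (fst (snd m))) \<in> borel_measurable collision_measure"
    unfolding S_def
  proof (rule lborel.borel_measurable_lebesgue_integral)
    have "(\<lambda>q. g (snd q, fst (fst q)) * h (snd q, fst (snd (fst q)))) \<in> borel_measurable (collision_measure \<Otimes>\<^sub>M lborel)"
      by (intro borel_measurable_times borel_measurable_at_phase[OF g] borel_measurable_at_phase[OF h]; measurable)
    then show "(\<lambda>(m, x). g (x, fst m) * h (x, fst (snd m))) \<in> borel_measurable (collision_measure \<Otimes>\<^sub>M lborel)"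
      by (simp add: split_def)
  qed
  have ac [measurable]: "a \<in> borel_measurable collision_measure" "c \<in> borel_measurable collision_measure"
    unfolding a_def[abs_def] c_def[abs_def]
    by (intro borel_measurable_times r S_meas measurable_compose[OF _ invariant_measurable]; measurable)+
  have "integrable collision_measure (\<lambda>m. LINT x|lborel. G (x, m))"
    by (rule N.integrable_snd) (simp add: intG)
  then have "integrable collision_measure (\<lambda>m. a (collide m))"
    by (rule Bochner_Integration.integrable_cong[THEN iffD1, rotated -1]) (simp_all add: G_int)
  then have int_a: "integrable collision_measure a"
    by (simp only: inv_dist(1)[OF ac(1) measurable_collide distr_collide])
  have "integrable collision_measure (\<lambda>m. LINT x|lborel. L (x, m))"
    by (rule N.integrable_snd) (simp add: intL)
  then have int_c: "integrable collision_measure c" by (simp only: L_int)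
  note ex = inv_dist[OF ac(1) measurable_exchange distr_exchange] inv_dist[OF ac(2) measurable_exchange distr_exchange]
  have "2 * ((LINT m|collision_measure. a m) - (LINT m|collision_measure. c m))
      = (LINT m|collision_measure. (a m + a (exchange m)) - (c m + c (exchange m)))"
    using int_a int_c ex by simp
  also have "\<dots> = (LINT m|collision_measure. 0)"
  proof (rule Bochner_Integration.integral_cong[OF refl])
    fix m assume m: "m \<in> space collision_measure"
    have "(a m + a (exchange m)) - (c m + c (exchange m)) = r m * S (fst m) (fst (snd m))
        * ((invariant i (p1 m) + invariant i (p2 m)) - (invariant i (fst m) + invariant i (fst (snd m))))"
      unfolding swap unfolding a_def c_def by (simp add: algebra_simps)
    then show "(a m + a (exchange m)) - (c m + c (exchange m)) = 0"
      by (simp add: invariant_conserved[OF re[OF m]])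
  qed
  finally have ac_eq: "(LINT m|collision_measure. a m) = (LINT m|collision_measure. c m)" by simp
  have "(LINT q|?N. G q) = (LINT m|collision_measure. LINT x|lborel. G (x, m))"
    using N.integral_snd[of "\<lambda>x m. G (x, m)"] intG by simp
  also have "\<dots> = (LINT m|collision_measure. a (collide m))"
    by (rule Bochner_Integration.integral_cong[OF refl G_int])
  also have "\<dots> = (LINT m|collision_measure. a m)"
    by (rule inv_dist(2)[OF ac(1) measurable_collide distr_collide])
  also have "\<dots> = (LINT m|collision_measure. LINT x|lborel. L (x, m))" by (simp only: L_int ac_eq)
  also have "\<dots> = (LINT q|?N. L q)"
    using N.integral_snd[of "\<lambda>x m. L (x, m)"] intL by simp
  finally have zero: "(LINT q|?N. G q - L q) = 0" using intG intL by simp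
  have intD: "integrable ?N (\<lambda>q. G q - L q)" using intG intL by simp
  have dJ: "dominated (2 * A * ?B * mass s) s t (J_B b g h)" by (rule J_B_dominated[OF s g h d dh])
  have intJ: "integrable lborel (\<lambda>z. invariant i (snd z) * J_B b g h z)"
    by (rule dominated_integrable(1)[OF _ invariant_product_measurable[OF J_B_measurable[OF g h]] invariant_dominated[OF s dJ]])
      (use s in simp)
  have "(LINT z|lborel. invariant i (snd z) * J_B b g h z)
      = (LINT x|lborel. LINT v|lborel. invariant i v * J_B b g h (x, v))"
    using lborel_pair.integral_fst'[of "\<lambda>z. invariant i (snd z) * J_B b g h z"] intJ
    by (simp add: lborel_prod)
  also have "\<dots> = (LINT x|lborel. LINT m|collision_measure. G (x, m) - L (x, m))"
  proof (rule integral_cong_AE)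
    have "(\<lambda>(x, v). invariant i v * J_B b g h (x, v)) \<in> borel_measurable (lborel \<Otimes>\<^sub>M lborel)"
      using intJ by (simp add: lborel_prod split_def)
    then show "(\<lambda>x. LINT v|lborel. invariant i v * J_B b g h (x, v)) \<in> borel_measurable lborel"
      by (rule lborel.borel_measurable_lebesgue_integral)
    have "(\<lambda>(x, m). G (x, m) - L (x, m)) \<in> borel_measurable ?N" using intD by simp
    then show "(\<lambda>x. LINT m|collision_measure. G (x, m) - L (x, m)) \<in> borel_measurable lborel"
      by (rule vel_vel_sphere.borel_measurable_lebesgue_integral)
    have "AE x in lborel. integrable collision_measure (\<lambda>m. G (x, m) - L (x, m))"
      using N.AE_integrable_fst'[OF intD] .
    then show "AE x in lborel. (LINT v|lborel. invariant i v * J_B b g h (x, v)) = (LINT m|collision_measure. G (x, m) - L (x, m))"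
    proof eventually_elim
      fix x :: space3
      assume ix: "integrable collision_measure (\<lambda>m. G (x, m) - L (x, m))"
      have "(LINT m|collision_measure. G (x, m) - L (x, m)) = (LINT v|lborel. LINT p|partner_measure. G (x, v, p) - L (x, v, p))"
        using vel_vel_sphere.integral_fst'[OF ix] by simp
      also have "\<dots> = (LINT v|lborel. invariant i v * J_B b g h (x, v))"
      proof (rule Bochner_Integration.integral_cong[OF refl])
        fix v :: space3
        have "(LINT p|partner_measure. G (x, v, p) - L (x, v, p))
            = (LINT p|partner_measure. invariant i v * collision_integrand b g h (x, v) p)"
          by (rule Bochner_Integration.integral_cong[OF refl])
            (simp add: G_def L_def r_def p1_def p2_def collision_integrand_def rate_def split_def algebra_simps)
        then show "(LINT p|partner_measure. G (x, v, p) - L (x, v, p)) = invariant i v * J_B b g h (x, v)"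
          by (simp add: J_B_def)
      qed
      finally show "(LINT v|lborel. invariant i v * J_B b g h (x, v)) = (LINT m|collision_measure. G (x, m) - L (x, m))" ..
    qed
  qed
  also have "\<dots> = (LINT q|?N. G q - L q)"
    using N.integral_fst'[OF intD] by simp
  finally show ?thesis by (simp add: zero J_cell_def h_def)
qed

end

section \<open>Representatives that are Lipschitz continuous in space\<close>

lemma AE_lborel_dense:
  fixes x :: "'a::euclidean_space"
  assumes ae: "AE y in lborel. Q y" and e: "0 < e"
  obtains y where "norm (y - x) < e" "Q y"
proof -
  have "\<exists>y. norm (y - x) < e \<and> Q y"
  proof (rule ccontr)
    assume none: "\<nexists>y. norm (y - x) < e \<and> Q y"
    have "AE y in lborel. y \<notin> ball x e"
      using ae by eventually_elim (use none in \<open>auto simp: dist_norm norm_minus_commute\<close>)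
    then have "ball x e \<in> null_sets lborel" by (simp add: AE_iff_null_sets)
    moreover have "emeasure lborel (ball x e) \<noteq> 0"
      using e content_ball_pos[of e x] by (auto simp: measure_def)
    ultimately show False by auto
  qed
  then show thesis using that by blast
qed

lemma AE_lborel_shift:
  fixes c :: "'a::euclidean_space"
  assumes Q: "Measurable.pred borel Q" and ae: "AE y in lborel. Q y"
  shows "AE y in lborel. Q (c + y)"
proof -
  have "AE y in distr lborel borel ((+) c). Q y" using ae by (simp only: lborel_distr_plus)
  then show ?thesis using Q by (subst (asm) AE_distr_iff) (auto simp: pred_def)
qed

lemma AE_lborel_dense_seq:
  fixes x :: "'a::euclidean_space"
  assumes ae: "AE y in lborel. Q y"
  obtains p where "p \<longlonglongrightarrow> x" "\<And>n. Q (p n)" "\<And>n. norm (p n - x) < 1"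
proof -
  have "\<exists>y. norm (y - x) < inverse (real (Suc n)) \<and> Q y" for n
    using AE_lborel_dense[OF ae, of "inverse (real (Suc n))" x] by auto
  then obtain p where p: "\<And>n. norm (p n - x) < inverse (real (Suc n)) \<and> Q (p n)" by metis
  have "(\<lambda>n. p n - x) \<longlonglongrightarrow> 0"
    by (rule Lim_null_comparison[OF _ LIMSEQ_inverse_real_of_nat]) (use p in \<open>auto intro: always_eventually less_imp_le\<close>)
  then have "p \<longlonglongrightarrow> x" by (simp add: LIM_zero_iff)
  moreover have "norm (p n - x) < 1" for n
  proof -
    have "inverse (real (Suc n)) \<le> 1" by (simp add: inverse_eq_divide)
    then show ?thesis using p[of n] by linarith
  qed
  ultimately show thesis using that p by blast
qed

text \<open>
  Averages exist at every point and are measurable in all arguments, so their limit provides a measurable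
  choice of the continuous representatives of all velocity slices.
\<close>

definition ball_average :: "nat \<Rightarrow> (space3 \<Rightarrow> real) \<Rightarrow> space3 \<Rightarrow> real" where
  "ball_average n G x = (LINT y:ball 0 (inverse (real (Suc n)))|lborel. G (x + y)) / measure lborel (ball (0::space3) (inverse (real (Suc n))))"

text \<open>
  At \<open>x\<close> and at \<open>x'\<close> the estimate is only known towards a.e. other point. So the two are compared through a
  third point, as close to \<open>x'\<close> as desired, towards which both estimates hold.
\<close>

lemma almost_lipschitz_compare:
  fixes G w :: "space3 \<Rightarrow> real"
  assumes G [measurable]: "G \<in> borel_measurable borel"
    and M: "0 \<le> M" and w: "\<And>x. 0 \<le> w x"
    and x: "AE y in lborel. norm y < 1 \<longrightarrow> \<bar>G (x + y) - G x\<bar> \<le> M * norm y * w x"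
    and x': "AE y in lborel. norm y < 1 \<longrightarrow> \<bar>G (x' + y) - G x'\<bar> \<le> M * norm y * w x'"
    and near: "norm (x' - x) < 1"
  shows "\<bar>G x' - G x\<bar> \<le> M * norm (x' - x) * w x"
proof (rule field_le_epsilon)
  fix \<epsilon> :: real assume \<epsilon>: "0 < \<epsilon>"
  (* The term 1 only ensures that D is positive. *)
  define D where "D = M * w x + M * w x' + 1"
  have D: "0 < D" using M w by (simp add: D_def add_nonneg_pos)
  define e where "e = min (1 - norm (x' - x)) (\<epsilon> / D)"
  have e: "0 < e" "e \<le> 1 - norm (x' - x)" "e * D \<le> \<epsilon>"
    using near \<epsilon> D by (auto simp: e_def min_def field_simps)
  have "AE y in lborel. norm ((x - x') + y) < 1 \<longrightarrow> \<bar>G (x' + ((x - x') + y)) - G x'\<bar> \<le> M * norm ((x - x') + y) * w x'"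
    by (rule AE_lborel_shift[OF _ x']) measurable
  with x have "AE y in lborel. (norm y < 1 \<longrightarrow> \<bar>G (x + y) - G x\<bar> \<le> M * norm y * w x) \<and>
      (norm (y - (x' - x)) < 1 \<longrightarrow> \<bar>G (x + y) - G x'\<bar> \<le> M * norm (y - (x' - x)) * w x')"
    by eventually_elim (simp add: algebra_simps)
  from AE_lborel_dense[OF this e(1)] obtain y where y: "norm (y - (x' - x)) < e"
    and 1: "norm y < 1 \<longrightarrow> \<bar>G (x + y) - G x\<bar> \<le> M * norm y * w x"
    and 2: "norm (y - (x' - x)) < 1 \<longrightarrow> \<bar>G (x + y) - G x'\<bar> \<le> M * norm (y - (x' - x)) * w x'"
    by blast
  have ny: "norm y < norm (x' - x) + e"
    using norm_triangle_ineq[of "y - (x' - x)" "x' - x"] y by simp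
  have "norm (y - (x' - x)) < 1" using y e norm_ge_zero[of "x' - x"] by linarith
  then have "\<bar>G x' - G x\<bar> \<le> M * norm y * w x + M * norm (y - (x' - x)) * w x'"
    using 1 2 ny e by linarith
  also have "\<dots> \<le> M * (norm (x' - x) + e) * w x + M * e * w x'"
    using M w ny y by (intro add_mono mult_right_mono mult_left_mono) auto
  also have "\<dots> \<le> M * norm (x' - x) * w x + e * D"
    using e by (simp add: D_def algebra_simps)
  finally show "\<bar>G x' - G x\<bar> \<le> M * norm (x' - x) * w x + \<epsilon>" using e by linarith
qed

lemma ball_average_near:
  fixes G w :: "space3 \<Rightarrow> real"
  assumes G [measurable]: "G \<in> borel_measurable borel" and bdd: "AE x in lborel. \<bar>G x\<bar> \<le> R"
    and M: "0 \<le> M" and w: "0 \<le> w x'"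
    and x': "AE y in lborel. norm y < 1 \<longrightarrow> \<bar>G (x' + y) - G x'\<bar> \<le> M * norm y * w x'"
    and near: "norm (x' - x) + inverse (real (Suc n)) \<le> 1"
  shows "\<bar>ball_average n G x - G x'\<bar> \<le> M * (norm (x' - x) + inverse (real (Suc n))) * w x'"
proof -
  let ?r = "inverse (real (Suc n))"
  let ?B = "ball (0::space3) ?r"
  let ?m = "measure lborel ?B"
  let ?K = "M * (norm (x' - x) + ?r) * w x'"
  have m: "0 < ?m" by (rule content_ball_pos) simp
  have B: "?B \<in> sets lborel" "emeasure lborel ?B < \<infinity>"
    using emeasure_bounded_finite[of ?B] by auto
  have "AE y in lborel. \<bar>G (x + y)\<bar> \<le> R"
    by (rule AE_lborel_shift[OF _ bdd]) measurable
  then have i1: "set_integrable lborel ?B (\<lambda>y. G (x + y))"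
    unfolding set_integrable_def using B
    by (intro integrableI_bounded_set_indicator[where B = R]) (measurable, auto)
  have ic: "set_integrable lborel ?B (\<lambda>y. c)" for c :: real
    unfolding set_integrable_def using B
    by (intro integrableI_bounded_set_indicator[where B = "\<bar>c\<bar>"]) auto
  have k: "(LINT y:?B|lborel. c) = c * ?m" for c :: real
    by (simp add: set_lebesgue_integral_def)
  have "AE y in lborel. norm ((x - x') + y) < 1 \<longrightarrow> \<bar>G (x' + ((x - x') + y)) - G x'\<bar> \<le> M * norm ((x - x') + y) * w x'"
    by (rule AE_lborel_shift[OF _ x']) measurable
  then have ae: "AE y\<in>?B in lborel. \<bar>G (x + y) - G x'\<bar> \<le> ?K"
  proof eventually_elim
    fix y assume H: "norm ((x - x') + y) < 1 \<longrightarrow> \<bar>G (x' + ((x - x') + y)) - G x'\<bar> \<le> M * norm ((x - x') + y) * w x'"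
    show "y \<in> ?B \<longrightarrow> \<bar>G (x + y) - G x'\<bar> \<le> ?K"
    proof
      assume "y \<in> ?B"
      then have n: "norm ((x - x') + y) < norm (x' - x) + ?r"
        using norm_triangle_ineq[of "x - x'" y] by (simp add: norm_minus_commute)
      then have "\<bar>G (x + y) - G x'\<bar> \<le> M * norm ((x - x') + y) * w x'" using H near by simp
      also have "\<dots> \<le> ?K" using n M w by (intro mult_right_mono mult_left_mono) auto
      finally show "\<bar>G (x + y) - G x'\<bar> \<le> ?K" .
    qed
  qed
  have id: "set_integrable lborel ?B (\<lambda>y. G (x + y) - G x')"
    by (rule set_integral_diff(1)[OF i1 ic])
  have "\<bar>LINT y:?B|lborel. G (x + y) - G x'\<bar> \<le> (LINT y:?B|lborel. \<bar>G (x + y) - G x'\<bar>)"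
    using set_integral_norm_bound[OF id] by simp
  also have "\<dots> \<le> (LINT y:?B|lborel. ?K)"
    using set_integrable_norm[OF id] ae by (intro set_integral_mono_AE ic) auto
  finally have "\<bar>(LINT y:?B|lborel. G (x + y)) - G x' * ?m\<bar> \<le> ?K * ?m"
    by (simp only: set_integral_diff(2)[OF i1 ic] k)
  moreover have "ball_average n G x - G x' = ((LINT y:?B|lborel. G (x + y)) - G x' * ?m) / ?m"
    using m by (simp add: ball_average_def diff_divide_distrib)
  ultimately show ?thesis using m by (simp add: divide_le_eq)
qed

text \<open>
  By \<open>almost_lipschitz_compare\<close>, \<open>G\<close> is locally Lipschitz continuous on a set of full measure, hence dense, so
  it extends to a continuous function; near a point of that set the average differs from the value of \<open>G\<close> there by
  the Lipschitz bound, which shows that the averages converge to the extension.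
\<close>

lemma almost_lipschitz_representative:
  fixes G w :: "space3 \<Rightarrow> real"
  assumes G: "G \<in> borel_measurable borel"
    and M: "0 \<le> M" and R: "0 \<le> R" and w: "\<And>x. 0 \<le> w x" "\<And>x. w x \<le> 1" "continuous_on UNIV w"
    and good: "AE x in lborel. 0 \<le> G x \<and> G x \<le> R * w x \<and>
      (AE y in lborel. norm y < 1 \<longrightarrow> \<bar>G (x + y) - G x\<bar> \<le> M * norm y * w x)"
  defines "L \<equiv> \<lambda>x. lim (\<lambda>n. ball_average n G x)"
  shows "AE x in lborel. L x = G x"
    and "0 \<le> L x" and "L x \<le> R * w x"
    and "norm y < 1 \<Longrightarrow> \<bar>L (x + y) - L x\<bar> \<le> M * norm y * w x"
proof -
  let ?good = "\<lambda>x. 0 \<le> G x \<and> G x \<le> R * w x \<and> (AE y in lborel. norm y < 1 \<longrightarrow> \<bar>G (x + y) - G x\<bar> \<le> M * norm y * w x)"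
  have "AE x in lborel. \<bar>G x\<bar> \<le> R"
    using good
  proof eventually_elim
    fix x assume "?good x"
    moreover have "R * w x \<le> R * 1" using R w by (intro mult_left_mono)
    ultimately show "\<bar>G x\<bar> \<le> R" by simp
  qed
  note near = ball_average_near[where w = w, OF G this M w(1)]
  have r: "(\<lambda>n. inverse (real (Suc n))) \<longlonglongrightarrow> 0" by (rule LIMSEQ_inverse_real_of_nat)
  have conv: "convergent (\<lambda>n. ball_average n G x)" for x
  proof (rule Cauchy_convergent, rule metric_CauchyI)
    fix e :: real assume e: "0 < e"
    define d where "d = min (1 / 2) (e / (4 * (M + 1)))"
    have "d \<le> e / (4 * (M + 1))" by (simp add: d_def)
    then have "d * (4 * (M + 1)) \<le> e" using M by (subst (asm) pos_le_divide_eq) auto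
    then have "d * (M + 1) \<le> e / 4" by (simp add: algebra_simps)
    moreover have "0 < d" using e M by (simp add: d_def)
    moreover have "d \<le> 1 / 2" unfolding d_def by (rule min.cobounded1)
    ultimately have d: "0 < d" "d \<le> 1 / 2" "d * (M + 1) \<le> e / 4" by simp_all
    obtain x' where x': "norm (x' - x) < d" "?good x'" by (rule AE_lborel_dense[OF good d(1)])
    from order_tendstoD(2)[OF r d(1)] obtain n0 where n0: "\<And>n. n \<ge> n0 \<Longrightarrow> inverse (real (Suc n)) < d"
      by (auto simp: eventually_sequentially)
    have b: "\<bar>ball_average n G x - G x'\<bar> < e / 2" if "n \<ge> n0" for n
    proof -
      have s: "norm (x' - x) + inverse (real (Suc n)) < 2 * d" using n0[OF that] x'(1) by linarith
      then have "\<bar>ball_average n G x - G x'\<bar> \<le> M * (norm (x' - x) + inverse (real (Suc n))) * w x'"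
        using near[where x' = x' and x = x and n = n] x'(2) d(2) by auto
      also have "\<dots> \<le> M * (2 * d) * 1"
        using s M w d by (intro mult_mono) auto
      also have "\<dots> < 2 * (d * (M + 1))" using d by (simp add: algebra_simps)
      finally show ?thesis using d(3) by linarith
    qed
    show "\<exists>N. \<forall>m\<ge>N. \<forall>n\<ge>N. dist (ball_average m G x) (ball_average n G x) < e"
    proof (intro exI allI impI)
      fix m n assume "n0 \<le> m" "n0 \<le> n"
      from b[OF this(1)] b[OF this(2)] show "dist (ball_average m G x) (ball_average n G x) < e"
        unfolding dist_real_def by arith
    qed
  qed
  have L_near: "\<bar>L x - G x'\<bar> \<le> M * norm (x' - x) * w x'" if "?good x'" "norm (x' - x) < 1" for x x'
  proof (rule LIMSEQ_le)
    have "(\<lambda>n. ball_average n G x) \<longlonglongrightarrow> L x" using conv[of x] unfolding L_def by (simp add: convergent_LIMSEQ_iff)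
    then show "(\<lambda>n. \<bar>ball_average n G x - G x'\<bar>) \<longlonglongrightarrow> \<bar>L x - G x'\<bar>" by (intro tendsto_intros)
    have "(\<lambda>n. M * (norm (x' - x) + inverse (real (Suc n))) * w x') \<longlonglongrightarrow> M * (norm (x' - x) + 0) * w x'"
      by (intro tendsto_intros r)
    then show "(\<lambda>n. M * (norm (x' - x) + inverse (real (Suc n))) * w x') \<longlonglongrightarrow> M * norm (x' - x) * w x'" by simp
    have "0 < 1 - norm (x' - x)" using that by simp
    from order_tendstoD(2)[OF r this]
    obtain n0 where n0: "\<And>n. n \<ge> n0 \<Longrightarrow> inverse (real (Suc n)) < 1 - norm (x' - x)"
      by (auto simp: eventually_sequentially)
    show "\<exists>N. \<forall>n\<ge>N. \<bar>ball_average n G x - G x'\<bar> \<le> M * (norm (x' - x) + inverse (real (Suc n))) * w x'"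
    proof (intro exI allI impI)
      fix n assume "n0 \<le> n"
      then show "\<bar>ball_average n G x - G x'\<bar> \<le> M * (norm (x' - x) + inverse (real (Suc n))) * w x'"
        using n0[of n] near[where x' = x' and x = x and n = n] that by auto
    qed
  qed
  have L_G: "L x = G x" if "?good x" for x
    using L_near[OF that, of x] by simp
  show "AE x in lborel. L x = G x"
    using good by eventually_elim (rule L_G)
  have seq: "(\<lambda>n. G (p n)) \<longlonglongrightarrow> L x" if p: "p \<longlonglongrightarrow> x" "\<And>n. ?good (p n)" "\<And>n. norm (p n - x) < 1" for p x
  proof -
    have 0: "(\<lambda>n. norm (p n - x)) \<longlonglongrightarrow> 0" using p(1) by (simp add: LIM_zero tendsto_norm_zero)
    have "(\<lambda>n. M * norm (p n - x)) \<longlonglongrightarrow> 0" using tendsto_mult_left[OF 0, of M] by simp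
    then have "(\<lambda>n. G (p n) - L x) \<longlonglongrightarrow> 0"
    proof (rule Lim_null_comparison[rotated], intro always_eventually allI)
      fix n
      have "\<bar>L x - G (p n)\<bar> \<le> M * norm (p n - x) * w (p n)" using L_near p by blast
      also have "\<dots> \<le> M * norm (p n - x) * 1" using M w by (intro mult_left_mono) auto
      finally show "norm (G (p n) - L x) \<le> M * norm (p n - x)" by simp
    qed
    then show ?thesis by (simp add: LIM_zero_iff)
  qed
  have w_seq: "(\<lambda>n. w (p n)) \<longlonglongrightarrow> w x" if "p \<longlonglongrightarrow> x" for p x
    using continuous_on_tendsto_compose[OF w(3) that] by simp
  obtain p where p: "p \<longlonglongrightarrow> x" "\<And>n. ?good (p n)" "\<And>n. norm (p n - x) < 1"
    by (rule AE_lborel_dense_seq[OF good, of x]) blast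
  show "0 \<le> L x" by (rule LIMSEQ_le_const[OF seq[OF p]]) (use p in auto)
  show "L x \<le> R * w x"
    by (rule LIMSEQ_le[OF seq[OF p] tendsto_mult_left[OF w_seq[OF p(1)]]]) (use p in auto)
  show "\<bar>L (x + y) - L x\<bar> \<le> M * norm y * w x" if y: "norm y < 1"
  proof -
    obtain q where q: "q \<longlonglongrightarrow> x + y" "\<And>n. ?good (q n)" "\<And>n. norm (q n - (x + y)) < 1"
      by (rule AE_lborel_dense_seq[OF good, of "x + y"]) blast
    have lim: "(\<lambda>n. norm (q n - p n)) \<longlonglongrightarrow> norm y"
      using tendsto_norm[OF tendsto_diff[OF q(1) p(1)]] by simp
    show ?thesis
    proof (rule LIMSEQ_le)
      show "(\<lambda>n. \<bar>G (q n) - G (p n)\<bar>) \<longlonglongrightarrow> \<bar>L (x + y) - L x\<bar>"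
        by (intro tendsto_intros seq p q)
      show "(\<lambda>n. M * norm (q n - p n) * w (p n)) \<longlonglongrightarrow> M * norm y * w x"
        by (intro tendsto_intros lim w_seq p)
      from order_tendstoD(2)[OF lim y] obtain n0 where n0: "\<And>n. n \<ge> n0 \<Longrightarrow> norm (q n - p n) < 1"
        by (auto simp: eventually_sequentially)
      show "\<exists>N. \<forall>n\<ge>N. \<bar>G (q n) - G (p n)\<bar> \<le> M * norm (q n - p n) * w (p n)"
      proof (intro exI allI impI)
        fix n assume "n0 \<le> n"
        then show "\<bar>G (q n) - G (p n)\<bar> \<le> M * norm (q n - p n) * w (p n)"
          using almost_lipschitz_compare[of G M w "p n" "q n"] G M w p(2)[of n] q(2)[of n] n0 by blast
      qed
    qed
  qed
qed

lemma weight_pos: "0 < weight \<alpha> \<tau> z"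
  by (simp add: weight_def split_def)

lemma weight_measurable: "weight \<alpha> \<tau> \<in> borel_measurable borel"
  unfolding weight_def split_def
  by (intro borel_measurable_continuous_onI continuous_intros)

lemma M_norm_leD:
  assumes "M_norm \<tau> g \<le> ennreal C" "0 \<le> C"
  shows "AE z in lborel. \<bar>g z\<bar> \<le> C * weight \<tau> \<tau> z"
proof -
  have "AE z in lborel. ennreal \<bar>inverse (weight \<tau> \<tau> z) * g z\<bar> \<le> M_norm \<tau> g"
    unfolding M_norm_def Linf_norm_def by (rule esssup_AE)
  then show ?thesis
  proof eventually_elim
    fix z assume "ennreal \<bar>inverse (weight \<tau> \<tau> z) * g z\<bar> \<le> M_norm \<tau> g"
    then have "ennreal \<bar>inverse (weight \<tau> \<tau> z) * g z\<bar> \<le> ennreal C" using assms(1) by (rule order_trans)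
    then have "inverse (weight \<tau> \<tau> z) * \<bar>g z\<bar> \<le> C"
      using weight_pos[of \<tau> \<tau> z] assms(2) by (simp add: abs_mult)
    then show "\<bar>g z\<bar> \<le> C * weight \<tau> \<tau> z"
      using weight_pos[of \<tau> \<tau> z] by (simp add: field_simps)
  qed
qed

text \<open>
  In \<open>M_set\<close> the exceptional null set may depend on the translation. By Fubini, for a.e. velocity
  and a.e. point of that slice the estimate holds for a.e. translation, so that
  \<open>almost_lipschitz_representative\<close> applies to the slice. Having the estimate everywhere is what permits
  translations that depend on the velocity, as they occur in the free flow.
\<close>

lemma M_set_pos_representative:
  assumes \<tau>: "0 < \<tau>" and R: "0 < R" and M: "0 < M" and g: "g \<in> M_set_pos \<tau> R M"
  obtains G where "G \<in> borel_measurable borel" "AE z in lborel. G z = g z"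
    "\<And>z. 0 \<le> G z" "\<And>z. G z \<le> R * weight \<tau> \<tau> z"
    "\<And>x y v. norm y < 1 \<Longrightarrow> \<bar>G (x + y, v) - G (x, v)\<bar> \<le> M * norm y * weight \<tau> \<tau> (x, v)"
proof -
  have gm: "g \<in> borel_measurable borel"
    using g by (auto simp: M_set_pos_def M_set_def M_space_def B_space_def Linf_def)
  have "AE z in lborel. 0 \<le> g z" "AE z in lborel. \<bar>g z\<bar> \<le> R * weight \<tau> \<tau> z"
    using g R M_norm_leD[of \<tau> g R] by (auto simp: M_set_pos_def M_set_def)
  then have bd: "AE z in lborel. 0 \<le> g z \<and> g z \<le> R * weight \<tau> \<tau> z"
    by eventually_elim simp
  let ?Q = "\<lambda>y z. norm y < 1 \<longrightarrow> \<bar>g (fst z + y, snd z) - g z\<bar> \<le> M * norm y * weight \<tau> \<tau> z"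
  have "AE z in lborel. ?Q y z" for y :: space3
  proof (cases "norm y < 1")
    case True
    then have "M_norm \<tau> (\<lambda>z. translate y g z - g z) \<le> ennreal (M * norm y)"
      using g by (simp add: M_set_pos_def M_set_def)
    from M_norm_leD[OF this] show ?thesis using M by (auto simp: translate_def split_def)
  qed simp
  then have "AE y in lborel. AE z in lborel. ?Q y z" by simp
  moreover have "{p \<in> space (lborel \<Otimes>\<^sub>M lborel). ?Q (fst p) (snd p)} \<in> sets (lborel \<Otimes>\<^sub>M (lborel :: phase measure))"
  proof -
    have "(\<lambda>p::space3 \<times> phase. fst (snd p)) \<in> borel_measurable (lborel \<Otimes>\<^sub>M lborel)"
      "(\<lambda>p::space3 \<times> phase. snd (snd p)) \<in> borel_measurable (lborel \<Otimes>\<^sub>M lborel)"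
      by (rule measurable_compose[OF measurable_snd], simp add: measurable_fst_phase measurable_snd_phase)+
    note [measurable] = this
    have [measurable]: "(\<lambda>p::space3 \<times> phase. g (fst (snd p) + fst p, snd (snd p))) \<in> borel_measurable (lborel \<Otimes>\<^sub>M lborel)"
      by (rule borel_measurable_at_phase[OF gm]) measurable
    have [measurable]: "(\<lambda>p::space3 \<times> phase. g (snd p)) \<in> borel_measurable (lborel \<Otimes>\<^sub>M lborel)"
      "(\<lambda>p::space3 \<times> phase. weight \<tau> \<tau> (snd p)) \<in> borel_measurable (lborel \<Otimes>\<^sub>M lborel)"
      by (rule measurable_compose[OF measurable_snd], simp add: gm weight_measurable)+
    show ?thesis by measurable
  qed
  ultimately have "AE z in lborel. AE y in lborel. ?Q y z"
    using lborel_pair.AE_commute[of ?Q] by blast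
  with bd have ae: "AE z in lborel. (0 \<le> g z \<and> g z \<le> R * weight \<tau> \<tau> z) \<and> (AE y in lborel. ?Q y z)"
    by eventually_elim simp
  obtain N0 where N0: "\<And>z. z \<in> space lborel - N0 \<Longrightarrow> (0 \<le> g z \<and> g z \<le> R * weight \<tau> \<tau> z) \<and> (AE y in lborel. ?Q y z)"
    "N0 \<in> null_sets lborel"
    by (rule AE_E3[OF ae]) blast
  have "AE z in lborel. z \<notin> N0" by (rule AE_not_in[OF N0(2)])
  moreover have pm: "Measurable.pred borel (\<lambda>z. z \<notin> N0)"
  proof -
    have "N0 \<in> sets borel" using N0(2) by auto
    then show ?thesis by measurable
  qed
  ultimately have ae: "AE v in lborel. AE x in lborel. (x, v) \<notin> N0"
    by (simp only: AE_phase_swap_iff[OF pm])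
  obtain N where N': "\<And>v. v \<in> space lborel - N \<Longrightarrow> AE x in lborel. (x, v) \<notin> N0" and N_null: "N \<in> null_sets lborel"
    by (rule AE_E3[OF ae]) blast
  have N: "N \<in> null_sets lborel" "\<And>v. v \<notin> N \<Longrightarrow> AE x in lborel. (x, v) \<notin> N0"
    using N' N_null by simp_all
  define G where "G z = indicator (- N) (snd z) * lim (\<lambda>n. ball_average n (\<lambda>x. g (x, snd z)) (fst z))" for z :: phase
  have slice: "AE x in lborel. 0 \<le> g (x, v) \<and> g (x, v) \<le> R * weight \<tau> \<tau> (x, v) \<and>
      (AE y in lborel. norm y < 1 \<longrightarrow> \<bar>g (x + y, v) - g (x, v)\<bar> \<le> M * norm y * weight \<tau> \<tau> (x, v))" if "v \<notin> N" for v
    using N(2)[OF that] by eventually_elim (use N0(1) in fastforce)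
  have w: "weight \<tau> \<tau> z \<le> 1" for z
  proof -
    have "0 \<le> \<tau> * (fst z \<bullet> fst z)" "0 \<le> \<tau> * (snd z \<bullet> snd z)" using \<tau> by simp_all
    then show ?thesis by (simp add: weight_def split_def)
  qed
  have wc: "continuous_on UNIV (\<lambda>x. weight \<tau> \<tau> (x, v))" for v
    unfolding weight_def split_def by (intro continuous_intros)
  note rep = almost_lipschitz_representative[where w = "\<lambda>x. weight \<tau> \<tau> (x, v)" and G = "\<lambda>x. g (x, v)" for v,
      OF borel_measurable_at_phase[OF gm] less_imp_le[OF M] less_imp_le[OF R] less_imp_le[OF weight_pos] w wc slice]
  show thesis
  proof (rule that)
    show Gm: "G \<in> borel_measurable borel"
    proof -
      have "(\<lambda>z. ball_average n (\<lambda>x. g (x, snd z)) (fst z)) \<in> borel_measurable (borel :: phase measure)" for n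
      proof -
        let ?B = "ball (0::space3) (inverse (real (Suc n)))"
        have "(\<lambda>z::phase. LINT y|lborel. indicator ?B y *\<^sub>R g (fst z + y, snd z)) \<in> borel_measurable borel"
        proof (rule lborel.borel_measurable_lebesgue_integral)
          have [measurable]: "(\<lambda>p::phase \<times> space3. fst (fst p)) \<in> borel_measurable (borel \<Otimes>\<^sub>M lborel)"
            "(\<lambda>p::phase \<times> space3. snd (fst p)) \<in> borel_measurable (borel \<Otimes>\<^sub>M lborel)"
            by (rule measurable_compose[OF measurable_fst], simp add: measurable_fst_phase measurable_snd_phase)+
          have [measurable]: "(\<lambda>p::phase \<times> space3. g (fst (fst p) + snd p, snd (fst p))) \<in> borel_measurable (borel \<Otimes>\<^sub>M lborel)"
            by (rule borel_measurable_at_phase[OF gm]) measurable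
          have [measurable]: "(\<lambda>p::phase \<times> space3. indicator ?B (snd p) :: real) \<in> borel_measurable (borel \<Otimes>\<^sub>M lborel)"
            by (intro measurable_compose[OF measurable_snd] borel_measurable_indicator) simp
          have "(\<lambda>p::phase \<times> space3. indicator ?B (snd p) *\<^sub>R g (fst (fst p) + snd p, snd (fst p))) \<in> borel_measurable (borel \<Otimes>\<^sub>M lborel)"
            by measurable
          then show "(\<lambda>(z::phase, y). indicator ?B y *\<^sub>R g (fst z + y, snd z)) \<in> borel_measurable (borel \<Otimes>\<^sub>M lborel)"
            by (simp add: split_def)
        qed
        then show ?thesis unfolding ball_average_def set_lebesgue_integral_def by (intro borel_measurable_divide) auto
      qed
      note [measurable] = this
      have "N \<in> sets borel" using N(1) by auto
      then have [measurable]: "(\<lambda>z::phase. indicator (- N) (snd z) :: real) \<in> borel_measurable borel"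
        by (intro measurable_compose[OF measurable_snd_phase borel_measurable_indicator]) auto
      show ?thesis unfolding G_def[abs_def] by measurable
    qed
    show "AE z in lborel. G z = g z"
    proof -
      have pm: "Measurable.pred borel (\<lambda>z. G z = g z)" using Gm gm by measurable
      have "AE v in lborel. v \<notin> N" by (rule AE_not_in[OF N(1)])
      then have "AE v in lborel. AE x in lborel. G (x, v) = g (x, v)"
      proof eventually_elim
        fix v assume "v \<notin> N"
        then show "AE x in lborel. G (x, v) = g (x, v)" using rep(1)[of v] by (simp add: G_def)
      qed
      then show ?thesis by (simp only: AE_phase_swap_iff[OF pm])
    qed
    show "0 \<le> G z" for z
      using rep(2)[of "snd z" "fst z"] by (cases "snd z \<in> N") (auto simp: G_def)
    show "G z \<le> R * weight \<tau> \<tau> z" for z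
      using rep(3)[of "snd z" "fst z"] R weight_pos[of \<tau> \<tau> z]
      by (cases "snd z \<in> N") (auto simp: G_def intro!: mult_nonneg_nonneg less_imp_le)
    show "\<bar>G (x + y, v) - G (x, v)\<bar> \<le> M * norm y * weight \<tau> \<tau> (x, v)" if "norm y < 1" for x y v
      using rep(4)[of v y x] that M weight_pos[of \<tau> \<tau> "(x, v)"]
      by (cases "v \<in> N") (auto simp: G_def intro!: mult_nonneg_nonneg less_imp_le)
  qed
qed

section \<open>Riemann integrals in the mild formulation\<close>

lemma AE_free_flow:
  fixes P :: "phase \<Rightarrow> bool"
  assumes P: "Measurable.pred borel P" and ae: "AE z in lborel. P z"
  shows "AE z in lborel. P (fst z - q *\<^sub>R snd z, snd z)"
proof -
  have "(\<lambda>z::phase. (fst z - q *\<^sub>R snd z, snd z)) \<in> borel_measurable borel"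
    by (intro borel_measurable_phase_Pair borel_measurable_diff borel_measurable_scaleR
        borel_measurable_const measurable_fst_phase measurable_snd_phase)
  from measurable_compose[OF this P]
  have pm: "Measurable.pred borel (\<lambda>z. P (fst z - q *\<^sub>R snd z, snd z))" .
  have "AE v in lborel. AE x in lborel. P (x, v)" using ae by (simp only: AE_phase_swap_iff[OF P])
  then have "AE v in lborel. AE x in lborel. P (x - q *\<^sub>R v, v)"
  proof eventually_elim
    fix v assume ae: "AE x in lborel. P (x, v)"
    have "(\<lambda>x::space3. (x, v :: space3)) \<in> borel_measurable borel" by (intro borel_measurable_phase_Pair) auto
    from measurable_compose[OF this P] have "Measurable.pred borel (\<lambda>x. P (x, v))" .
    from AE_lborel_shift[OF this ae, of "- (q *\<^sub>R v)"] show "AE x in lborel. P (x - q *\<^sub>R v, v)" by simp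
  qed
  then show ?thesis using AE_phase_swap_iff[OF pm] by simp
qed

lemma free_flow_alt: "free_flow q g z = g (fst z - q *\<^sub>R snd z, snd z)"
  by (simp add: free_flow_def split_def)

lemma free_flow_free_flow: "free_flow q (free_flow p g) = free_flow (p + q) g"
  by (rule ext) (simp add: free_flow_alt algebra_simps)

lemma free_flow_0: "free_flow 0 g = g"
  by (rule ext) (simp add: free_flow_alt)

lemma free_flow_cong_AE:
  assumes "g \<in> borel_measurable borel" "h \<in> borel_measurable borel" and eq: "AE z in lborel. g z = h z"
  shows "AE z in lborel. free_flow q g z = free_flow q h z"
proof -
  have "Measurable.pred borel (\<lambda>z. g z = h z)" using assms(1,2) by measurable
  from AE_free_flow[OF this eq] show ?thesis by (simp add: free_flow_alt)
qed

lemma L1_norm_free_flow: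
  assumes g: "g \<in> borel_measurable borel"
  shows "L1_norm (free_flow q g) = L1_norm g"
proof -
  have I: "L1_norm k = (\<integral>\<^sup>+ v. \<integral>\<^sup>+ x. ennreal \<bar>k (x, v)\<bar> \<partial>lborel \<partial>lborel)" if "k \<in> borel_measurable borel" for k
  proof -
    have "(\<lambda>z. ennreal \<bar>k z\<bar>) \<in> borel_measurable (lborel \<Otimes>\<^sub>M lborel)"
      unfolding lborel_prod using that by measurable
    from lborel_pair.nn_integral_snd[OF this] show ?thesis by (simp add: L1_norm_def lborel_prod)
  qed
  have "(\<integral>\<^sup>+ x. ennreal \<bar>free_flow q g (x, v)\<bar> \<partial>lborel) = (\<integral>\<^sup>+ x. ennreal \<bar>g (x, v)\<bar> \<partial>lborel)" for v
  proof -
    have "(\<lambda>x. g (x, v)) \<in> borel_measurable borel" by (rule borel_measurable_at_phase[OF g]) simp_all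
    then have "(\<lambda>x. ennreal \<bar>g (x, v)\<bar>) \<in> borel_measurable borel" by measurable
    from nn_integral_lborel_shift[OF this, of "- (q *\<^sub>R v)"] show ?thesis by (simp add: free_flow_apply)
  qed
  then show ?thesis by (simp add: I[OF g] I[OF measurable_free_flow[OF g]])
qed

lemma L1_iff: "g \<in> L1 \<longleftrightarrow> g \<in> borel_measurable borel \<and> L1_norm g < \<infinity>"
  by (simp add: L1_def L1_norm_def integrable_iff_bounded)

lemma L1_measurable: "g \<in> L1 \<Longrightarrow> g \<in> borel_measurable borel"
  by (simp add: L1_iff)

lemma L1_free_flow: "g \<in> L1 \<Longrightarrow> free_flow q g \<in> L1"
  by (simp add: L1_iff measurable_free_flow L1_norm_free_flow)

lemma L1_norm_triangle:
  assumes "g \<in> borel_measurable borel" "h \<in> borel_measurable borel"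
  shows "L1_norm (\<lambda>z. g z - h z) \<le> L1_norm g + L1_norm h"
proof -
  have "L1_norm (\<lambda>z. g z - h z) \<le> (\<integral>\<^sup>+ z. ennreal \<bar>g z\<bar> + ennreal \<bar>h z\<bar> \<partial>lborel)"
    unfolding L1_norm_def by (intro nn_integral_mono) (simp add: ennreal_leI flip: ennreal_plus)
  also have "\<dots> = L1_norm g + L1_norm h"
    unfolding L1_norm_def using assms by (intro nn_integral_add) simp_all
  finally show ?thesis .
qed

lemma riemann_sum_measurable:
  fixes u :: "real \<Rightarrow> phase \<Rightarrow> real"
  assumes p: "p tagged_division_of {a..c}" and u: "\<And>s. s \<in> {a..c} \<Longrightarrow> u s \<in> borel_measurable borel"
  shows "(\<lambda>z. \<Sum>(s, k)\<in>p. measure lborel k * u s z) \<in> borel_measurable borel"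
proof (unfold split_def, intro borel_measurable_sum borel_measurable_times borel_measurable_const)
  fix q assume "q \<in> p"
  then have "fst q \<in> {a..c}"
    using tagged_division_ofD(2,3)[OF p, of "fst q" "snd q"] by auto
  then show "u (fst q) \<in> borel_measurable borel" by (rule u)
qed

lemma has_riemann_integral_L1_free_flow:
  assumes "has_riemann_integral_L1 u I a c"
  shows "has_riemann_integral_L1 (\<lambda>s. free_flow q (u s)) (free_flow q I) a c"
proof -
  have u: "\<And>s. s \<in> {a..c} \<Longrightarrow> u s \<in> L1" and I: "I \<in> L1"
    and lim: "\<And>\<epsilon>. 0 < \<epsilon> \<Longrightarrow> \<exists>\<delta>>0. \<forall>p. p tagged_division_of {a..c} \<and> (\<lambda>s. ball s \<delta>) fine p \<longrightarrow>
        L1_norm (\<lambda>z. (\<Sum>(s, k)\<in>p. measure lborel k * u s z) - I z) < ennreal \<epsilon>"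
    using assms by (auto simp: has_riemann_integral_L1_def)
  have eq: "L1_norm (\<lambda>z. (\<Sum>(s, k)\<in>p. measure lborel k * free_flow q (u s) z) - free_flow q I z)
      = L1_norm (\<lambda>z. (\<Sum>(s, k)\<in>p. measure lborel k * u s z) - I z)" if p: "p tagged_division_of {a..c}" for p
  proof -
    have "(\<lambda>z. (\<Sum>(s, k)\<in>p. measure lborel k * u s z) - I z) \<in> borel_measurable borel"
      using riemann_sum_measurable[OF p, of u] L1_measurable[OF u] L1_measurable[OF I]
      by (intro borel_measurable_diff) auto
    from L1_norm_free_flow[OF this, of q] show ?thesis by (simp add: free_flow_alt[abs_def])
  qed
  show ?thesis
    unfolding has_riemann_integral_L1_def
  proof (intro conjI ballI allI impI)
    show "free_flow q (u s) \<in> L1" if "s \<in> {a..c}" for s using u[OF that] by (rule L1_free_flow)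
    show "free_flow q I \<in> L1" by (rule L1_free_flow[OF I])
    fix \<epsilon> :: real assume "\<epsilon> > 0"
    from lim[OF this] obtain \<delta> where "\<delta> > 0" and \<delta>: "\<And>p. p tagged_division_of {a..c} \<Longrightarrow> (\<lambda>s. ball s \<delta>) fine p \<Longrightarrow>
        L1_norm (\<lambda>z. (\<Sum>(s, k)\<in>p. measure lborel k * u s z) - I z) < ennreal \<epsilon>"
      by blast
    show "\<exists>\<delta>>0. \<forall>p. p tagged_division_of {a..c} \<and> (\<lambda>s. ball s \<delta>) fine p \<longrightarrow>
        L1_norm (\<lambda>z. (\<Sum>(s, k)\<in>p. measure lborel k * free_flow q (u s) z) - free_flow q I z) < ennreal \<epsilon>"
    proof (intro exI conjI allI impI)
      fix p assume "p tagged_division_of {a..c} \<and> (\<lambda>s. ball s \<delta>) fine p"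
      then show "L1_norm (\<lambda>z. (\<Sum>(s, k)\<in>p. measure lborel k * free_flow q (u s) z) - free_flow q I z) < ennreal \<epsilon>"
        using \<delta>[of p] by (simp only: eq)
    qed fact
  qed
qed

lemma fine_tagged_division_exists:
  fixes a c \<delta> :: real
  assumes "0 < \<delta>"
  obtains p where "p tagged_division_of {a..c}" "(\<lambda>s. ball s \<delta>) fine p"
  using fine_division_exists[OF gauge_ball[OF assms], of a c] by (auto simp: cbox_interval)

text \<open>
  A fine division of \<open>[m, c]\<close>, extended by any fine division of \<open>[a, m]\<close>, is a fine division of \<open>[a, c]\<close>.
\<close>

lemma has_riemann_integral_L1_diff_interval:
  assumes ui: "has_riemann_integral_L1 u I a c" and uj: "has_riemann_integral_L1 u I' a m"
    and am: "a \<le> m" "m \<le> c"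
  shows "has_riemann_integral_L1 u (\<lambda>z. I z - I' z) m c"
  unfolding has_riemann_integral_L1_def
proof (intro conjI ballI allI impI)
  have I: "I \<in> L1" "I' \<in> L1" using ui uj by (auto simp: has_riemann_integral_L1_def)
  have u: "u s \<in> L1" if "s \<in> {a..c}" for s using ui that by (auto simp: has_riemann_integral_L1_def)
  show "u s \<in> L1" if "s \<in> {m..c}" for s using u that am by auto
  show "(\<lambda>z. I z - I' z) \<in> L1" using I by (simp add: L1_def)
  fix \<epsilon> :: real assume "\<epsilon> > 0"
  then have \<epsilon>: "\<epsilon> / 2 > 0" by simp
  from ui \<epsilon> obtain \<delta>1 where \<delta>1: "\<delta>1 > 0" "\<And>p. p tagged_division_of {a..c} \<Longrightarrow> (\<lambda>s. ball s \<delta>1) fine p \<Longrightarrow>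
      L1_norm (\<lambda>z. (\<Sum>(s, k)\<in>p. measure lborel k * u s z) - I z) < ennreal (\<epsilon> / 2)"
    unfolding has_riemann_integral_L1_def by blast
  from uj \<epsilon> obtain \<delta>2 where \<delta>2: "\<delta>2 > 0" "\<And>p. p tagged_division_of {a..m} \<Longrightarrow> (\<lambda>s. ball s \<delta>2) fine p \<Longrightarrow>
      L1_norm (\<lambda>z. (\<Sum>(s, k)\<in>p. measure lborel k * u s z) - I' z) < ennreal (\<epsilon> / 2)"
    unfolding has_riemann_integral_L1_def by blast
  define \<delta> where "\<delta> = min \<delta>1 \<delta>2"
  have \<delta>: "\<delta> > 0" "\<delta> \<le> \<delta>1" "\<delta> \<le> \<delta>2" using \<delta>1 \<delta>2 by (auto simp: \<delta>_def)
  show "\<exists>\<delta>>0. \<forall>p. p tagged_division_of {m..c} \<and> (\<lambda>s. ball s \<delta>) fine p \<longrightarrow>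
      L1_norm (\<lambda>z. (\<Sum>(s, k)\<in>p. measure lborel k * u s z) - (I z - I' z)) < ennreal \<epsilon>"
  proof (intro exI conjI allI impI)
    show "\<delta> > 0" by fact
    fix p assume "p tagged_division_of {m..c} \<and> (\<lambda>s. ball s \<delta>) fine p"
    then have p: "p tagged_division_of {m..c}" "(\<lambda>s. ball s \<delta>) fine p" by auto
    obtain p' where p': "p' tagged_division_of {a..m}" "(\<lambda>s. ball s \<delta>) fine p'"
      by (rule fine_tagged_division_exists[OF \<delta>(1)])
    have fine_mono: "(\<lambda>s. ball s \<delta>') fine q" if "(\<lambda>s. ball s \<delta>) fine q" "\<delta> \<le> \<delta>'" for q :: "(real \<times> real set) set" and \<delta>'
      using that(1) subset_ball[OF that(2)] unfolding fine_def by blast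
    have un: "p' \<union> p tagged_division_of {a..m} \<union> {m..c}"
      by (rule tagged_division_Un[OF p'(1) p(1)]) auto
    have "{a..m} \<union> {m..c} = {a..c}" using am by auto
    with un have q: "p' \<union> p tagged_division_of {a..c}" by simp
    have fin: "finite p" "finite p'" using p p' by (auto simp: tagged_division_of_finite)
    (* A piece that belongs to both divisions is contained in their common end point. *)
    have zero: "measure lborel k = 0" if "(s, k) \<in> p' \<inter> p" for s k
    proof -
      have sub: "k \<subseteq> {a..m}" "k \<subseteq> {m..c}"
        using that tagged_division_ofD(3)[OF p'(1)] tagged_division_ofD(3)[OF p(1)] by blast+
      then have "k \<subseteq> {m}" by force
      then have "emeasure lborel k \<le> emeasure lborel {m}" by (rule emeasure_mono) simp
      then show ?thesis by (simp add: measure_def)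
    qed
    have split: "(\<Sum>(s, k)\<in>p' \<union> p. measure lborel k * u s z)
        = (\<Sum>(s, k)\<in>p'. measure lborel k * u s z) + (\<Sum>(s, k)\<in>p. measure lborel k * u s z)" for z
      by (rule sum.union_inter_neutral[OF fin(2,1)]) (use zero in auto)
    let ?S = "\<lambda>q z. \<Sum>(s, k)\<in>q. measure lborel k * u s z"
    have um: "u s \<in> borel_measurable borel" if "s \<in> {a..c}" for s using u[OF that] by (rule L1_measurable)
    have "L1_norm (\<lambda>z. ?S p z - (I z - I' z)) = L1_norm (\<lambda>z. (?S (p' \<union> p) z - I z) - (?S p' z - I' z))"
      by (simp add: split algebra_simps)
    also have "\<dots> \<le> L1_norm (\<lambda>z. ?S (p' \<union> p) z - I z) + L1_norm (\<lambda>z. ?S p' z - I' z)"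
    proof (rule L1_norm_triangle)
      show "(\<lambda>z. ?S (p' \<union> p) z - I z) \<in> borel_measurable borel"
        using riemann_sum_measurable[OF q um] L1_measurable[OF I(1)] by (rule borel_measurable_diff)
      show "(\<lambda>z. ?S p' z - I' z) \<in> borel_measurable borel"
        by (rule borel_measurable_diff[OF riemann_sum_measurable[OF p'(1)] L1_measurable[OF I(2)]])
          (use um am in auto)
    qed
    also have "\<dots> < ennreal (\<epsilon> / 2) + ennreal (\<epsilon> / 2)"
    proof (rule add_strict_mono)
      show "L1_norm (\<lambda>z. ?S (p' \<union> p) z - I z) < ennreal (\<epsilon> / 2)"
        by (rule \<delta>1(2)[OF q]) (use fine_mono[OF p(2) \<delta>(2)] fine_mono[OF p'(2) \<delta>(2)] in \<open>auto simp: fine_Un\<close>)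
      show "L1_norm (\<lambda>z. ?S p' z - I' z) < ennreal (\<epsilon> / 2)"
        by (rule \<delta>2(2)[OF p'(1)]) (rule fine_mono[OF p'(2) \<delta>(3)])
    qed
    also have "\<dots> = ennreal \<epsilon>" using \<epsilon> by (simp flip: ennreal_plus)
    finally show "L1_norm (\<lambda>z. ?S p z - (I z - I' z)) < ennreal \<epsilon>" .
  qed
qed

text \<open>
  The bound holds a.e. for every Riemann sum, since a sum involves only finitely many times, and it passes to
  the limit in \<open>L\<^sup>1\<close>. With \<open>G = 0\<close> it estimates the integral, otherwise its distance to a
  rectangle rule.
\<close>

lemma riemann_integral_AE_bound:
  assumes ui: "has_riemann_integral_L1 u I a c" and ac: "a \<le> c"
    and G: "G \<in> borel_measurable borel" and E: "E \<in> borel_measurable borel"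
    and bd: "\<And>s. s \<in> {a..c} \<Longrightarrow> AE z in lborel. \<bar>u s z - G z\<bar> \<le> E z"
  shows "AE z in lborel. \<bar>I z - (c - a) * G z\<bar> \<le> (c - a) * E z"
proof -
  have I: "I \<in> borel_measurable borel" using ui by (auto simp: has_riemann_integral_L1_def L1_measurable)
  (* The amount by which the bound is violated; its integral is at most the distance of I to any Riemann sum. *)
  define \<phi> where "\<phi> z = max 0 (\<bar>I z - (c - a) * G z\<bar> - (c - a) * E z)" for z
  have \<phi>: "\<phi> \<in> borel_measurable borel" unfolding \<phi>_def[abs_def] using I G E by measurable
  have "(\<integral>\<^sup>+ z. ennreal (\<phi> z) \<partial>lborel) \<le> ennreal \<epsilon>" if \<epsilon>: "0 < \<epsilon>" for \<epsilon>
  proof -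
    from ui \<epsilon> obtain \<delta> where \<delta>: "\<delta> > 0" "\<And>p. p tagged_division_of {a..c} \<Longrightarrow> (\<lambda>s. ball s \<delta>) fine p \<Longrightarrow>
        L1_norm (\<lambda>z. (\<Sum>(s, k)\<in>p. measure lborel k * u s z) - I z) < ennreal \<epsilon>"
      unfolding has_riemann_integral_L1_def by blast
    obtain p where p: "p tagged_division_of {a..c}" "(\<lambda>s. ball s \<delta>) fine p"
      by (rule fine_tagged_division_exists[OF \<delta>(1)])
    have fin: "finite p" using p by (auto simp: tagged_division_of_finite)
    have len: "(\<Sum>q\<in>p. measure lborel (snd q)) = c - a"
      using additive_content_tagged_division[of p a c] p ac by (simp add: cbox_interval split_def)
    have "AE z in lborel. \<forall>q\<in>p. \<bar>u (fst q) z - G z\<bar> \<le> E z"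
    proof (rule AE_finite_allI[OF fin])
      fix q assume "q \<in> p"
      then have "fst q \<in> {a..c}" using tagged_division_ofD(2,3)[OF p(1), of "fst q" "snd q"] by auto
      then show "AE z in lborel. \<bar>u (fst q) z - G z\<bar> \<le> E z" by (rule bd)
    qed
    then have "AE z in lborel. ennreal (\<phi> z) \<le> ennreal \<bar>(\<Sum>(s, k)\<in>p. measure lborel k * u s z) - I z\<bar>"
    proof eventually_elim
      fix z assume q: "\<forall>q\<in>p. \<bar>u (fst q) z - G z\<bar> \<le> E z"
      let ?S = "\<Sum>q\<in>p. measure lborel (snd q) * u (fst q) z"
      have "\<bar>?S - (c - a) * G z\<bar> = \<bar>\<Sum>q\<in>p. measure lborel (snd q) * (u (fst q) z - G z)\<bar>"
        by (simp add: right_diff_distrib sum_subtractf flip: len sum_distrib_right)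
      also have "\<dots> \<le> (\<Sum>q\<in>p. \<bar>measure lborel (snd q) * (u (fst q) z - G z)\<bar>)" by (rule sum_abs)
      also have "\<dots> \<le> (\<Sum>q\<in>p. measure lborel (snd q) * E z)"
        by (intro sum_mono) (use q in \<open>auto simp: abs_mult intro!: mult_left_mono\<close>)
      also have "\<dots> = (c - a) * E z" by (simp flip: len sum_distrib_right)
      finally have "\<phi> z \<le> \<bar>?S - I z\<bar>" unfolding \<phi>_def by linarith
      then show "ennreal (\<phi> z) \<le> ennreal \<bar>(\<Sum>(s, k)\<in>p. measure lborel k * u s z) - I z\<bar>"
        by (simp add: split_def ennreal_leI)
    qed
    then have "(\<integral>\<^sup>+ z. ennreal (\<phi> z) \<partial>lborel) \<le> L1_norm (\<lambda>z. (\<Sum>(s, k)\<in>p. measure lborel k * u s z) - I z)"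
      unfolding L1_norm_def by (rule nn_integral_mono_AE)
    then show ?thesis using \<delta>(2)[OF p] by simp
  qed
  then have "(\<integral>\<^sup>+ z. ennreal (\<phi> z) \<partial>lborel) \<le> 0 + ennreal \<epsilon>" if "0 < \<epsilon>" for \<epsilon>
    using that by simp
  then have "(\<integral>\<^sup>+ z. ennreal (\<phi> z) \<partial>lborel) \<le> 0"
    by (rule ennreal_le_epsilon)
  then have "(\<integral>\<^sup>+ z. ennreal (\<phi> z) \<partial>lborel) = 0" by simp
  then have "AE z in lborel. ennreal (\<phi> z) = 0"
    using \<phi> by (subst (asm) nn_integral_0_iff_AE) auto
  then show ?thesis
    by eventually_elim (auto simp: \<phi>_def max_def split: if_splits)
qed

lemma mild_solution_formula:
  assumes "mild_solution b T f0 f" "0 \<le> t" "t \<le> T"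
  obtains I where "has_riemann_integral_L1 (\<lambda>s. free_flow (t - s) (J b (f s))) I 0 t"
    "AE z in lborel. f t z = free_flow t f0 z + I z"
proof -
  have "\<forall>t\<in>{0..T}. \<exists>I. has_riemann_integral_L1 (\<lambda>s. free_flow (t - s) (J b (f s))) I 0 t \<and>
      (AE z in lborel. f t z = free_flow t f0 z + I z)"
    using assms(1) unfolding mild_solution_def by (elim conjE)
  moreover have "t \<in> {0..T}" using assms by simp
  ultimately have "\<exists>I. has_riemann_integral_L1 (\<lambda>s. free_flow (t - s) (J b (f s))) I 0 t \<and>
      (AE z in lborel. f t z = free_flow t f0 z + I z)" by (rule bspec)
  then show thesis using that by (elim exE conjE)
qed

lemma mild_solution_initial:
  assumes f: "mild_solution b T f0 f" and T: "0 \<le> T"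
  shows "AE z in lborel. f 0 z = f0 z"
proof -
  let ?u = "\<lambda>s. free_flow (0 - s) (J b (f s))"
  obtain I where I: "has_riemann_integral_L1 ?u I 0 0" "AE z in lborel. f 0 z = free_flow 0 f0 z + I z"
    by (rule mild_solution_formula[OF f order_refl T])
  have "?u 0 \<in> borel_measurable borel" using I(1) by (auto simp: has_riemann_integral_L1_def L1_measurable)
  from riemann_integral_AE_bound[OF I(1) _ this, of "\<lambda>z. 0"]
  have "AE z in lborel. I z = 0" by simp
  with I(2) show ?thesis by eventually_elim (simp add: free_flow_0)
qed

text \<open>
  The mild formula between two times of the interval, by the semigroup property of the free flow.
\<close>

lemma mild_solution_step:
  assumes f: "mild_solution b T f0 f" and t: "0 \<le> t" "t \<le> r" "r \<le> T"
  obtains D where "has_riemann_integral_L1 (\<lambda>s. free_flow (r - s) (J b (f s))) D t r"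
    "AE z in lborel. f r z = free_flow (r - t) (f t) z + D z"
proof -
  have f0: "f0 \<in> borel_measurable borel" and fm: "\<And>t. t \<in> {0..T} \<Longrightarrow> f t \<in> borel_measurable borel"
    using f by (auto simp: mild_solution_def L1_measurable)
  have "0 \<le> r" "t \<le> T" using t by simp_all
  obtain I where I: "has_riemann_integral_L1 (\<lambda>s. free_flow (r - s) (J b (f s))) I 0 r"
    "AE z in lborel. f r z = free_flow r f0 z + I z"
    by (rule mild_solution_formula[OF f \<open>0 \<le> r\<close> t(3)])
  obtain I' where I': "has_riemann_integral_L1 (\<lambda>s. free_flow (t - s) (J b (f s))) I' 0 t"
    "AE z in lborel. f t z = free_flow t f0 z + I' z"
    by (rule mild_solution_formula[OF f t(1) \<open>t \<le> T\<close>])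
  have I'm: "I' \<in> borel_measurable borel" using I'(1) by (auto simp: has_riemann_integral_L1_def L1_measurable)
  have "has_riemann_integral_L1 (\<lambda>s. free_flow (r - s) (J b (f s))) (free_flow (r - t) I') 0 t"
    using has_riemann_integral_L1_free_flow[OF I'(1), of "r - t"] by (simp add: free_flow_free_flow)
  from has_riemann_integral_L1_diff_interval[OF I(1) this t(1,2)]
  have D: "has_riemann_integral_L1 (\<lambda>s. free_flow (r - s) (J b (f s))) (\<lambda>z. I z - free_flow (r - t) I' z) t r" .
  have "(\<lambda>z. free_flow t f0 z + I' z) \<in> borel_measurable borel"
    by (intro borel_measurable_add measurable_free_flow f0 I'm)
  from free_flow_cong_AE[OF fm this I'(2), of "r - t"] t
  have "AE z in lborel. free_flow (r - t) (f t) z = free_flow (r - t) (\<lambda>z. free_flow t f0 z + I' z) z" by simp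
  with I(2) have "AE z in lborel. f r z = free_flow (r - t) (f t) z + (I z - free_flow (r - t) I' z)"
  proof eventually_elim
    fix z assume 1: "f r z = free_flow r f0 z + I z"
      and 2: "free_flow (r - t) (f t) z = free_flow (r - t) (\<lambda>z. free_flow t f0 z + I' z) z"
    have "free_flow (r - t) (\<lambda>z. free_flow t f0 z + I' z) z = free_flow (r - t) (free_flow t f0) z + free_flow (r - t) I' z"
      by (simp add: free_flow_alt)
    then show "f r z = free_flow (r - t) (f t) z + (I z - free_flow (r - t) I' z)"
      using 1 2 by (simp add: free_flow_free_flow)
  qed
  with D show thesis by (rule that)
qed

section \<open>The local error of the exact solution\<close>

text \<open>
  The factor \<open>exp (norm y)\<close> admits translations of any length: over a distance of \<open>1\<close> or more, the
  domination by the weight gives the estimate, as the weight varies by at most this factor.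
\<close>

definition flow_lipschitz :: "real \<Rightarrow> real \<Rightarrow> real \<Rightarrow> (phase \<Rightarrow> real) \<Rightarrow> bool" where
  "flow_lipschitz L s t g \<longleftrightarrow> dominated L s t g \<and>
     (\<forall>x y v. \<bar>g (x + y, v) - g (x, v)\<bar> \<le> L * norm y * exp (norm y) * flow_weight s t (x, v))"

text \<open>
  The Gaussian decay in the position pays for \<open>\<bar>x\<bar>\<close>, and the surplus \<open>\<tau> - s\<close> of the decay in the velocity
  pays for \<open>t \<bar>v\<bar>\<close>.
\<close>

lemma weight_le_flow_weight:
  assumes "s < \<tau>" "0 < \<tau>" "0 \<le> t" "t \<le> T"
  shows "weight \<tau> \<tau> (x, v) \<le> exp (1 / (4 * \<tau>) + T\<^sup>2 / (4 * (\<tau> - s))) * flow_weight s t (x, v)"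
proof -
  have "norm (x - t *\<^sub>R v) \<le> norm x + norm (t *\<^sub>R v)" by (rule norm_triangle_ineq4)
  also have "norm (t *\<^sub>R v) \<le> T * norm v" using assms by (simp add: mult_right_mono)
  also have "norm x \<le> \<tau> * (norm x)\<^sup>2 + 1 / (4 * \<tau>)"
    using linear_le_quadratic[of \<tau> 1 "norm x"] assms by simp
  also have "T * norm v \<le> (\<tau> - s) * (norm v)\<^sup>2 + T\<^sup>2 / (4 * (\<tau> - s))"
    using linear_le_quadratic[of "\<tau> - s" T "norm v"] assms by simp
  finally have "- \<tau> * (x \<bullet> x) - \<tau> * (v \<bullet> v)
      \<le> (1 / (4 * \<tau>) + T\<^sup>2 / (4 * (\<tau> - s))) + (- s * (v \<bullet> v) - norm (x - t *\<^sub>R v))"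
    by (simp add: power2_norm_eq_inner algebra_simps)
  then show ?thesis by (simp add: weight_def flow_weight_def flip: exp_add)
qed

lemma representative_flow_lipschitz:
  assumes par: "s < \<tau>" "0 < \<tau>" "0 \<le> t" "t \<le> T" "0 \<le> R" "0 \<le> M"
    and nn: "\<And>z. 0 \<le> G z" and bd: "\<And>z. G z \<le> R * weight \<tau> \<tau> z"
    and lip: "\<And>x y v. norm y < 1 \<Longrightarrow> \<bar>G (x + y, v) - G (x, v)\<bar> \<le> M * norm y * weight \<tau> \<tau> (x, v)"
  shows "flow_lipschitz ((M + 2 * R) * exp (1 / (4 * \<tau>) + T\<^sup>2 / (4 * (\<tau> - s)))) s t G"
proof -
  define c where "c = exp (1 / (4 * \<tau>) + T\<^sup>2 / (4 * (\<tau> - s)))"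
  have c: "0 < c" by (simp add: c_def)
  have wc: "weight \<tau> \<tau> (x, v) \<le> c * flow_weight s t (x, v)" for x v
    unfolding c_def by (rule weight_le_flow_weight[OF par(1-4)])
  have le: "G (x, v) \<le> R * c * flow_weight s t (x, v)" for x v
  proof -
    have "G (x, v) \<le> R * weight \<tau> \<tau> (x, v)" by (rule bd)
    also have "\<dots> \<le> R * (c * flow_weight s t (x, v))" by (rule mult_left_mono[OF wc par(5)])
    finally show ?thesis by (simp add: mult.assoc)
  qed
  have nn_c: "0 \<le> R * c" "0 \<le> M * c" using c par by auto
  have dom: "dominated ((M + 2 * R) * c) s t G"
    unfolding dominated_def
  proof
    fix z :: phase
    obtain x v where z: "z = (x, v)" by (cases z)
    have "R * c \<le> (M + 2 * R) * c" using nn_c by (simp add: algebra_simps)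
    then have "R * c * flow_weight s t (x, v) \<le> (M + 2 * R) * c * flow_weight s t (x, v)"
      by (rule mult_right_mono) (rule flow_weight_nonneg)
    then show "\<bar>G z\<bar> \<le> (M + 2 * R) * c * flow_weight s t z" using le[of x v] nn[of z] by (simp add: z)
  qed
  have "\<bar>G (x + y, v) - G (x, v)\<bar> \<le> (M + 2 * R) * c * norm y * exp (norm y) * flow_weight s t (x, v)" for x y v
  proof (cases "norm y < 1")
    case True
    have "\<bar>G (x + y, v) - G (x, v)\<bar> \<le> M * norm y * weight \<tau> \<tau> (x, v)" by (rule lip[OF True])
    also have "\<dots> \<le> M * norm y * (c * flow_weight s t (x, v))"
      using par by (intro mult_left_mono wc) auto
    also have "\<dots> = M * c * (norm y * 1 * flow_weight s t (x, v))" by simp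
    also have "\<dots> \<le> (M + 2 * R) * c * (norm y * exp (norm y) * flow_weight s t (x, v))"
      using nn_c c par by (intro mult_mono mult_right_mono mult_left_mono)
        (auto simp: algebra_simps flow_weight_nonneg)
    finally show ?thesis by (simp add: mult.assoc)
  next
    case False
    have "\<bar>G (x + y, v) - G (x, v)\<bar> \<le> G (x + y, v) + G (x, v)" using nn[of "(x + y, v)"] nn[of "(x, v)"] by linarith
    also have "\<dots> \<le> R * c * flow_weight s t (x + y, v) + R * c * flow_weight s t (x, v)" by (intro add_mono le)
    also have "\<dots> \<le> R * c * (exp (norm y) * flow_weight s t (x, v)) + R * c * (exp (norm y) * flow_weight s t (x, v))"
    proof (intro add_mono mult_left_mono nn_c)
      show "flow_weight s t (x + y, v) \<le> exp (norm y) * flow_weight s t (x, v)"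
        using flow_weight_shift[of s t "x + y" v x] by simp
      show "flow_weight s t (x, v) \<le> exp (norm y) * flow_weight s t (x, v)"
        using flow_weight_nonneg[of s t "(x, v)"] by (simp add: mult_le_cancel_right1)
    qed
    also have "\<dots> = 2 * R * c * (1 * exp (norm y) * flow_weight s t (x, v))" by simp
    also have "\<dots> \<le> (M + 2 * R) * c * (norm y * exp (norm y) * flow_weight s t (x, v))"
      using nn_c c par False by (intro mult_mono mult_right_mono) (auto simp: algebra_simps flow_weight_nonneg)
    finally show ?thesis by (simp add: mult.assoc)
  qed
  with dom show ?thesis unfolding flow_lipschitz_def c_def by blast
qed

lemma flow_lipschitz_dominated: "flow_lipschitz L s t g \<Longrightarrow> dominated L s t g"
  by (simp add: flow_lipschitz_def)

lemma flow_lipschitz_free_flow: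
  assumes g: "flow_lipschitz L s t g"
  shows "flow_lipschitz L s (t + q) (free_flow q g)"
proof -
  have "\<bar>free_flow q g (x + y, v) - free_flow q g (x, v)\<bar> \<le> L * norm y * exp (norm y) * flow_weight s (t + q) (x, v)" for x y v
  proof -
    have "\<bar>g ((x - q *\<^sub>R v) + y, v) - g (x - q *\<^sub>R v, v)\<bar> \<le> L * norm y * exp (norm y) * flow_weight s t (x - q *\<^sub>R v, v)"
      using g by (simp add: flow_lipschitz_def)
    then show ?thesis by (simp add: free_flow_apply flow_weight_free_flow algebra_simps)
  qed
  then show ?thesis using dominated_free_flow[OF flow_lipschitz_dominated[OF g]] by (simp add: flow_lipschitz_def)
qed

text \<open>
  Translations by a multiple of \<open>v - u\<close> cost a factor that is exponential in \<open>\<bar>v - v\<^sub>*\<bar>\<close>; the surplus \<open>s1 - s\<close> of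
  the decay pays for it, because the energy of the pair is conserved.
\<close>

lemma flow_weight_absorb:
  assumes r: "reachable v vs u us" and s: "s < s1"
  shows "exp (4 * norm (v - vs)) * (flow_weight s1 t (x, u) * flow_weight s1 t (x, us))
    \<le> exp (8 / (s1 - s)) * flow_weight s t (x, v) * exp (- s * (vs \<bullet> vs))"
proof -
  define d where "d = s1 - s"
  have d: "0 < d" using s by (simp add: d_def)
  have e: "u \<bullet> u + us \<bullet> us = v \<bullet> v + vs \<bullet> vs" using r by (simp add: reachable_def)
  have "4 * norm (v - vs) \<le> 4 * norm v + 4 * norm vs" using norm_triangle_ineq4[of v vs] by simp
  also have "\<dots> \<le> (d * (v \<bullet> v) + 4 / d) + (d * (vs \<bullet> vs) + 4 / d)"
    using linear_le_quadratic[OF d, of 4 "norm v"] linear_le_quadratic[OF d, of 4 "norm vs"]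
    by (simp add: power2_norm_eq_inner)
  also have "\<dots> = d * (u \<bullet> u + us \<bullet> us) + 8 / d" unfolding e using d by (simp add: field_simps)
  finally have a: "exp (4 * norm (v - vs)) * exp (- d * (u \<bullet> u + us \<bullet> us)) \<le> exp (8 / d)"
    by (simp flip: exp_add)
  have w: "flow_weight s1 t (x, u) = exp (- d * (u \<bullet> u)) * flow_weight s t (x, u)" for u
    by (simp add: flow_weight_def d_def algebra_simps flip: exp_add)
  have "exp (4 * norm (v - vs)) * (flow_weight s1 t (x, u) * flow_weight s1 t (x, us))
      = (exp (4 * norm (v - vs)) * exp (- d * (u \<bullet> u + us \<bullet> us))) * (flow_weight s t (x, u) * flow_weight s t (x, us))"
    by (simp add: w algebra_simps flip: exp_add)
  also have "\<dots> \<le> exp (8 / d) * (exp (- s * (vs \<bullet> vs)) * flow_weight s t (x, v))"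
    by (intro mult_mono a flow_weight_reachable[OF r]) (auto simp: flow_weight_nonneg)
  finally show ?thesis by (simp add: d_def ac_simps)
qed

lemma mult_exp_le: "0 \<le> (d::real) \<Longrightarrow> d * exp d \<le> exp (2 * d)"
proof -
  assume "0 \<le> d"
  have "d \<le> exp d" using exp_ge_add_one_self[of d] by linarith
  then have "d * exp d \<le> exp d * exp d" by (rule mult_right_mono) simp
  then show ?thesis by (simp flip: exp_add)
qed

lemma product_diff_bound:
  fixes a b a' b' :: real
  assumes "\<bar>a\<bar> \<le> p" "\<bar>b\<bar> \<le> q" "\<bar>a'\<bar> \<le> p'" "\<bar>a - a'\<bar> \<le> e" "\<bar>b - b'\<bar> \<le> e'" "0 \<le> q" "0 \<le> p'"
  shows "\<bar>a * b - a' * b'\<bar> \<le> e * q + p' * e'"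
proof -
  have "a * b - a' * b' = (a - a') * b + a' * (b - b')" by (simp add: algebra_simps)
  also have "\<bar>\<dots>\<bar> \<le> \<bar>a - a'\<bar> * \<bar>b\<bar> + \<bar>a'\<bar> * \<bar>b - b'\<bar>"
    by (metis abs_mult abs_triangle_ineq)
  also have "\<dots> \<le> e * q + p' * e'"
    using assms by (intro add_mono mult_mono) auto
  finally show ?thesis .
qed

definition commutator_factor :: "real \<Rightarrow> real \<Rightarrow> real \<Rightarrow> real \<Rightarrow> real" where
  "commutator_factor m s s1 N = 2 * m * exp (8 / (s1 - s)) * N\<^sup>2"

context collision begin

abbreviation commutator_const :: "real \<Rightarrow> real \<Rightarrow> real \<Rightarrow> real" where
  "commutator_const s s1 N \<equiv> commutator_factor (mass s) s s1 N"

text \<open>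
  Transport and collisions do not commute: with the collision first, all densities of the integrand are evaluated
  at the same position \<open>x - q v\<close>; with the transport first, each of them is evaluated at \<open>x - q u\<close>, with its own
  velocity \<open>u\<close>. The distance \<open>q \<bar>u - v\<bar>\<close> is of the order of the time step, and \<open>F\<close> is Lipschitz continuous.
  As this distance grows with the velocities, some of the Gaussian decay is lost.
  The function \<open>k\<close> allows for a perturbation of the same order.
\<close>

lemma transport_collision_commutator:
  assumes s: "0 < s" "s < s1" and q: "0 \<le> q" "q \<le> h" "h \<le> 1" and C: "0 \<le> C"
    and F: "F \<in> borel_measurable borel" "flow_lipschitz L s1 t F"
    and k: "k \<in> borel_measurable borel" "dominated (h * C) s1 t (\<lambda>z. F z - k z)"
  shows "\<bar>free_flow q (J_B b F F) z - J_B b (free_flow q k) (free_flow q k) z\<bar>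
    \<le> h * commutator_const s s1 (3 * L + C) * flow_weight s (t + q) z"
proof -
  obtain x v where z: "z = (x, v)" by (cases z)
  define N where "N = 3 * L + C"
  have dF: "dominated L s1 t F" by (rule flow_lipschitz_dominated[OF F(2)])
  have L: "0 \<le> L" by (rule dominated_nonneg[OF dF])
  have h: "0 \<le> h" using q by simp
  let ?W = "\<lambda>u. flow_weight s1 (t + q) (x, u)"
  let ?F1 = "\<lambda>u. F (x - q *\<^sub>R v, u)" and ?F2 = "\<lambda>u. k (x - q *\<^sub>R u, u)"
  have single: "\<bar>?F1 u - ?F2 u\<bar> \<le> h * (L + C) * exp (2 * d) * ?W u
      \<and> \<bar>?F2 u\<bar> \<le> (L + C) * exp (2 * d) * ?W u \<and> \<bar>?F1 u\<bar> \<le> 2 * L * exp (2 * d) * ?W u"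
    if d: "norm (v - u) \<le> d" for u d
  proof -
    have W: "flow_weight s1 t (x - q *\<^sub>R u, u) = ?W u" by (rule flow_weight_free_flow)
    have d0: "0 \<le> d" using d norm_ge_zero[of "v - u"] by linarith
    let ?y = "q *\<^sub>R (u - v)"
    have "norm (q *\<^sub>R (u - v)) \<le> h * d"
      using d q d0 by (simp add: norm_minus_commute mult_mono)
    moreover have "h * d \<le> d" using q d0 h by (simp add: mult_left_le_one_le)
    ultimately have y: "norm ?y \<le> h * d" "norm ?y \<le> d" by auto
    have "\<bar>?F1 u - F (x - q *\<^sub>R u, u)\<bar> = \<bar>F ((x - q *\<^sub>R u) + ?y, u) - F (x - q *\<^sub>R u, u)\<bar>"
      by (simp add: algebra_simps)
    also have "\<dots> \<le> L * norm ?y * exp (norm ?y) * ?W u"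
      using F(2) W unfolding flow_lipschitz_def by metis
    also have "\<dots> \<le> L * (h * d) * exp d * ?W u"
      using y L h d0 by (intro mult_mono mult_right_mono mult_left_mono) (auto simp: flow_weight_nonneg)
    also have "\<dots> = h * L * (d * exp d) * ?W u" by simp
    also have "\<dots> \<le> h * L * exp (2 * d) * ?W u"
      using L h mult_exp_le[OF d0] by (intro mult_right_mono mult_left_mono) (auto simp: flow_weight_nonneg)
    finally have 1: "\<bar>?F1 u - F (x - q *\<^sub>R u, u)\<bar> \<le> h * L * exp (2 * d) * ?W u" .
    have 2: "\<bar>F (x - q *\<^sub>R u, u) - ?F2 u\<bar> \<le> h * C * ?W u"
      using dominatedD[OF k(2), of "(x - q *\<^sub>R u, u)"] by (simp add: W)
    have 3: "\<bar>F (x - q *\<^sub>R u, u)\<bar> \<le> L * ?W u"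
      using dominatedD[OF dF, of "(x - q *\<^sub>R u, u)"] by (simp add: W)
    have E: "1 \<le> exp (2 * d)" using d0 by simp
    have hE: "h * X * Y * ?W u \<le> X * Y * ?W u" if "0 \<le> X" "0 \<le> Y" for X Y
      using q h that mult_left_le_one_le[of "X * Y * ?W u" h] by (simp add: flow_weight_nonneg mult.assoc)
    have 4: "X * ?W u \<le> X * exp (2 * d) * ?W u" if "0 \<le> X" for X
      using that E by (intro mult_right_mono) (auto simp: flow_weight_nonneg mult_le_cancel_left1)
    have a: "\<bar>?F1 u - ?F2 u\<bar> \<le> h * (L + C) * exp (2 * d) * ?W u"
      using 1 2 4[of "h * C"] h C by (simp add: algebra_simps)
    have b: "\<bar>?F2 u\<bar> \<le> (L + C) * exp (2 * d) * ?W u"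
      using 2 3 4[of L] 4[of C] hE[of C 1] L C by (simp add: algebra_simps)
    have c: "\<bar>?F1 u\<bar> \<le> 2 * L * exp (2 * d) * ?W u"
      using 1 3 4[of L] hE[of L "exp (2 * d)"] L by (simp add: algebra_simps)
    show ?thesis using a b c by blast
  qed
  let ?B = "N\<^sup>2 * exp (8 / (s1 - s)) * flow_weight s (t + q) (x, v)"
  have bounds: "\<bar>?F1 u * ?F1 us\<bar> \<le> ?B * exp (- s * (vs \<bullet> vs)) \<and> \<bar>?F2 u * ?F2 us\<bar> \<le> ?B * exp (- s * (vs \<bullet> vs))
      \<and> \<bar>?F1 u * ?F1 us - ?F2 u * ?F2 us\<bar> \<le> h * ?B * exp (- s * (vs \<bullet> vs))"
    if r: "reachable v vs u us" for vs u us
  proof -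
    let ?d = "norm (v - vs)"
    let ?E = "exp (2 * ?d)"
    note 1 = single[OF reachable_dist(1)[OF r]] and 2 = single[OF reachable_dist(2)[OF r]]
    let ?P = "(?E * ?W u) * (?E * ?W us)"
    have P0: "0 \<le> ?P" by (simp add: flow_weight_nonneg)
    have "?P = exp (4 * ?d) * (?W u * ?W us)" by (simp flip: exp_add)
    also have "\<dots> \<le> exp (8 / (s1 - s)) * flow_weight s (t + q) (x, v) * exp (- s * (vs \<bullet> vs))"
      by (rule flow_weight_absorb[OF r s(2)])
    finally have P: "N\<^sup>2 * ?P \<le> ?B * exp (- s * (vs \<bullet> vs))"
      by (simp add: mult.assoc mult_left_mono)
    have LN: "2 * L \<le> N" "L + C \<le> N" "0 \<le> N" using L C by (simp_all add: N_def)
    have WN: "X * exp (2 * ?d) * ?W w \<le> N * (?E * ?W w)" if "X \<le> N" for X w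
      using that by (simp add: mult.assoc mult_right_mono flow_weight_nonneg)
    have f1: "\<bar>?F1 u\<bar> \<le> N * (?E * ?W u)" "\<bar>?F1 us\<bar> \<le> N * (?E * ?W us)"
      using 1 2 WN[OF LN(1)] by (meson order_trans)+
    have f2: "\<bar>?F2 u\<bar> \<le> N * (?E * ?W u)" "\<bar>?F2 us\<bar> \<le> N * (?E * ?W us)"
      using 1 2 WN[OF LN(2)] by (meson order_trans)+
    have "\<bar>?F1 u * ?F1 us\<bar> \<le> (N * (?E * ?W u)) * (N * (?E * ?W us))"
      unfolding abs_mult using f1 by (intro mult_mono) auto
    moreover have "\<bar>?F2 u * ?F2 us\<bar> \<le> (N * (?E * ?W u)) * (N * (?E * ?W us))"
      unfolding abs_mult using f2 by (intro mult_mono) auto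
    moreover have "(N * (?E * ?W u)) * (N * (?E * ?W us)) = N\<^sup>2 * ?P" by (simp add: power2_eq_square)
    moreover have "\<bar>?F1 u * ?F1 us - ?F2 u * ?F2 us\<bar> \<le> h * ?B * exp (- s * (vs \<bullet> vs))"
    proof -
      have "\<bar>?F1 u * ?F1 us - ?F2 u * ?F2 us\<bar>
          \<le> (h * (L + C) * ?E * ?W u) * (2 * L * ?E * ?W us) + ((L + C) * ?E * ?W u) * (h * (L + C) * ?E * ?W us)"
        by (rule product_diff_bound[where p = "2 * L * ?E * ?W u"])
          (use 1 2 L C in \<open>auto simp: flow_weight_nonneg\<close>)
      also have "\<dots> = h * (((L + C) * (3 * L + C)) * ?P)" by (simp add: algebra_simps)
      also have "\<dots> \<le> h * (N\<^sup>2 * ?P)"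
        unfolding power2_eq_square using LN L C h P0
        by (intro mult_left_mono mult_right_mono mult_mono) (auto simp: N_def)
      also have "\<dots> \<le> h * (?B * exp (- s * (vs \<bullet> vs)))" using P h by (rule mult_left_mono)
      finally show ?thesis by (simp add: mult.assoc)
    qed
    ultimately show ?thesis using P by simp
  qed
  have "\<bar>Q (\<lambda>u us. ?F1 u * ?F1 us) v - Q (\<lambda>u us. ?F2 u * ?F2 us) v\<bar> \<le> 2 * (h * ?B) * mass s"
  proof (rule Q_diff[OF s(1), where A = ?B])
    show "0 \<le> ?B" "0 \<le> h * ?B" using h by (simp_all add: flow_weight_nonneg)
    show "(\<lambda>(u, us). ?F1 u * ?F1 us) \<in> borel_measurable borel" by (rule product_measurable[OF F(1) F(1)])
    show "(\<lambda>(u, us). ?F2 u * ?F2 us) \<in> borel_measurable borel"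
      using product_measurable[OF measurable_free_flow[OF k(1)] measurable_free_flow[OF k(1)], of q x q]
      by (simp add: free_flow_apply)
  qed (use bounds in blast)+
  then show ?thesis
    by (simp add: z free_flow_apply J_B_eq_Q N_def commutator_factor_def ac_simps)
qed

abbreviation production_const :: "real \<Rightarrow> real \<Rightarrow> real" where
  "production_const s1 L \<equiv> 2 * L * L * mass s1"

lemma J_transport_dominated:
  assumes s1: "0 < s1" and m: "F \<in> borel_measurable borel" and d: "dominated L s1 s F"
  shows "dominated (production_const s1 L) s1 r (free_flow (r - s) (J_B b F F))"
  using dominated_free_flow[OF J_B_dominated[OF s1 m m d d], of "r - s"] by simp

text \<open>
  Along the free flow the solution changes only by the integral of the collision term, which is bounded.
\<close>

lemma solution_time_lipschitz:
  assumes f: "mild_solution b T f0 f" and s1: "0 < s1"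
    and F: "\<And>t. t \<in> {0..T} \<Longrightarrow> F t \<in> borel_measurable borel \<and> (AE z in lborel. F t z = f t z) \<and> flow_lipschitz L s1 t (F t)"
    and t: "0 \<le> t" "t \<le> r" "r \<le> T"
  shows "AE z in lborel. \<bar>F r z - free_flow (r - t) (F t) z\<bar> \<le> (r - t) * production_const s1 L * flow_weight s1 r z"
proof -
  have fm: "\<And>t. t \<in> {0..T} \<Longrightarrow> f t \<in> borel_measurable borel"
    using f by (auto simp: mild_solution_def L1_measurable)
  obtain D where D: "has_riemann_integral_L1 (\<lambda>s. free_flow (r - s) (J b (f s))) D t r"
    "AE z in lborel. f r z = free_flow (r - t) (f t) z + D z"
    by (rule mild_solution_step[OF f t])
  have "AE z in lborel. \<bar>D z - (r - t) * (\<lambda>z. 0) z\<bar> \<le> (r - t) * (\<lambda>z. production_const s1 L * flow_weight s1 r z) z"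
  proof (rule riemann_integral_AE_bound[OF D(1) t(2)])
    fix s assume "s \<in> {t..r}"
    then have s: "s \<in> {0..T}" using t by auto
    note Fs = F[OF s]
    have "AE z in lborel. J_B b (f s) (f s) z = J_B b (F s) (F s) z"
      by (rule J_B_cong_AE) (use Fs fm[OF s] in \<open>auto simp: eq_commute\<close>)
    from free_flow_cong_AE[OF _ _ this, of "r - s"] Fs fm[OF s]
    have "AE z in lborel. free_flow (r - s) (J b (f s)) z = free_flow (r - s) (J_B b (F s) (F s)) z"
      by (simp add: J_def[abs_def] J_B_measurable)
    then show "AE z in lborel. \<bar>free_flow (r - s) (J b (f s)) z - 0\<bar> \<le> production_const s1 L * flow_weight s1 r z"
    proof eventually_elim
      fix z assume "free_flow (r - s) (J b (f s)) z = free_flow (r - s) (J_B b (F s) (F s)) z"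
      then show "\<bar>free_flow (r - s) (J b (f s)) z - 0\<bar> \<le> production_const s1 L * flow_weight s1 r z"
        using dominatedD[OF J_transport_dominated[OF s1 _ flow_lipschitz_dominated, of "F s" L s r], of z] Fs by simp
    qed
  qed (auto intro!: borel_measurable_times)
  moreover have "AE z in lborel. F r z = f r z" using F t by auto
  moreover have "AE z in lborel. free_flow (r - t) (F t) z = free_flow (r - t) (f t) z"
    by (rule free_flow_cong_AE) (use F[of t] fm[of t] t in auto)
  ultimately show ?thesis using D(2) by eventually_elim (simp add: mult.assoc)
qed

text \<open>
  At each time \<open>s'\<close> between \<open>t\<close> and \<open>t + h\<close> the integrand of the mild formula is within \<open>O(h)\<close> of the collision term
  of the freely transported solution, by \<open>transport_collision_commutator\<close> and \<open>solution_time_lipschitz\<close>.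
  Integrating over a time interval of length \<open>h\<close> gives an error of the order of \<open>h\<^sup>2\<close>.
\<close>

lemma solution_local_error:
  assumes f: "mild_solution b T f0 f" and s: "0 < s" "s < s1"
    and F: "\<And>t. t \<in> {0..T} \<Longrightarrow> F t \<in> borel_measurable borel \<and> (AE z in lborel. F t z = f t z) \<and> flow_lipschitz L s1 t (F t)"
    and h: "0 \<le> t" "0 \<le> h" "h \<le> 1" "t + h \<le> T"
  shows "AE z in lborel. \<bar>F (t + h) z - free_flow h (F t) z - h * J_B b (free_flow h (F t)) (free_flow h (F t)) z\<bar>
    \<le> h * (h * commutator_const s s1 (3 * L + production_const s1 L)) * flow_weight s (t + h) z"
proof -
  let ?C = "production_const s1 L" and ?r = "t + h"
  let ?K = "commutator_const s s1 (3 * L + ?C)"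
  have s1: "0 < s1" using s by simp
  have fm: "\<And>t. t \<in> {0..T} \<Longrightarrow> f t \<in> borel_measurable borel"
    using f by (auto simp: mild_solution_def L1_measurable)
  have C: "0 \<le> ?C" by (simp add: mass_nonneg)
  have t: "t \<in> {0..T}" "?r \<in> {0..T}" using h by auto
  have Ft: "F t \<in> borel_measurable borel" using F[OF t(1)] by blast
  have J_meas: "J_B b (free_flow h (F t)) (free_flow h (F t)) \<in> borel_measurable borel"
    by (intro J_B_measurable measurable_free_flow Ft)
  obtain D where D: "has_riemann_integral_L1 (\<lambda>s. free_flow (?r - s) (J b (f s))) D t ?r"
    "AE z in lborel. f ?r z = free_flow (?r - t) (f t) z + D z"
    by (rule mild_solution_step[OF f h(1) _ h(4)]) (use h in auto)
  have "AE z in lborel. \<bar>D z - (?r - t) * J_B b (free_flow h (F t)) (free_flow h (F t)) z\<bar>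
      \<le> (?r - t) * (\<lambda>z. h * ?K * flow_weight s ?r z) z"
  proof (rule riemann_integral_AE_bound[OF D(1)])
    fix s' assume s': "s' \<in> {t..?r}"
    then have s'T: "s' \<in> {0..T}" using h by auto
    note Fs = F[OF s'T]
    define q where "q = ?r - s'"
    have q: "0 \<le> q" "q \<le> h" "s' + q = ?r" using s' by (auto simp: q_def)
    (* Off a null set k is the freely transported F t; on it, k is still close to F s'. *)
    define e where "e z = h * ?C * flow_weight s1 s' z" for z
    define k where "k z = max (F s' z - e z) (min (F s' z + e z) (free_flow (s' - t) (F t) z))" for z
    have e: "0 \<le> e z" for z using h C by (simp add: e_def flow_weight_nonneg)
    have [measurable]: "e \<in> borel_measurable borel" unfolding e_def[abs_def] by measurable
    have [measurable]: "free_flow (s' - t) (F t) \<in> borel_measurable borel" by (rule measurable_free_flow[OF Ft])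
    have [measurable]: "F s' \<in> borel_measurable borel" using Fs by blast
    have km: "k \<in> borel_measurable borel" unfolding k_def[abs_def] by measurable
    have kd: "dominated (h * ?C) s1 s' (\<lambda>z. F s' z - k z)"
      unfolding dominated_def using e by (auto simp: k_def e_def[symmetric] max_def min_def abs_le_iff)
    have "AE z in lborel. \<bar>F s' z - free_flow (s' - t) (F t) z\<bar> \<le> (s' - t) * ?C * flow_weight s1 s' z"
      by (rule solution_time_lipschitz[OF f s1 F]) (use s' s'T h in auto)
    then have "AE z in lborel. k z = free_flow (s' - t) (F t) z"
    proof eventually_elim
      fix z assume "\<bar>F s' z - free_flow (s' - t) (F t) z\<bar> \<le> (s' - t) * ?C * flow_weight s1 s' z"
      also have "\<dots> \<le> e z" unfolding e_def using s' C by (intro mult_right_mono) (auto simp: flow_weight_nonneg)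
      finally show "k z = free_flow (s' - t) (F t) z" by (auto simp: k_def max_def min_def)
    qed
    from free_flow_cong_AE[OF km _ this, of q]
    have kq: "AE z in lborel. free_flow q k z = free_flow h (F t) z"
      by (simp add: free_flow_free_flow q_def)
    have 1: "AE z in lborel. J_B b (free_flow q k) (free_flow q k) z = J_B b (free_flow h (F t)) (free_flow h (F t)) z"
      by (rule J_B_cong_AE[OF _ _ _ _ kq kq]) (intro measurable_free_flow km Ft)+
    have "AE z in lborel. J_B b (f s') (f s') z = J_B b (F s') (F s') z"
      by (rule J_B_cong_AE) (use Fs fm[OF s'T] in \<open>auto simp: eq_commute\<close>)
    from free_flow_cong_AE[OF _ _ this, of q] Fs fm[OF s'T]
    have 2: "AE z in lborel. free_flow q (J b (f s')) z = free_flow q (J_B b (F s') (F s')) z"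
      by (simp add: J_def[abs_def] J_B_measurable)
    from 1 2 show "AE z in lborel. \<bar>free_flow (?r - s') (J b (f s')) z - J_B b (free_flow h (F t)) (free_flow h (F t)) z\<bar>
        \<le> h * ?K * flow_weight s ?r z"
      unfolding q_def[symmetric]
    proof eventually_elim
      fix z assume "J_B b (free_flow q k) (free_flow q k) z = J_B b (free_flow h (F t)) (free_flow h (F t)) z"
        "free_flow q (J b (f s')) z = free_flow q (J_B b (F s') (F s')) z"
      then show "\<bar>free_flow q (J b (f s')) z - J_B b (free_flow h (F t)) (free_flow h (F t)) z\<bar> \<le> h * ?K * flow_weight s ?r z"
        using transport_collision_commutator[OF s q(1,2) h(3) C _ _ km kd, of L z] Fs by (simp add: q(3))
    qed
  qed (use h J_meas in \<open>auto intro!: borel_measurable_times\<close>)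
  moreover have "AE z in lborel. F ?r z = f ?r z" using F t by auto
  moreover have "AE z in lborel. free_flow h (F t) z = free_flow h (f t) z"
    by (rule free_flow_cong_AE) (use F[of t] fm[of t] t in auto)
  ultimately show ?thesis using D(2) by eventually_elim (simp add: mult.assoc)
qed

end

section \<open>Stability, positivity and convergence of the scheme\<close>

lemma dominated_add:
  "dominated A s t g \<Longrightarrow> dominated B s t h \<Longrightarrow> dominated (A + B) s t (\<lambda>z. g z + h z)"
  using dominated_diff_mono[of A s t g B "\<lambda>z. g z + h z"] by simp

lemma dominated_scale:
  assumes "dominated A s t g" "0 \<le> c"
  shows "dominated (c * A) s t (\<lambda>z. c * g z)"
  unfolding dominated_def
proof
  fix z
  show "\<bar>c * g z\<bar> \<le> c * A * flow_weight s t z"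
    using mult_left_mono[OF dominatedD[OF assms(1)] assms(2), of z] assms(2) by (simp add: abs_mult mult.assoc)
qed

lemma dominated_imp_B_space:
  assumes s: "0 \<le> s" and g: "g \<in> borel_measurable borel" and k: "AE z in lborel. k z = g z" "dominated A s t k"
  shows "g \<in> B_space s"
proof -
  have A: "0 \<le> A" by (rule dominated_nonneg[OF k(2)])
  have m: "(\<lambda>z. ennreal \<bar>g z\<bar>) \<in> borel_measurable lborel"
    "(\<lambda>z. ennreal \<bar>inverse (weight 0 s z) * g z\<bar>) \<in> borel_measurable lborel"
    using g weight_measurable by measurable
  have le: "flow_weight s t z \<le> weight 0 s z" for z
    by (cases z) (simp add: flow_weight_def weight_def)
  have "AE z in lborel. ennreal \<bar>g z\<bar> \<le> ennreal A"
    using k(1)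
  proof eventually_elim
    fix z assume "k z = g z"
    then show "ennreal \<bar>g z\<bar> \<le> ennreal A"
      using dominated_bounded[OF k(2) s, of z] by (intro ennreal_leI) simp
  qed
  with m(1) have 1: "Linf_norm g \<le> ennreal A"
    unfolding Linf_norm_def by (rule esssup_I)
  have "AE z in lborel. ennreal \<bar>inverse (weight 0 s z) * g z\<bar> \<le> ennreal A"
    using k(1)
  proof eventually_elim
    fix z assume "k z = g z"
    then have "\<bar>g z\<bar> \<le> A * weight 0 s z"
      using dominatedD[OF k(2), of z] mult_left_mono[OF le A, of z] by simp
    then show "ennreal \<bar>inverse (weight 0 s z) * g z\<bar> \<le> ennreal A"
      using weight_pos[of 0 s z] by (intro ennreal_leI) (simp add: abs_mult field_simps)
  qed
  with m(2) have "B_norm s g \<le> ennreal A"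
    unfolding B_norm_def Linf_norm_def by (rule esssup_I)
  then show ?thesis using 1 g by (simp add: B_space_def Linf_def le_less_trans)
qed

context collision_cells begin

lemma cell_average_lipschitz:
  assumes G: "G \<in> borel_measurable borel" "flow_lipschitz L s t G" and s: "0 \<le> s"
  shows "dominated (exp 1 * L * partition_diameter P) s t (\<lambda>z. cell_average P G z - G z)"
  unfolding dominated_def
proof
  fix z :: phase
  obtain x v where z: "z = (x, v)" by (cases z)
  obtain l where x: "x \<in> P l" by (rule cell_cover)
  have d: "dominated L s t G" by (rule flow_lipschitz_dominated[OF G(2)])
  have L: "0 \<le> L" by (rule dominated_nonneg[OF d])
  have "\<bar>cell_average P G (x, v) - G (x, v)\<bar> \<le> exp 1 * L * partition_diameter P * flow_weight s t (x, v)"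
  proof (rule cell_average_near[OF G(1) dominated_bounded[OF d s] x])
    fix y assume "y \<in> P l"
    then have y: "norm (y - x) \<le> partition_diameter P" by (rule cell_dist[OF x])
    then have "exp (norm (y - x)) \<le> exp 1" using small by simp
    have "\<bar>G (x + (y - x), v) - G (x, v)\<bar> \<le> L * norm (y - x) * exp (norm (y - x)) * flow_weight s t (x, v)"
      using G(2) unfolding flow_lipschitz_def by blast
    also have "\<dots> \<le> L * partition_diameter P * exp 1 * flow_weight s t (x, v)"
      using y L \<open>exp (norm (y - x)) \<le> exp 1\<close> diameter_nonneg
      by (intro mult_mono mult_right_mono mult_left_mono) (auto simp: flow_weight_nonneg)
    finally show "\<bar>G (y, v) - G (x, v)\<bar> \<le> exp 1 * L * partition_diameter P * flow_weight s t (x, v)"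
      by (simp add: ac_simps)
  qed
  then show "\<bar>cell_average P G z - G z\<bar> \<le> exp 1 * L * partition_diameter P * flow_weight s t z"
    by (simp add: z)
qed

lemma J_cell_measurable: "g \<in> borel_measurable borel \<Longrightarrow> J_cell b P g \<in> borel_measurable borel"
  unfolding J_cell_def by (intro J_B_measurable cell_average_measurable)

lemma J_cell_cong_AE:
  assumes "g \<in> borel_measurable borel" "h \<in> borel_measurable borel" "AE z in lborel. g z = h z"
  shows "AE z in lborel. J_cell b P g z = J_cell b P h z"
  unfolding J_cell_def
  by (intro J_B_cong_AE assms cell_average_measurable cell_average_cong_AE)

lemma J_cell_dominated:
  assumes s: "0 < s" and g: "g \<in> borel_measurable borel" "dominated A s t g"
  shows "dominated (2 * exp 1 * A\<^sup>2 * mass s) s t (J_cell b P g)"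
proof -
  have "dominated (exp 1 * A) s t (cell_average P g)"
    by (rule cell_average_dominated[OF g]) (use s in simp)
  from J_B_dominated[OF s g(1) cell_average_measurable[OF g(1)] g(2) this]
  show ?thesis by (simp add: J_cell_def[abs_def] power2_eq_square ac_simps)
qed

lemma J_cell_diff_dominated:
  assumes s: "0 < s" and g: "g \<in> borel_measurable borel" "dominated A s t g"
    and h: "h \<in> borel_measurable borel" "dominated A s t h" and d: "dominated C s t (\<lambda>z. g z - h z)"
  shows "dominated (4 * exp 1 * A * mass s * C) s t (\<lambda>z. J_cell b P g z - J_cell b P h z)"
proof -
  have s0: "0 \<le> s" using s by simp
  from J_B_diff_dominated[OF s g(1) cell_average_measurable[OF g(1)] h(1) cell_average_measurable[OF h(1)]
      g(2) h(2) cell_average_dominated[OF g s0] cell_average_dominated[OF h s0] d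
      cell_average_diff_dominated[OF g h d s0]]
  show ?thesis by (simp add: J_cell_def algebra_simps)
qed

lemma J_cell_consistent:
  assumes s: "0 < s" and g: "g \<in> borel_measurable borel" "flow_lipschitz L s t g"
  shows "dominated (2 * exp 1 * L\<^sup>2 * mass s * partition_diameter P) s t (\<lambda>z. J_cell b P g z - J_B b g g z)"
proof -
  have s0: "0 \<le> s" using s by simp
  have d: "dominated L s t g" by (rule flow_lipschitz_dominated[OF g(2)])
  have "1 * L \<le> exp 1 * L" using dominated_nonneg[OF d] by (intro mult_right_mono) auto
  then have d': "dominated (exp 1 * L) s t g" using dominated_mono[OF d] by simp
  have z: "dominated 0 s t (\<lambda>z. g z - g z)" by (simp add: dominated_def)
  from J_B_diff_dominated[OF s g(1) cell_average_measurable[OF g(1)] g(1) g(1) d d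
      cell_average_dominated[OF g(1) d s0] d' z cell_average_lipschitz[OF g s0]]
  show ?thesis by (simp add: J_cell_def power2_eq_square algebra_simps)
qed

end

text \<open>
  \<open>F t\<close> is the Lipschitz representative of the solution \<open>f t\<close>. The condition \<open>stable\<close> keeps the scheme
  positive, and \<open>close\<close> keeps it within distance \<open>1\<close> of the solution, so that the iterates satisfy the bound
  \<open>L + 1\<close> as long as the solution satisfies the bound \<open>L\<close>.
\<close>

locale discrete_solution = collision_cells b b0 lam P for b b0 lam P +
  fixes s s1 L T dt :: real and f0 :: "phase \<Rightarrow> real" and f F :: "real \<Rightarrow> phase \<Rightarrow> real"
  assumes s: "0 < s" "s < s1" and T: "0 < T" and dt: "0 < dt" "dt \<le> 1"
    and mild: "mild_solution b T f0 f"
    and F: "\<And>t. t \<in> {0..T} \<Longrightarrow>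
      F t \<in> borel_measurable borel \<and> (AE z in lborel. F t z = f t z) \<and> flow_lipschitz L s1 t (F t)"
    and F_initial_nonneg: "\<And>z. 0 \<le> F 0 z"
    and stable: "dt * (exp 1 * (L + 1) * mass s) \<le> 1"
    and close: "(commutator_const s s1 (3 * L + production_const s1 L) * dt
        + 2 * exp 1 * L\<^sup>2 * mass s * partition_diameter P)
      * (T * exp (4 * exp 1 * (L + 1) * mass s * T)) \<le> 1"
begin

abbreviation "A \<equiv> L + 1"
abbreviation "\<kappa> \<equiv> 4 * exp 1 * A * mass s"
abbreviation "K_time \<equiv> commutator_const s s1 (3 * L + production_const s1 L)"
abbreviation "K_space \<equiv> 2 * exp 1 * L\<^sup>2 * mass s"
abbreviation "\<eta> \<equiv> K_time * dt + K_space * partition_diameter P"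
abbreviation "f_dt \<equiv> scheme b P dt f0"

lemma L_nonneg: "0 \<le> L"
proof -
  have "0 \<in> {0..T}" using T by simp
  from F[OF this] show ?thesis using dominated_nonneg[OF flow_lipschitz_dominated, of L s1 0 "F 0"] by blast
qed

lemma const_nonneg: "0 \<le> \<kappa>" "0 \<le> K_time" "0 \<le> K_space" "0 \<le> \<eta>"
proof -
  show k: "0 \<le> \<kappa>" "0 \<le> K_time" "0 \<le> K_space"
    using L_nonneg by (simp_all add: mass_nonneg commutator_factor_def)
  show "0 \<le> \<eta>" using k dt diameter_nonneg by simp
qed

definition step :: "(phase \<Rightarrow> real) \<Rightarrow> phase \<Rightarrow> real" where
  "step g z = free_flow dt g z + dt * J_cell b P (free_flow dt g) z"

lemma scheme_Suc: "f_dt (Suc n) = step (f_dt n)"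
  by (rule ext) (simp add: step_def)

lemma step_measurable: "g \<in> borel_measurable borel \<Longrightarrow> step g \<in> borel_measurable borel"
  unfolding step_def[abs_def]
  by (intro borel_measurable_add borel_measurable_times borel_measurable_const J_cell_measurable measurable_free_flow)

lemma scheme_measurable: "f_dt n \<in> borel_measurable borel"
proof (induction n)
  case 0
  show ?case using mild by (simp add: mild_solution_def L1_measurable)
next
  case (Suc n)
  then show ?case unfolding scheme_Suc by (rule step_measurable)
qed

lemma step_cong_AE:
  assumes g: "g \<in> borel_measurable borel" and h: "h \<in> borel_measurable borel" and eq: "AE z in lborel. g z = h z"
  shows "AE z in lborel. step g z = step h z"
  using free_flow_cong_AE[OF assms, of dt]
    J_cell_cong_AE[OF measurable_free_flow[OF g] measurable_free_flow[OF h] free_flow_cong_AE[OF assms], of dt]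
  by eventually_elim (simp add: step_def)

text \<open>
  Since \<open>g\<close> is within distance \<open>1\<close> of the solution, the quadratic collision operator acts on it like a
  Lipschitz map. The three contributions are the propagated error, the averaging error and the local error
  of the solution.
\<close>

lemma step_error:
  assumes t: "0 \<le> t" "t + dt \<le> T" and g: "g \<in> borel_measurable borel" and \<epsilon>: "0 \<le> \<epsilon>" "\<epsilon> \<le> 1"
    and err: "AE z in lborel. \<bar>g z - F t z\<bar> \<le> \<epsilon> * flow_weight s t z"
  shows "AE z in lborel. \<bar>step g z - F (t + dt) z\<bar> \<le> ((1 + \<kappa> * dt) * \<epsilon> + dt * \<eta>) * flow_weight s (t + dt) z"
proof -
  have s1: "s \<le> s1" "0 < s1" using s by simp_all
  have "t \<in> {0..T}" using t dt by simp
  note Ft = F[OF this]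
  have Fm [measurable]: "F t \<in> borel_measurable borel" using Ft by blast
  have Fl: "flow_lipschitz L s1 t (F t)" using Ft by blast
  let ?U = "free_flow dt (F t)"
  have Um: "?U \<in> borel_measurable borel" by (rule measurable_free_flow[OF Fm])
  have Ul1: "flow_lipschitz L s1 (t + dt) ?U" by (rule flow_lipschitz_free_flow[OF Fl])
  have Ul: "flow_lipschitz L s (t + dt) ?U"
    unfolding flow_lipschitz_def
  proof (intro conjI allI)
    show "dominated L s (t + dt) ?U" by (rule dominated_mono_weight[OF flow_lipschitz_dominated[OF Ul1] s1(1)])
    fix x y v
    have "\<bar>?U (x + y, v) - ?U (x, v)\<bar> \<le> L * norm y * exp (norm y) * flow_weight s1 (t + dt) (x, v)"
      using Ul1 by (simp add: flow_lipschitz_def)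
    also have "\<dots> \<le> L * norm y * exp (norm y) * flow_weight s (t + dt) (x, v)"
      using L_nonneg by (intro mult_left_mono flow_weight_mono s1) auto
    finally show "\<bar>?U (x + y, v) - ?U (x, v)\<bar> \<le> L * norm y * exp (norm y) * flow_weight s (t + dt) (x, v)" .
  qed
  (* Changing g on a null set makes the hypothesis hold everywhere. *)
  define k where "k z = max (F t z - \<epsilon> * flow_weight s t z) (min (F t z + \<epsilon> * flow_weight s t z) (g z))" for z
  have km: "k \<in> borel_measurable borel" unfolding k_def[abs_def] using g by measurable
  have e0: "0 \<le> \<epsilon> * flow_weight s t z" for z using \<epsilon> by (simp add: flow_weight_nonneg)
  have kd: "dominated \<epsilon> s t (\<lambda>z. k z - F t z)"
    unfolding dominated_def using e0 by (auto simp: k_def max_def min_def abs_le_iff)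
  have kg: "AE z in lborel. g z = k z"
    using err by eventually_elim (auto simp: k_def max_def min_def)
  let ?K = "free_flow dt k"
  have Km: "?K \<in> borel_measurable borel" by (rule measurable_free_flow[OF km])
  have Kd: "dominated \<epsilon> s (t + dt) (\<lambda>z. ?K z - ?U z)"
    using dominated_free_flow[OF kd, of dt] by (simp add: free_flow_alt[abs_def])
  have UA: "dominated A s (t + dt) ?U"
    by (rule dominated_mono[OF flow_lipschitz_dominated[OF Ul]]) simp
  have KA: "dominated A s (t + dt) ?K"
    by (rule dominated_mono[OF dominated_diff_mono[OF flow_lipschitz_dominated[OF Ul] Kd]]) (use \<epsilon> in simp)
  note 1 = J_cell_diff_dominated[OF s(1) Km KA Um UA Kd]
  note 2 = J_cell_consistent[OF s(1) Um Ul]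
  have "AE z in lborel. \<bar>F (t + dt) z - ?U z - dt * J_B b ?U ?U z\<bar> \<le> dt * (dt * K_time) * flow_weight s (t + dt) z"
    by (rule solution_local_error[OF mild s F t(1) less_imp_le[OF dt(1)] dt(2) t(2)])
  with step_cong_AE[OF g km kg] show ?thesis
  proof eventually_elim
    fix z
    let ?W = "flow_weight s (t + dt) z"
    assume sk: "step g z = step k z"
      and le: "\<bar>F (t + dt) z - ?U z - dt * J_B b ?U ?U z\<bar> \<le> dt * (dt * K_time) * ?W"
    have "step g z - F (t + dt) z = (?K z - ?U z) + dt * (J_cell b P ?K z - J_cell b P ?U z)
        + dt * (J_cell b P ?U z - J_B b ?U ?U z) - (F (t + dt) z - ?U z - dt * J_B b ?U ?U z)"
      unfolding sk unfolding step_def by (simp add: algebra_simps)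
    moreover have "\<bar>dt * (J_cell b P ?K z - J_cell b P ?U z)\<bar> \<le> dt * (\<kappa> * \<epsilon> * ?W)"
      unfolding abs_mult using dominatedD[OF 1, of z] dt by (simp add: mult_left_mono)
    moreover have "\<bar>dt * (J_cell b P ?U z - J_B b ?U ?U z)\<bar> \<le> dt * (K_space * partition_diameter P * ?W)"
      unfolding abs_mult using dominatedD[OF 2, of z] dt by (simp add: mult_left_mono)
    moreover have "\<bar>?K z - ?U z\<bar> \<le> \<epsilon> * ?W" by (rule dominatedD[OF Kd])
    ultimately have "\<bar>step g z - F (t + dt) z\<bar> \<le> \<epsilon> * ?W + dt * (\<kappa> * \<epsilon> * ?W)
        + dt * (K_space * partition_diameter P * ?W) + dt * (dt * K_time) * ?W"
      using le by linarith
    also have "\<dots> = ((1 + \<kappa> * dt) * \<epsilon> + dt * \<eta>) * ?W" by (simp add: algebra_simps)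
    finally show "\<bar>step g z - F (t + dt) z\<bar> \<le> ((1 + \<kappa> * dt) * \<epsilon> + dt * \<eta>) * ?W" .
  qed
qed

text \<open>
  A majorant of the recursion for the error; the exponential factor makes up for the growth by
  \<open>1 + \<kappa> dt\<close> in each step.
\<close>

definition error :: "nat \<Rightarrow> real" where
  "error n = \<eta> * (real n * dt * exp (\<kappa> * (real n * dt)))"

lemma error_nonneg: "0 \<le> error n"
  using const_nonneg dt by (simp add: error_def)

lemma error_le:
  assumes "real n * dt \<le> T"
  shows "error n \<le> \<eta> * (T * exp (\<kappa> * T))"
proof -
  have "\<kappa> * (real n * dt) \<le> \<kappa> * T" by (rule mult_left_mono[OF assms const_nonneg(1)])
  then have "real n * dt * exp (\<kappa> * (real n * dt)) \<le> T * exp (\<kappa> * T)"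
    using assms T by (intro mult_mono) simp_all
  then show ?thesis unfolding error_def by (rule mult_left_mono[OF _ const_nonneg(4)])
qed

lemma error_Suc: "(1 + \<kappa> * dt) * error n + dt * \<eta> \<le> error (Suc n)"
proof -
  let ?E = "exp (\<kappa> * (real n * dt))"
  have "(1 + \<kappa> * dt) * (real n * dt * ?E) + dt \<le> exp (\<kappa> * dt) * (real n * dt * ?E) + dt * (exp (\<kappa> * dt) * ?E)"
  proof (intro add_mono mult_right_mono)
    show "1 + \<kappa> * dt \<le> exp (\<kappa> * dt)" by (rule exp_ge_add_one_self)
    have "0 \<le> \<kappa> * dt" "0 \<le> \<kappa> * (real n * dt)" using const_nonneg(1) dt by (simp_all only: mult_nonneg_nonneg of_nat_0_le_iff less_imp_le)
    then have "dt * 1 \<le> dt * exp (\<kappa> * dt + \<kappa> * (real n * dt))" using dt by (intro mult_left_mono) auto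
    then show "dt \<le> dt * (exp (\<kappa> * dt) * ?E)" by (simp add: exp_add)
  qed (use dt in auto)
  also have "\<dots> = real (Suc n) * dt * exp (\<kappa> * (real (Suc n) * dt))"
    by (simp add: algebra_simps exp_add)
  finally have "\<eta> * ((1 + \<kappa> * dt) * (real n * dt * ?E) + dt) \<le> error (Suc n)"
    unfolding error_def by (rule mult_left_mono[OF _ const_nonneg(4)])
  then show ?thesis by (simp add: error_def algebra_simps)
qed

text \<open>
  The quadratic growth of the collision operator alone would only bound the iterates for a short time. The
  induction works up to time \<open>T\<close> because the bound on the error keeps them within distance \<open>1\<close> of the solution,
  which is the hypothesis of \<open>step_error\<close>.
\<close>

lemma scheme_error:
  assumes "real n * dt \<le> T"
  shows "AE z in lborel. \<bar>f_dt n z - F (real n * dt) z\<bar> \<le> error n * flow_weight s (real n * dt) z"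
  using assms
proof (induction n)
  case 0
  have "AE z in lborel. f 0 z = f0 z" by (rule mild_solution_initial[OF mild less_imp_le[OF T]])
  moreover have "AE z in lborel. F 0 z = f 0 z" using F[of 0] T by simp
  ultimately show ?case by eventually_elim (simp add: error_def)
next
  case (Suc n)
  have le: "real n * dt \<le> T" "real n * dt + dt \<le> T" using Suc.prems dt by (simp_all add: algebra_simps)
  have "error n \<le> 1" using error_le[OF le(1)] close by linarith
  from step_error[OF _ le(2) scheme_measurable error_nonneg this Suc.IH[OF le(1)]] dt
  have "AE z in lborel. \<bar>f_dt (Suc n) z - F (real n * dt + dt) z\<bar>
      \<le> ((1 + \<kappa> * dt) * error n + dt * \<eta>) * flow_weight s (real n * dt + dt) z"
    unfolding scheme_Suc by simp
  then show ?case
  proof eventually_elim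
    fix z assume "\<bar>f_dt (Suc n) z - F (real n * dt + dt) z\<bar>
        \<le> ((1 + \<kappa> * dt) * error n + dt * \<eta>) * flow_weight s (real n * dt + dt) z"
    also have "\<dots> \<le> error (Suc n) * flow_weight s (real n * dt + dt) z"
      by (rule mult_right_mono[OF error_Suc flow_weight_nonneg])
    finally show "\<bar>f_dt (Suc n) z - F (real (Suc n) * dt) z\<bar> \<le> error (Suc n) * flow_weight s (real (Suc n) * dt) z"
      by (simp add: algebra_simps)
  qed
qed

definition pos_representative :: "real \<Rightarrow> (phase \<Rightarrow> real) \<Rightarrow> (phase \<Rightarrow> real) \<Rightarrow> bool" where
  "pos_representative t g k \<longleftrightarrow> k \<in> borel_measurable borel \<and> (AE z in lborel. g z = k z) \<and>
     dominated A s t k \<and> (\<forall>z. 0 \<le> k z)"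

text \<open>
  The bound on the time step makes the loss term of one step at most the transported density.
\<close>

lemma step_nonneg:
  assumes k: "k \<in> borel_measurable borel" "dominated A s t k" "\<And>z. 0 \<le> k z"
  shows "0 \<le> step k z"
proof -
  let ?K = "free_flow dt k"
  have m: "?K \<in> borel_measurable borel" by (rule measurable_free_flow[OF k(1)])
  have d: "dominated A s (t + dt) ?K" by (rule dominated_free_flow[OF k(2)])
  have s0: "0 \<le> s" using s by simp
  have nn: "0 \<le> ?K z" for z using k(3) by (simp add: free_flow_alt)
  have "- (exp 1 * A * mass s * ?K z) \<le> J_cell b P ?K z"
    unfolding J_cell_def
    by (rule J_B_lower_bound[OF s(1) m cell_average_measurable[OF m] d cell_average_dominated[OF m d s0]])
      (use nn cell_average_nonneg in auto)
  then have "dt * - (exp 1 * A * mass s * ?K z) \<le> dt * J_cell b P ?K z" using dt by (intro mult_left_mono) auto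
  moreover have "dt * (exp 1 * A * mass s) * ?K z \<le> 1 * ?K z" by (rule mult_right_mono[OF stable nn])
  ultimately show ?thesis by (simp add: step_def algebra_simps)
qed

lemma step_dominated:
  assumes k: "k \<in> borel_measurable borel" "dominated A s t k"
  shows "dominated (A + dt * (2 * exp 1 * A\<^sup>2 * mass s)) s (t + dt) (step k)"
  unfolding step_def[abs_def] using dt
  by (intro dominated_add dominated_scale dominated_free_flow k J_cell_dominated s measurable_free_flow) auto

lemma step_conservation:
  assumes k: "k \<in> borel_measurable borel" "dominated A s t k"
  shows "(LINT z|lborel. invariant i (snd z) * step k z) = (LINT z|lborel. invariant i (snd z) * k z)"
proof -
  let ?K = "free_flow dt k"
  have m: "?K \<in> borel_measurable borel" by (rule measurable_free_flow[OF k(1)])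
  have d: "dominated A s (t + dt) ?K" by (rule dominated_free_flow[OF k(2)])
  have I: "integrable lborel (\<lambda>z. invariant i (snd z) * g z)"
    if "g \<in> borel_measurable borel" "dominated B s r g" for g B r
    by (rule dominated_integrable(1)[OF _ invariant_product_measurable[OF that(1)] invariant_dominated[OF s(1) that(2)]])
      (use s in simp)
  have iJ: "integrable lborel (\<lambda>z. invariant i (snd z) * J_cell b P ?K z)"
    by (rule I[OF J_cell_measurable[OF m] J_cell_dominated[OF s(1) m d]])
  have "(LINT z|lborel. invariant i (snd z) * step k z)
      = (LINT z|lborel. invariant i (snd z) * ?K z + dt * (invariant i (snd z) * J_cell b P ?K z))"
    by (rule Bochner_Integration.integral_cong[OF refl]) (simp add: step_def algebra_simps)
  also have "\<dots> = (LINT z|lborel. invariant i (snd z) * ?K z) + dt * (LINT z|lborel. invariant i (snd z) * J_cell b P ?K z)"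
    using I[OF m d] iJ by simp
  also have "(LINT z|lborel. invariant i (snd z) * J_cell b P ?K z) = 0"
    by (rule J_cell_conservation[OF s(1) m d])
  also have "(LINT z|lborel. invariant i (snd z) * ?K z) = (LINT z|lborel. invariant i (snd z) * k z)"
    by (rule integral_free_flow[OF k(1) I[OF k] I[OF m d]])
  finally show ?thesis by simp
qed

text \<open>
  Positivity and the bound hold a.e.; truncating an iterate yields a function that has these properties
  everywhere, as the estimates of the next step require.
\<close>

lemma scheme_pos_representative:
  assumes "real n * dt \<le> T"
  shows "\<exists>k. pos_representative (real n * dt) (f_dt n) k"
proof -
  have bound: "AE z in lborel. \<bar>f_dt n z\<bar> \<le> A * flow_weight s (real n * dt) z" if n: "real n * dt \<le> T" for n
  proof -
    have t: "real n * dt \<in> {0..T}" using n dt by simp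
    have "dominated L s1 (real n * dt) (F (real n * dt))"
      using F[OF t] flow_lipschitz_dominated by blast
    then have d: "dominated L s (real n * dt) (F (real n * dt))"
      by (rule dominated_mono_weight) (use s in simp)
    have "error n \<le> 1" using error_le[OF n] close by linarith
    then have e: "error n * flow_weight s (real n * dt) z \<le> 1 * flow_weight s (real n * dt) z" for z
      by (rule mult_right_mono[OF _ flow_weight_nonneg])
    from scheme_error[OF n] show ?thesis
    proof eventually_elim
      fix z assume "\<bar>f_dt n z - F (real n * dt) z\<bar> \<le> error n * flow_weight s (real n * dt) z"
      then show "\<bar>f_dt n z\<bar> \<le> A * flow_weight s (real n * dt) z"
        using e[of z] dominatedD[OF d, of z] by (simp add: algebra_simps)
    qed
  qed
  have rep: "\<exists>k. pos_representative (real n * dt) (f_dt n) k"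
    if n: "real n * dt \<le> T" and nn: "AE z in lborel. 0 \<le> f_dt n z" for n
  proof -
    define k where "k z = max 0 (min (A * flow_weight s (real n * dt) z) (f_dt n z))" for z
    have W: "0 \<le> A * flow_weight s (real n * dt) z" for z using L_nonneg by (simp add: flow_weight_nonneg)
    have "k \<in> borel_measurable borel" unfolding k_def[abs_def] using scheme_measurable by measurable
    moreover have "AE z in lborel. f_dt n z = k z"
      using nn bound[OF n] by eventually_elim (auto simp: k_def max_def min_def)
    moreover have "dominated A s (real n * dt) k" "0 \<le> k z" for z
      using W by (auto simp: dominated_def k_def max_def min_def)
    ultimately have "pos_representative (real n * dt) (f_dt n) k" by (simp add: pos_representative_def)
    then show ?thesis by blast
  qed
  from assms show ?thesis
  proof (induction n)
    case 0
    have "AE z in lborel. f 0 z = f0 z" by (rule mild_solution_initial[OF mild less_imp_le[OF T]])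
    moreover have "AE z in lborel. F 0 z = f 0 z" using F[of 0] T by simp
    ultimately have "AE z in lborel. 0 \<le> f_dt 0 z"
    proof eventually_elim
      fix z assume "f 0 z = f0 z" "F 0 z = f 0 z"
      then show "0 \<le> f_dt 0 z" using F_initial_nonneg[of z] by simp
    qed
    with 0 show ?case by (rule rep)
  next
    case (Suc n)
    have "real n * dt \<le> T" using Suc.prems dt by (simp add: algebra_simps)
    from Suc.IH[OF this] obtain k where k: "k \<in> borel_measurable borel" "AE z in lborel. f_dt n z = k z"
      "dominated A s (real n * dt) k" "\<And>z. 0 \<le> k z" by (auto simp: pos_representative_def)
    have "AE z in lborel. 0 \<le> f_dt (Suc n) z"
      using step_cong_AE[OF scheme_measurable k(1,2)] unfolding scheme_Suc
      by eventually_elim (simp add: step_nonneg[OF k(1,3,4)])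
    with Suc.prems show ?case by (rule rep)
  qed
qed

text \<open>
  Only the time before the last step has to lie in \<open>[0, T]\<close>: the final iterate may belong to a time beyond
  \<open>T\<close>, at which no solution is given to compare it with.
\<close>

lemma scheme_Suc_properties:
  assumes "real n * dt \<le> T"
  shows "f_dt (Suc n) \<in> L1_pos \<inter> B_space s"
    and "integrable lborel (\<lambda>z. invariant i (snd z) * f_dt (Suc n) z)"
    and "(LINT z|lborel. invariant i (snd z) * f_dt (Suc n) z) = (LINT z|lborel. invariant i (snd z) * f_dt n z)"
proof -
  from scheme_pos_representative[OF assms] obtain k where k: "k \<in> borel_measurable borel" "AE z in lborel. f_dt n z = k z"
    "dominated A s (real n * dt) k" "\<And>z. 0 \<le> k z" by (auto simp: pos_representative_def)
  have eq: "AE z in lborel. f_dt (Suc n) z = step k z"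
    unfolding scheme_Suc by (rule step_cong_AE[OF scheme_measurable k(1,2)])
  note d = step_dominated[OF k(1,3)] and m = step_measurable[OF k(1)]
  have cong: "(integrable lborel (\<lambda>z. \<psi> z * f_dt (Suc n) z) \<longleftrightarrow> integrable lborel (\<lambda>z. \<psi> z * step k z)) \<and>
      (LINT z|lborel. \<psi> z * f_dt (Suc n) z) = (LINT z|lborel. \<psi> z * step k z)"
    if "\<psi> \<in> borel_measurable borel" for \<psi>
    using eq that m scheme_measurable[of "Suc n"]
    by (intro conjI integrable_cong_AE integral_cong_AE) (auto intro!: borel_measurable_times simp del: scheme.simps)
  have inv: "(\<lambda>z::phase. invariant i (snd z)) \<in> borel_measurable borel"
    by (rule measurable_compose[OF measurable_snd_phase invariant_measurable])
  have "integrable lborel (step k)" by (rule dominated_integrable(1)[OF s(1) m d])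
  then have "integrable lborel (f_dt (Suc n))" using cong[of "\<lambda>z. 1"] by (simp del: scheme.simps)
  moreover have "AE z in lborel. 0 \<le> f_dt (Suc n) z"
    using eq by eventually_elim (simp add: step_nonneg[OF k(1,3,4)] del: scheme.simps)
  moreover have "f_dt (Suc n) \<in> B_space s"
  proof -
    have "AE z in lborel. step k z = f_dt (Suc n) z" using eq by eventually_elim (rule sym)
    from dominated_imp_B_space[OF less_imp_le[OF s(1)] scheme_measurable this d] show ?thesis .
  qed
  ultimately show "f_dt (Suc n) \<in> L1_pos \<inter> B_space s"
    by (simp add: L1_pos_def L1_def del: scheme.simps)
  show "integrable lborel (\<lambda>z. invariant i (snd z) * f_dt (Suc n) z)"
    using cong[OF inv] dominated_integrable(1)[OF _ invariant_product_measurable[OF m] invariant_dominated[OF s(1) d]] s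
    by (simp del: scheme.simps)
  have "(LINT z|lborel. invariant i (snd z) * f_dt (Suc n) z) = (LINT z|lborel. invariant i (snd z) * k z)"
    using cong[OF inv] step_conservation[OF k(1,3)] by (simp del: scheme.simps)
  also have "\<dots> = (LINT z|lborel. invariant i (snd z) * f_dt n z)"
    using k(2) by (intro integral_cong_AE)
      (auto intro!: borel_measurable_times inv k scheme_measurable elim!: eventually_mono)
  finally show "(LINT z|lborel. invariant i (snd z) * f_dt (Suc n) z) = (LINT z|lborel. invariant i (snd z) * f_dt n z)" .
qed

lemma scheme_conservation:
  assumes "real n * dt \<le> T"
  shows "(LINT z|lborel. invariant i (snd z) * f_dt (Suc n) z) = (LINT z|lborel. invariant i (snd z) * f0 z)"
  using assms
proof (induction n)
  case 0
  then show ?case using scheme_Suc_properties(3)[of 0 i] by simp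
next
  case (Suc n)
  then have "real n * dt \<le> T" using dt by (simp add: algebra_simps)
  from Suc.IH[OF this] scheme_Suc_properties(3)[OF Suc.prems, of i] show ?case by (simp del: scheme.simps)
qed

lemma L1_norm_AE_le:
  assumes ae: "AE z in lborel. \<bar>g z\<bar> \<le> a * flow_weight s t z + c * flow_weight s r z" and ac: "0 \<le> a" "0 \<le> c"
  shows "L1_norm g \<le> ennreal ((a + c) * weight_mass s)"
proof -
  have "L1_norm g \<le> (\<integral>\<^sup>+ z. ennreal a * ennreal (flow_weight s t z) + ennreal c * ennreal (flow_weight s r z) \<partial>lborel)"
    unfolding L1_norm_def
  proof (rule nn_integral_mono_AE)
    from ae show "AE z in lborel. ennreal \<bar>g z\<bar> \<le> ennreal a * ennreal (flow_weight s t z) + ennreal c * ennreal (flow_weight s r z)"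
    proof eventually_elim
      fix z assume "\<bar>g z\<bar> \<le> a * flow_weight s t z + c * flow_weight s r z"
      then have "ennreal \<bar>g z\<bar> \<le> ennreal (a * flow_weight s t z + c * flow_weight s r z)" by (rule ennreal_leI)
      then show "ennreal \<bar>g z\<bar> \<le> ennreal a * ennreal (flow_weight s t z) + ennreal c * ennreal (flow_weight s r z)"
        using ac by (simp add: flow_weight_nonneg ennreal_mult)
    qed
  qed
  also have "\<dots> = ennreal a * (\<integral>\<^sup>+ z. ennreal (flow_weight s t z) \<partial>lborel) + ennreal c * (\<integral>\<^sup>+ z. ennreal (flow_weight s r z) \<partial>lborel)"
    by (subst nn_integral_add) (simp_all add: nn_integral_cmult)
  also have "\<dots> = ennreal a * ennreal (weight_mass s) + ennreal c * ennreal (weight_mass s)"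
    by (simp only: nn_integral_flow_weight[OF s(1)])
  also have "\<dots> = ennreal ((a + c) * weight_mass s)"
    using ac by (simp add: weight_mass_nonneg ennreal_mult distrib_right)
  finally show ?thesis .
qed

text \<open>
  On the interval that begins at \<open>n dt\<close> the approximation is the iterate with index \<open>n + 1\<close>. Compared with the
  error at \<open>n dt\<close>, it is off by one collision step and by the change of the solution over a time of at most \<open>dt\<close>,
  which includes the displacement by the free flow. As the error bound is a multiple of the weight, it can be
  integrated over the phase space.
\<close>

lemma scheme_L1_error:
  assumes n: "real n * dt \<le> t" "t \<le> real n * dt + dt" and t: "t \<le> T"
  shows "L1_norm (\<lambda>z. f_dt (Suc n) z - f t z)
    \<le> ennreal ((\<eta> * (T * exp (\<kappa> * T)) + dt * (2 * exp 1 * A\<^sup>2 * mass s)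
        + dt * (L * exp (1 / (s1 - s)) + production_const s1 L)) * weight_mass s)"
proof -
  let ?t = "real n * dt"
  have s1: "s \<le> s1" "0 < s1" using s by simp_all
  have tT: "?t \<le> T" "0 \<le> ?t" using n t dt by simp_all
  then have "?t \<in> {0..T}" by simp
  note Ft = F[OF this]
  have Fm: "F ?t \<in> borel_measurable borel" and Fl: "flow_lipschitz L s1 ?t (F ?t)" using Ft by blast+
  obtain k where k: "k \<in> borel_measurable borel" "AE z in lborel. f_dt n z = k z"
    "dominated A s ?t k" using scheme_pos_representative[OF tT(1)] by (auto simp: pos_representative_def)
  define q where "q = t - ?t"
  have q: "0 \<le> q" "q \<le> dt" "?t + q = t" using n by (auto simp: q_def)
  let ?a = "error n + dt * (2 * exp 1 * A\<^sup>2 * mass s)"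
  let ?c = "dt * (L * exp (1 / (s1 - s)) + production_const s1 L)"
  have pc: "0 \<le> production_const s1 L" by (simp add: mass_nonneg)
  have ac: "0 \<le> ?a" "0 \<le> ?c"
    using error_nonneg[of n] dt L_nonneg pc by (simp_all add: mass_nonneg)
  have J_bound: "dominated (2 * exp 1 * A\<^sup>2 * mass s) s (?t + dt) (J_cell b P (free_flow dt k))"
    by (rule J_cell_dominated[OF s(1) measurable_free_flow[OF k(1)] dominated_free_flow[OF k(3)]])
  have shift: "\<bar>free_flow dt (F ?t) z - free_flow q (F ?t) z\<bar> \<le> dt * (L * exp (1 / (s1 - s))) * flow_weight s t z" for z
  proof -
    obtain x v where z: "z = (x, v)" by (cases z)
    let ?y = "- ((dt - q) *\<^sub>R v)"
    have y: "norm ?y \<le> dt * norm v" using q by (simp add: mult_right_mono)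
    have "dt * norm v \<le> norm v" using dt by (simp add: mult_left_le_one_le)
    then have y': "norm ?y \<le> norm v" using y by linarith
    have "\<bar>F ?t ((x - q *\<^sub>R v) + ?y, v) - F ?t (x - q *\<^sub>R v, v)\<bar>
        \<le> L * norm ?y * exp (norm ?y) * flow_weight s1 ?t (x - q *\<^sub>R v, v)"
      using Fl unfolding flow_lipschitz_def by blast
    also have "\<dots> = L * norm ?y * exp (norm ?y) * flow_weight s1 t (x, v)"
      by (simp only: flow_weight_free_flow q(3))
    also have "\<dots> \<le> L * (dt * norm v) * exp (norm v) * flow_weight s1 t (x, v)"
      using y y' L_nonneg dt by (intro mult_mono mult_right_mono mult_left_mono) (auto simp: flow_weight_nonneg)
    also have "\<dots> = dt * L * ((norm v * exp (norm v)) * flow_weight s1 t (x, v))" by simp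
    also have "\<dots> \<le> dt * L * (exp (2 * norm v) * flow_weight s1 t (x, v))"
      using dt L_nonneg by (intro mult_left_mono mult_right_mono mult_exp_le) (auto simp: flow_weight_nonneg)
    also have "\<dots> \<le> dt * L * (exp (1 / (s1 - s)) * flow_weight s t (x, v))"
    proof (rule mult_left_mono)
      have "2 * norm v \<le> (s1 - s) * (v \<bullet> v) + 1 / (s1 - s)"
      proof -
        have q: "2\<^sup>2 / (4 * d) = 1 / d" for d :: real by simp
        have "0 < s1 - s" using s by simp
        from linear_le_quadratic[OF this, of 2 "norm v"] show ?thesis
          unfolding power2_norm_eq_inner q .
      qed
      then show "exp (2 * norm v) * flow_weight s1 t (x, v) \<le> exp (1 / (s1 - s)) * flow_weight s t (x, v)"
        by (simp add: flow_weight_def algebra_simps flip: exp_add)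
    qed (use dt L_nonneg in simp)
    finally show ?thesis by (simp add: z free_flow_apply algebra_simps)
  qed
  have "AE z in lborel. \<bar>F t z - free_flow (t - ?t) (F ?t) z\<bar> \<le> (t - ?t) * production_const s1 L * flow_weight s1 t z"
    by (rule solution_time_lipschitz[OF mild s1(2) F tT(2) n(1) t])
  moreover have "AE z in lborel. F t z = f t z" using F[of t] t n tT by auto
  moreover have "AE z in lborel. f_dt (Suc n) z = step k z"
    unfolding scheme_Suc by (rule step_cong_AE[OF scheme_measurable k(1,2)])
  moreover have "AE z in lborel. \<bar>free_flow dt k z - free_flow dt (F ?t) z\<bar> \<le> error n * flow_weight s (?t + dt) z"
  proof -
    have "Measurable.pred borel (\<lambda>z. \<bar>k z - F ?t z\<bar> \<le> error n * flow_weight s ?t z)"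
      using k(1) Fm by measurable
    moreover have "AE z in lborel. \<bar>k z - F ?t z\<bar> \<le> error n * flow_weight s ?t z"
      using scheme_error[OF tT(1)] k(2) by eventually_elim simp
    ultimately have "AE z in lborel. \<bar>k (fst z - dt *\<^sub>R snd z, snd z) - F ?t (fst z - dt *\<^sub>R snd z, snd z)\<bar>
        \<le> error n * flow_weight s ?t (fst z - dt *\<^sub>R snd z, snd z)"
      by (rule AE_free_flow)
    then show ?thesis by (simp add: free_flow_alt flow_weight_free_flow)
  qed
  ultimately have "AE z in lborel. \<bar>f_dt (Suc n) z - f t z\<bar> \<le> ?a * flow_weight s (?t + dt) z + ?c * flow_weight s t z"
  proof eventually_elim
    fix z
    let ?W = "flow_weight s (?t + dt) z" and ?V = "flow_weight s t z"
    assume 1: "\<bar>F t z - free_flow (t - ?t) (F ?t) z\<bar> \<le> (t - ?t) * production_const s1 L * flow_weight s1 t z"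
      and 2: "F t z = f t z" and 3: "f_dt (Suc n) z = step k z"
      and 4: "\<bar>free_flow dt k z - free_flow dt (F ?t) z\<bar> \<le> error n * ?W"
    have 5: "\<bar>dt * J_cell b P (free_flow dt k) z\<bar> \<le> dt * (2 * exp 1 * A\<^sup>2 * mass s * ?W)"
      unfolding abs_mult using dominatedD[OF J_bound, of z] dt by (simp add: mult_left_mono)
    have 6: "\<bar>F t z - free_flow q (F ?t) z\<bar> \<le> dt * production_const s1 L * ?V"
    proof -
      have "(t - ?t) * production_const s1 L * flow_weight s1 t z \<le> dt * production_const s1 L * ?V"
        using q pc by (intro mult_mono mult_right_mono flow_weight_mono s1) (auto simp: q_def flow_weight_nonneg)
      then show ?thesis using 1 by (simp add: q_def)
    qed
    have "\<bar>f_dt (Suc n) z - f t z\<bar> \<le> error n * ?W + dt * (2 * exp 1 * A\<^sup>2 * mass s * ?W)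
        + dt * (L * exp (1 / (s1 - s))) * ?V + dt * production_const s1 L * ?V"
      using 4 5 6 shift[of z] unfolding 3 2[symmetric] step_def by linarith
    also have "\<dots> = ?a * ?W + ?c * ?V" by (simp add: algebra_simps)
    finally show "\<bar>f_dt (Suc n) z - f t z\<bar> \<le> ?a * ?W + ?c * ?V" .
  qed
  from L1_norm_AE_le[OF this ac]
  have "L1_norm (\<lambda>z. f_dt (Suc n) z - f t z) \<le> ennreal ((?a + ?c) * weight_mass s)" .
  also have "\<dots> \<le> ennreal ((\<eta> * (T * exp (\<kappa> * T)) + dt * (2 * exp 1 * A\<^sup>2 * mass s) + ?c) * weight_mass s)"
    using error_le[OF tT(1)] by (intro ennreal_leI mult_right_mono weight_mass_nonneg) simp
  finally show ?thesis .
qed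

end

section \<open>The convergence theorem\<close>

lemma discrete_approx_eq_scheme:
  assumes dt: "0 < dt" and t: "0 \<le> t" "t \<le> T"
  shows "discrete_approx b P T dt f0 t = scheme b P dt f0 (Suc (nat \<lfloor>t / dt\<rfloor>))"
proof (rule ext)
  fix z
  define n where "n = nat \<lfloor>t / dt\<rfloor>"
  have n: "real n \<le> t / dt" "t / dt < real n + 1"
    using t dt by (simp_all add: n_def of_nat_nat)
  have ind: "indicator {(real j - 1) * dt..<real j * dt} t = (if j = Suc n then 1 else 0 :: real)" for j
  proof -
    have "t \<in> {(real j - 1) * dt..<real j * dt} \<longleftrightarrow> real j - 1 \<le> t / dt \<and> t / dt < real j"
      using dt by (simp add: pos_le_divide_eq pos_divide_less_eq)
    also have "\<dots> \<longleftrightarrow> j = Suc n"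
    proof
      assume "real j - 1 \<le> t / dt \<and> t / dt < real j"
      then have "real j < real n + 2" "real n < real j" using n by auto
      then show "j = Suc n" by linarith
    next
      assume "j = Suc n"
      then show "real j - 1 \<le> t / dt \<and> t / dt < real j" using n by auto
    qed
    finally show ?thesis by (simp only: indicator_def of_bool_def)
  qed
  have "n \<le> nat \<lfloor>T / dt\<rfloor>" unfolding n_def using t dt by (intro nat_mono floor_mono divide_right_mono) auto
  then have "Suc n \<in> {1..nat \<lfloor>T / dt\<rfloor> + 1}" by simp
  then have "(\<Sum>j = 1..nat \<lfloor>T / dt\<rfloor> + 1. if j = Suc n then scheme b P dt f0 j z else 0) = scheme b P dt f0 (Suc n) z"
    by (subst sum.delta) (simp_all del: scheme.simps)
  then show "discrete_approx b P T dt f0 t z = scheme b P dt f0 (Suc (nat \<lfloor>t / dt\<rfloor>)) z"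
    unfolding n_def[symmetric] discrete_approx_def ind by (simp del: scheme.simps add: if_distrib[of "\<lambda>c. c * _"] cong: if_cong)
qed

lemma le_inverse_imp_mult_le:
  fixes x a c :: real
  assumes "0 \<le> x" "0 \<le> a" "0 < c" "x \<le> 1 / (c * (a + 1))"
  shows "c * (x * a) \<le> 1"
proof -
  have "x * (c * (a + 1)) \<le> 1" using assms by (simp add: pos_le_divide_eq)
  moreover have "c * (x * a) \<le> x * (c * (a + 1))" using assms by (simp add: algebra_simps)
  ultimately show ?thesis by linarith
qed

theorem theorem1:
  fixes \<tau> T R M \<sigma> b0 lam :: real
  assumes "0 < \<tau>" and "0 < T" and "0 < R" and "0 < M"
    and "0 < b0" and "0 \<le> lam" and "lam < 2"
    and "0 < \<sigma>" and "\<sigma> < \<tau>"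
  shows "\<exists>Xs Ts K1 K2. 0 < Xs \<and> Xs < 1 \<and> 0 < Ts \<and> Ts < min 1 T \<and> 0 < K1 \<and> 0 < K2 \<and>
    (\<forall>(b :: real \<Rightarrow> real \<Rightarrow> real) (f0 :: phase \<Rightarrow> real) (f :: real \<Rightarrow> phase \<Rightarrow> real).
       collision_kernel b b0 lam \<and> mild_solution b T f0 f \<and> (\<forall>t\<in>{0..T}. f t \<in> M_set_pos \<tau> R M) \<longrightarrow>
       (\<forall>(dt :: real) (P :: nat \<Rightarrow> space3 set).
          0 < dt \<and> dt \<le> Ts \<and> cell_partition P \<and> 0 < partition_diameter P \<and> partition_diameter P \<le> Xs \<longrightarrow>
          (\<forall>t. 0 \<le> t \<and> t < T \<longrightarrow> discrete_approx b P T dt f0 t \<in> L1_pos \<inter> B_space \<sigma>) \<and>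
          (SUP t\<in>{0..T}. L1_norm (\<lambda>z. discrete_approx b P T dt f0 t z - f t z))
            \<le> ennreal (K1 * dt + K2 * partition_diameter P) \<and>
          (\<forall>t. 0 \<le> t \<and> t < T \<longrightarrow> (\<forall>i\<in>{0..4}.
             integrable lborel (\<lambda>(x, v). invariant i v * discrete_approx b P T dt f0 t (x, v)) \<and>
             (LINT (x, v)|lborel. invariant i v * discrete_approx b P T dt f0 t (x, v)) =
             (LINT (x, v)|lborel. invariant i v * f0 (x, v))))))"
proof -
  (* One half of the surplus of decay is used for the weight of the solution, the other for the commutator. *)
  define s1 where "s1 = (\<sigma> + \<tau>) / 2"
  have s1: "\<sigma> < s1" "s1 < \<tau>" using assms by (simp_all add: s1_def)
  define L where "L = (M + 2 * R) * exp (1 / (4 * \<tau>) + T\<^sup>2 / (4 * (\<tau> - s1)))"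
  have L: "0 < L" using assms by (simp add: L_def)
  define m where "m = collision_mass b0 lam \<sigma>"
  define C where "C = 2 * L * L * collision_mass b0 lam s1"
  have m: "0 \<le> m" "0 \<le> C"
    using assms L by (simp_all add: m_def C_def collision_mass_nonneg)
  define K_time where "K_time = commutator_factor m \<sigma> s1 (3 * L + C)"
  define K_space where "K_space = 2 * exp 1 * L\<^sup>2 * m"
  define N where "N = T * exp (4 * exp 1 * (L + 1) * m * T)"
  define D where "D = 2 * exp 1 * (L + 1)\<^sup>2 * m + (L * exp (1 / (s1 - \<sigma>)) + C)"
  define w where "w = weight_mass \<sigma>"
  have nn: "0 \<le> K_time" "0 \<le> K_space" "0 \<le> N" "0 \<le> D" "0 \<le> w"
    using assms L m by (simp_all add: K_time_def commutator_factor_def K_space_def N_def D_def w_def weight_mass_nonneg)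
  (* The last two bounds give positivity and one half of the condition that keeps the error below 1. *)
  define Ts where "Ts = min (min (1 / 2) (T / 2))
    (min (1 / (1 * (exp 1 * (L + 1) * m + 1))) (1 / (2 * (K_time * N + 1))))"
  define Xs where "Xs = min (1 / 2) (1 / (2 * (K_space * N + 1)))"
  (* Adding 1 only makes the constants positive. *)
  define K1 where "K1 = (K_time * N + D) * w + 1"
  define K2 where "K2 = K_space * N * w + 1"
  have pos: "0 < exp 1 * (L + 1) * m + 1" "0 < K_time * N + 1" "0 < K_space * N + 1"
    using L m nn by (simp_all add: add_nonneg_pos)
  have thresholds: "0 < Xs" "Xs < 1" "0 < Ts" "Ts < min 1 T" "0 < K1" "0 < K2"
    using pos assms nn by (auto simp: Xs_def Ts_def K1_def K2_def min_def add_nonneg_pos)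
  have main: "(\<forall>t. 0 \<le> t \<and> t < T \<longrightarrow> discrete_approx b P T dt f0 t \<in> L1_pos \<inter> B_space \<sigma>) \<and>
      (SUP t\<in>{0..T}. L1_norm (\<lambda>z. discrete_approx b P T dt f0 t z - f t z))
        \<le> ennreal (K1 * dt + K2 * partition_diameter P) \<and>
      (\<forall>t. 0 \<le> t \<and> t < T \<longrightarrow> (\<forall>i\<in>{0..4}.
         integrable lborel (\<lambda>(x, v). invariant i v * discrete_approx b P T dt f0 t (x, v)) \<and>
         (LINT (x, v)|lborel. invariant i v * discrete_approx b P T dt f0 t (x, v)) =
         (LINT (x, v)|lborel. invariant i v * f0 (x, v))))"
    if b: "collision_kernel b b0 lam" and mild: "mild_solution b T f0 f"
      and fM: "\<forall>t\<in>{0..T}. f t \<in> M_set_pos \<tau> R M"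
      and dt: "0 < dt" "dt \<le> Ts" and P: "cell_partition P" "partition_diameter P \<le> Xs"
    for b f0 f dt P
  proof -
    have "\<exists>G. G \<in> borel_measurable borel \<and> (AE z in lborel. G z = f t z) \<and> flow_lipschitz L s1 t G \<and> (\<forall>z. 0 \<le> G z)"
      if t: "t \<in> {0..T}" for t
    proof -
      have ft: "f t \<in> M_set_pos \<tau> R M" using fM t by (rule bspec)
      obtain G where G: "G \<in> borel_measurable borel" "AE z in lborel. G z = f t z"
        "\<And>z. 0 \<le> G z" "\<And>z. G z \<le> R * weight \<tau> \<tau> z"
        "\<And>x y v. norm y < 1 \<Longrightarrow> \<bar>G (x + y, v) - G (x, v)\<bar> \<le> M * norm y * weight \<tau> \<tau> (x, v)"
        by (rule M_set_pos_representative[OF assms(1,3,4) ft]) blast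
      have "flow_lipschitz L s1 t G"
        unfolding L_def by (rule representative_flow_lipschitz[OF s1(2) assms(1) _ _ _ _ G(3-5)]) (use t assms in auto)
      with G show ?thesis by blast
    qed
    then have "\<forall>t\<in>{0..T}. \<exists>G. G \<in> borel_measurable borel \<and> (AE z in lborel. G z = f t z) \<and> flow_lipschitz L s1 t G \<and> (\<forall>z. 0 \<le> G z)"
      by blast
    from bchoice[OF this] obtain F where F: "\<forall>t\<in>{0..T}. F t \<in> borel_measurable borel \<and>
        (AE z in lborel. F t z = f t z) \<and> flow_lipschitz L s1 t (F t) \<and> (\<forall>z. 0 \<le> F t z)" by blast
    interpret cells P
      using P by unfold_locales (auto simp: Xs_def)
    interpret discrete_solution b b0 lam P \<sigma> s1 L T dt f0 f F
    proof unfold_locales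
      show "dt * (exp 1 * (L + 1) * collision_mass b0 lam \<sigma>) \<le> 1"
        using le_inverse_imp_mult_le[of dt "exp 1 * (L + 1) * m" 1] dt L m by (simp add: Ts_def m_def)
      have "2 * (dt * (K_time * N)) \<le> 1"
        by (rule le_inverse_imp_mult_le) (use dt nn in \<open>auto simp: Ts_def\<close>)
      moreover have "2 * (partition_diameter P * (K_space * N)) \<le> 1"
        by (rule le_inverse_imp_mult_le) (use P nn diameter_nonneg in \<open>auto simp: Xs_def\<close>)
      ultimately have "(K_time * dt + K_space * partition_diameter P) * N \<le> 1"
        by (simp add: algebra_simps)
      then show "(commutator_factor (collision_mass b0 lam \<sigma>) \<sigma> s1 (3 * L + 2 * L * L * collision_mass b0 lam s1) * dt
          + 2 * exp 1 * L\<^sup>2 * collision_mass b0 lam \<sigma> * partition_diameter P)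
          * (T * exp (4 * exp 1 * (L + 1) * collision_mass b0 lam \<sigma> * T)) \<le> 1"
        by (simp only: K_time_def K_space_def N_def C_def m_def)
      show "F t \<in> borel_measurable borel \<and> (AE z in lborel. F t z = f t z) \<and> flow_lipschitz L s1 t (F t)"
        if "t \<in> {0..T}" for t using F that by blast
      have "0 \<in> {0..T}" using assms(2) by simp
      with F show "0 \<le> F 0 z" for z by blast
    qed (use b mild dt assms s1 in \<open>auto simp: Ts_def\<close>)
    have eq: "discrete_approx b P T dt f0 t = scheme b P dt f0 (Suc (nat \<lfloor>t / dt\<rfloor>))"
      and le: "real (nat \<lfloor>t / dt\<rfloor>) * dt \<le> t" "t \<le> real (nat \<lfloor>t / dt\<rfloor>) * dt + dt" if "0 \<le> t" "t \<le> T" for t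
    proof -
      show "discrete_approx b P T dt f0 t = scheme b P dt f0 (Suc (nat \<lfloor>t / dt\<rfloor>))"
        by (rule discrete_approx_eq_scheme[OF dt(1) that])
      have "real (nat \<lfloor>t / dt\<rfloor>) \<le> t / dt" "t / dt \<le> real (nat \<lfloor>t / dt\<rfloor>) + 1"
        using that dt by (simp_all add: of_nat_nat less_imp_le)
      then show "real (nat \<lfloor>t / dt\<rfloor>) * dt \<le> t" "t \<le> real (nat \<lfloor>t / dt\<rfloor>) * dt + dt"
        using dt by (simp_all add: pos_le_divide_eq pos_divide_le_eq algebra_simps)
    qed
    show ?thesis
    proof (intro conjI allI impI ballI)
      fix t assume "0 \<le> t \<and> t < T"
      then have t: "0 \<le> t" "t \<le> T" by auto
      have n: "real (nat \<lfloor>t / dt\<rfloor>) * dt \<le> T" using le(1)[OF t] t by linarith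
      show "discrete_approx b P T dt f0 t \<in> L1_pos \<inter> B_space \<sigma>"
        unfolding eq[OF t] by (rule scheme_Suc_properties(1)[OF n])
      fix i :: nat
      show "integrable lborel (\<lambda>(x, v). invariant i v * discrete_approx b P T dt f0 t (x, v))"
        unfolding eq[OF t] using scheme_Suc_properties(2)[OF n, of i] by (simp add: split_def del: scheme.simps)
      show "(LINT (x, v)|lborel. invariant i v * discrete_approx b P T dt f0 t (x, v)) = (LINT (x, v)|lborel. invariant i v * f0 (x, v))"
        unfolding eq[OF t] using scheme_conservation[OF n, of i] by (simp add: split_def del: scheme.simps)
    next
      show "(SUP t\<in>{0..T}. L1_norm (\<lambda>z. discrete_approx b P T dt f0 t z - f t z)) \<le> ennreal (K1 * dt + K2 * partition_diameter P)"
      proof (rule SUP_least)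
        fix t assume "t \<in> {0..T}"
        then have t: "0 \<le> t" "t \<le> T" by auto
        have "L1_norm (\<lambda>z. discrete_approx b P T dt f0 t z - f t z)
            \<le> ennreal (((K_time * dt + K_space * partition_diameter P) * N + dt * (2 * exp 1 * (L + 1)\<^sup>2 * m)
                + dt * (L * exp (1 / (s1 - \<sigma>)) + C)) * w)"
          using scheme_L1_error[OF le[OF t] t(2)] unfolding eq[OF t]
          by (simp only: K_time_def K_space_def N_def C_def m_def w_def)
        also have "\<dots> \<le> ennreal (K1 * dt + K2 * partition_diameter P)"
        proof (rule ennreal_leI)
          have "((K_time * dt + K_space * partition_diameter P) * N + dt * (2 * exp 1 * (L + 1)\<^sup>2 * m)
              + dt * (L * exp (1 / (s1 - \<sigma>)) + C)) * w = (K1 - 1) * dt + (K2 - 1) * partition_diameter P"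
            by (simp add: K1_def K2_def D_def algebra_simps)
          also have "\<dots> \<le> K1 * dt + K2 * partition_diameter P"
            using dt diameter_nonneg by (intro add_mono mult_right_mono) auto
          finally show "((K_time * dt + K_space * partition_diameter P) * N + dt * (2 * exp 1 * (L + 1)\<^sup>2 * m)
              + dt * (L * exp (1 / (s1 - \<sigma>)) + C)) * w \<le> K1 * dt + K2 * partition_diameter P" .
        qed
        finally show "L1_norm (\<lambda>z. discrete_approx b P T dt f0 t z - f t z) \<le> ennreal (K1 * dt + K2 * partition_diameter P)" .
      qed
    qed
  qed
  show ?thesis
    by (rule exI[of _ Xs], rule exI[of _ Ts], rule exI[of _ K1], rule exI[of _ K2],
        rule conjI[OF thresholds(1)], rule conjI[OF thresholds(2)], rule conjI[OF thresholds(3)],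
        rule conjI[OF thresholds(4)], rule conjI[OF thresholds(5)], rule conjI[OF thresholds(6)],
        intro allI impI, elim conjE, rule main; assumption)
qed

end
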